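(* There exists an active statistical query algorithm that, for any dimension $d$, any $\epsilon\in(0,1)$ and any isotropic log-concave distribution $D$ on $\mathbb{R}^d$, learns the class $\mathcal{H}_d$ of homogeneous halfspaces over $D$ to accuracy $1-\epsilon$, in time $\mathrm{poly}(d,\log(1/\epsilon))$, using active statistical queries of query tolerance $\ge 1/\mathrm{poly}(d,\log(1/\epsilon))$ and filter tolerance $\Omega(\epsilon)$.
   Context: $\mathcal{H}_d$ is the class of functions $h_v(x)=\mathrm{sign}(\langle v,x\rangle)$ for unit vectors $v\in\mathbb{R}^d$. A distribution on $\mathbb{R}^d$ with density $f$ is log-concave if $\log f$ is concave, and isotropic if its mean is the origin and its covariance matrix is the identity. Active statistical queries (SQs). For a distribution $D$ on $X$ and a target $f:X\to\{-1,1\}$, and for a filter $\chi:X\to[0,1]$ with $\mathbf{E}_D[\chi]>0$, let $D_{|\chi}$ have density $D(x)\chi(x)/\mathbf{E}_D[\chi]$. An active SQ is a pair $(\chi,\phi)$, $\chi:X\to[0,1]$, $\phi:X\times\{-1,1\}\to[-1,1]$, with filter tolerance $\tau_0$ and query tolerance $\tau$; a valid response is any $\mu$ such that, if $\mathbf{E}_D[\chi]\ge\tau_0$, then $|\mu-\mathbf{E}_{x\sim D_{|\chi}}[\phi(x,f(x))]|\le\tau$ (any value is valid if $\mathbf{E}_D[\chi]<\tau_0$). An active SQ algorithm accesses the target only via active SQs (it may also ask target-independent queries $\varphi:X\to[-1,1]$ with tolerance $\tau$, answered by a value within $\tau$ of $\mathbf{E}_D[\varphi]$). It learns a class $C$ over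 $D$ to accuracy $1-\epsilon$ if for every target $f\in C$, whenever all queries receive valid responses, it outputs $h$ with $\mathbf{Pr}_{x\sim D}[h(x)\ne f(x)]\le\epsilon$. Asking a query counts as a unit-cost operation, so the running time also bounds the number of queries. *)

theory Defs
  imports "HOL-Probability.Probability"
begin

section \<open>Isotropic log-concave distributions and homogeneous halfspaces\<close>

text \<open>
  One algorithm has to serve all dimensions, so the dimension cannot be a type. A point of
  \<open>\<real>\<^sup>d\<close> is an element of \<open>{..<d} \<rightarrow>\<^sub>E UNIV\<close>, the underlying set of the product Lebesgue measure.
\<close>

abbreviation lebesgue_R :: "nat \<Rightarrow> (nat \<Rightarrow> real) measure" where
  "lebesgue_R d \<equiv> PiM {..<d} (\<lambda>_. lborel)"

text \<open>
  Concavity of \<open>log f\<close> as a function into \<open>[-\<infinity>, \<infinity>)\<close>: the inequality has content only where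
  \<open>f x\<close> and \<open>f y\<close> are positive, and there it forces \<open>f\<close> to be positive on the segment.
\<close>

definition log_concave_fun :: "nat \<Rightarrow> ((nat \<Rightarrow> real) \<Rightarrow> real) \<Rightarrow> bool" where
  "log_concave_fun d f \<longleftrightarrow>
     (\<forall>x \<in> {..<d} \<rightarrow>\<^sub>E UNIV. 0 \<le> f x) \<and>
     (\<forall>x \<in> {..<d} \<rightarrow>\<^sub>E UNIV. \<forall>y \<in> {..<d} \<rightarrow>\<^sub>E UNIV. \<forall>t \<in> {0..1}. 0 < f x \<longrightarrow> 0 < f y \<longrightarrow>
        (let z = restrict (\<lambda>i. (1 - t) * x i + t * y i) {..<d}
         in 0 < f z \<and> (1 - t) * ln (f x) + t * ln (f y) \<le> ln (f z)))"

definition log_concave :: "nat \<Rightarrow> (nat \<Rightarrow> real) measure \<Rightarrow> bool" where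
  "log_concave d D \<longleftrightarrow> prob_space D \<and>
     (\<exists>f. f \<in> borel_measurable (lebesgue_R d) \<and> log_concave_fun d f \<and>
          D = density (lebesgue_R d) (\<lambda>x. ennreal (f x)))"

definition isotropic :: "nat \<Rightarrow> (nat \<Rightarrow> real) measure \<Rightarrow> bool" where
  "isotropic d D \<longleftrightarrow>
     (\<forall>i<d. integrable D (\<lambda>x. x i) \<and> (\<integral>x. x i \<partial>D) = 0) \<and>
     (\<forall>i<d. \<forall>j<d. integrable D (\<lambda>x. x i * x j) \<and>
                    (\<integral>x. x i * x j \<partial>D) = (if i = j then 1 else 0))"

text \<open>The value of the sign at \<open>0\<close> is fixed to be \<open>1\<close>, so that halfspaces are \<open>{-1, 1}\<close>-valued.\<close>

definition halfspace :: "nat \<Rightarrow> (nat \<Rightarrow> real) \<Rightarrow> (nat \<Rightarrow> real) \<Rightarrow> real" where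
  "halfspace d v x = (if 0 \<le> (\<Sum>i<d. v i * x i) then 1 else - 1)"

definition halfspaces :: "nat \<Rightarrow> ((nat \<Rightarrow> real) \<Rightarrow> real) set" where
  "halfspaces d = {halfspace d v | v. v \<in> {..<d} \<rightarrow>\<^sub>E UNIV \<and> (\<Sum>i<d. (v i)\<^sup>2) = 1}"

section \<open>Active statistical queries\<close>

text \<open>Filters are called \<open>\<rho>\<close> because \<open>\<chi>\<close> is reserved for vector abstraction in the library.\<close>

definition filtered :: "'x measure \<Rightarrow> ('x \<Rightarrow> real) \<Rightarrow> 'x measure" where
  "filtered D \<rho> = density D (\<lambda>x. ennreal (\<rho> x / (\<integral>x. \<rho> x \<partial>D)))"

definition is_filter :: "'x measure \<Rightarrow> ('x \<Rightarrow> real) \<Rightarrow> bool" where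
  "is_filter D \<rho> \<longleftrightarrow> \<rho> \<in> borel_measurable D \<and> (\<forall>x \<in> space D. \<rho> x \<in> {0..1})"

definition is_query :: "'x measure \<Rightarrow> ('x \<Rightarrow> real \<Rightarrow> real) \<Rightarrow> bool" where
  "is_query D \<phi> \<longleftrightarrow>
     (\<forall>l \<in> {-1, 1}. (\<lambda>x. \<phi> x l) \<in> borel_measurable D \<and> (\<forall>x \<in> space D. \<phi> x l \<in> {-1..1}))"

definition is_unlabelled_query :: "'x measure \<Rightarrow> ('x \<Rightarrow> real) \<Rightarrow> bool" where
  "is_unlabelled_query D \<phi> \<longleftrightarrow> \<phi> \<in> borel_measurable D \<and> (\<forall>x \<in> space D. \<phi> x \<in> {-1..1})"

definition valid_response ::
  "'x measure \<Rightarrow> ('x \<Rightarrow> real) \<Rightarrow> ('x \<Rightarrow> real) \<Rightarrow> ('x \<Rightarrow> real \<Rightarrow> real) \<Rightarrow> real \<Rightarrow> real \<Rightarrow> real \<Rightarrow> bool" where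
  "valid_response D f \<rho> \<phi> \<tau>0 \<tau> \<mu> \<longleftrightarrow>
     ((\<integral>x. \<rho> x \<partial>D) \<ge> \<tau>0 \<longrightarrow> \<bar>\<mu> - (\<integral>x. \<phi> x (f x) \<partial>(filtered D \<rho>))\<bar> \<le> \<tau>)"

definition valid_unlabelled_response ::
  "'x measure \<Rightarrow> ('x \<Rightarrow> real) \<Rightarrow> real \<Rightarrow> real \<Rightarrow> bool" where
  "valid_unlabelled_response D \<phi> \<tau> \<mu> \<longleftrightarrow> \<bar>\<mu> - (\<integral>x. \<phi> x \<partial>D)\<bar> \<le> \<tau>"

section \<open>The machine model\<close>

text \<open>
  Algorithms are programs for a real-arithmetic random access machine: exact comparisons and
  field operations on reals at unit cost, rational constants only, and index registers for
  natural numbers with addition and truncated subtraction only. Real memory consists of arrays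
  named by constants in the program text. A program is a finite text that depends neither on
  the dimension nor on the accuracy, so charging one time unit per small step, irrespective of
  the size of the expressions in it, changes the running time by a constant factor only.
\<close>

record state =
  nreg :: "nat \<Rightarrow> nat"
  rmem :: "nat \<Rightarrow> nat \<Rightarrow> real"

datatype nexp = NConst nat | NReg nat | NPlus nexp nexp | NMinus nexp nexp

datatype rexp = RConst rat | ROfNat nexp | RMem nat nexp
  | RPlus rexp rexp | RMinus rexp rexp | RTimes rexp rexp | RDivide rexp rexp

datatype bexp = NLess nexp nexp | RLess rexp rexp | BNot bexp | BAnd bexp bexp

primrec nval :: "nexp \<Rightarrow> state \<Rightarrow> nat" where
  "nval (NConst n) s = n"
| "nval (NReg v) s = nreg s v"
| "nval (NPlus a b) s = nval a s + nval b s"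
| "nval (NMinus a b) s = nval a s - nval b s"

primrec rval :: "rexp \<Rightarrow> state \<Rightarrow> real" where
  "rval (RConst q) s = of_rat q"
| "rval (ROfNat e) s = real (nval e s)"
| "rval (RMem a e) s = rmem s a (nval e s)"
| "rval (RPlus a b) s = rval a s + rval b s"
| "rval (RMinus a b) s = rval a s - rval b s"
| "rval (RTimes a b) s = rval a s * rval b s"
| "rval (RDivide a b) s = rval a s / rval b s"

primrec bval :: "bexp \<Rightarrow> state \<Rightarrow> bool" where
  "bval (NLess a b) s = (nval a s < nval b s)"
| "bval (RLess a b) s = (rval a s < rval b s)"
| "bval (BNot b) s = (\<not> bval b s)"
| "bval (BAnd a b) s = (bval a s \<and> bval b s)"

text \<open>The parameter \<open>'q\<close> is the type of questions a program may ask.\<close>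

datatype 'q com =
    Skip
  | NAssign nat nexp
  | RAssign nat nexp rexp
  | Seq "'q com" "'q com"
  | If bexp "'q com" "'q com"
  | While bexp "'q com"
  | Ask 'q

definition store :: "nat \<Rightarrow> nat \<Rightarrow> real \<Rightarrow> state \<Rightarrow> state" where
  "store a i r s = s\<lparr>rmem := (rmem s)(a := (rmem s a)(i := r))\<rparr>"

text \<open>\<open>ans q s s'\<close> means that asking \<open>q\<close> in state \<open>s\<close> may lead to \<open>s'\<close>.\<close>

inductive step :: "('q \<Rightarrow> state \<Rightarrow> state \<Rightarrow> bool) \<Rightarrow> 'q com \<times> state \<Rightarrow> 'q com \<times> state \<Rightarrow> bool"
  for ans where
  step_NAssign: "step ans (NAssign v e, s) (Skip, s\<lparr>nreg := (nreg s)(v := nval e s)\<rparr>)"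
| step_RAssign: "step ans (RAssign a e r, s) (Skip, store a (nval e s) (rval r s) s)"
| step_Seq_Skip: "step ans (Seq Skip c, s) (c, s)"
| step_Seq: "step ans (c1, s) (c1', s') \<Longrightarrow> step ans (Seq c1 c2, s) (Seq c1' c2, s')"
| step_If_True: "bval b s \<Longrightarrow> step ans (If b c1 c2, s) (c1, s)"
| step_If_False: "\<not> bval b s \<Longrightarrow> step ans (If b c1 c2, s) (c2, s)"
| step_While: "step ans (While b c, s) (If b (Seq c (While b c)) Skip, s)"
| step_Ask: "ans q s s' \<Longrightarrow> step ans (Ask q, s) (Skip, s')"

subsection \<open>Functions computed by programs\<close>

text \<open>
  Filters, query functions and the output hypothesis are described by a program that asks no
  questions (for such a program \<^term>\<open>Ask ()\<close> is stuck), together with the contents of the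
  memory at the moment the description is used. To evaluate the function, the point is placed
  in array 1 and the label, if any, in cell 0 of array 2; the value is read from cell 0 of
  array 3. The memory changes made by an evaluation are discarded.
\<close>

type_synonym code = "unit com"

definition load_point :: "nat \<Rightarrow> (nat \<Rightarrow> real) \<Rightarrow> state \<Rightarrow> state" where
  "load_point d x s = s\<lparr>rmem := (rmem s)(1 := (\<lambda>i. if i < d then x i else 0))\<rparr>"

definition load_example :: "nat \<Rightarrow> (nat \<Rightarrow> real) \<Rightarrow> real \<Rightarrow> state \<Rightarrow> state" where
  "load_example d x l s = store 2 0 l (load_point d x s)"

definition computes_in :: "real \<Rightarrow> code \<Rightarrow> state \<Rightarrow> real \<Rightarrow> bool" where
  "computes_in T c s r \<longleftrightarrow>
     (\<exists>n s'. real n \<le> T \<and> (step (\<lambda>_ _ _. False) ^^ n) (c, s) (Skip, s') \<and> rmem s' 3 0 = r)"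

subsection \<open>Active SQ algorithms\<close>

text \<open>
  \<open>ActiveSQ \<rho> \<phi> \<tau>0 \<tau> a i\<close> asks the active query with filter program \<open>\<rho>\<close>, query program
  \<open>\<phi>\<close>, filter tolerance \<open>\<tau>0\<close> and query tolerance \<open>\<tau>\<close>, and stores the response in cell \<open>i\<close> of
  array \<open>a\<close>; \<open>UnlabelledSQ \<phi> \<tau> a i\<close> does the same for a target-independent query.
\<close>

datatype query =
    ActiveSQ code code rexp rexp nat nexp
  | UnlabelledSQ code rexp nat nexp

text \<open>
  The bound \<open>T\<close> limits the evaluation time of the functions in a query, \<open>\<tau>0min\<close> and \<open>\<tau>min\<close> are
  the least admissible tolerances. A query that violates any of these requirements, or whose
  functions do not have the required range, has no successor state. Every valid response to
  an admissible query is possible.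
\<close>

inductive response ::
  "nat \<Rightarrow> (nat \<Rightarrow> real) measure \<Rightarrow> ((nat \<Rightarrow> real) \<Rightarrow> real) \<Rightarrow> real \<Rightarrow> real \<Rightarrow> real \<Rightarrow>
   query \<Rightarrow> state \<Rightarrow> state \<Rightarrow> bool"
  for d D f T \<tau>0min \<tau>min where
  response_ActiveSQ:
    "\<lbrakk> is_filter D \<rho>; \<forall>x \<in> space D. computes_in T cf (load_point d x s) (\<rho> x);
       is_query D \<phi>; \<forall>x \<in> space D. \<forall>l \<in> {-1, 1}. computes_in T cq (load_example d x l s) (\<phi> x l);
       \<tau>0min \<le> rval t0 s; \<tau>min \<le> rval t s;
       valid_response D f \<rho> \<phi> (rval t0 s) (rval t s) \<mu> \<rbrakk>
     \<Longrightarrow> response d D f T \<tau>0min \<tau>min (ActiveSQ cf cq t0 t a i) s (store a (nval i s) \<mu> s)"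
| response_UnlabelledSQ:
    "\<lbrakk> is_unlabelled_query D \<psi>; \<forall>x \<in> space D. computes_in T cq (load_point d x s) (\<psi> x);
       \<tau>min \<le> rval t s;
       valid_unlabelled_response D \<psi> (rval t s) \<mu> \<rbrakk>
     \<Longrightarrow> response d D f T \<tau>0min \<tau>min (UnlabelledSQ cq t a i) s (store a (nval i s) \<mu> s)"

record sq_algorithm =
  main_prog :: "query com"
  hyp_prog :: code

text \<open>The input is the dimension, in index register 0, and \<open>\<epsilon>\<close>, in cell 0 of array 0.\<close>

definition init_state :: "nat \<Rightarrow> real \<Rightarrow> state" where
  "init_state d \<epsilon> = \<lparr>nreg = (\<lambda>_. 0)(0 := d), rmem = (\<lambda>_ _. 0)(0 := (\<lambda>_. 0)(0 := \<epsilon>))\<rparr>"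

definition good_output ::
  "nat \<Rightarrow> real \<Rightarrow> (nat \<Rightarrow> real) measure \<Rightarrow> ((nat \<Rightarrow> real) \<Rightarrow> real) \<Rightarrow> real \<Rightarrow> code \<Rightarrow> state \<Rightarrow> bool" where
  "good_output d \<epsilon> D f T ch s \<longleftrightarrow>
     (\<exists>h. h \<in> borel_measurable D \<and>
          (\<forall>x \<in> space D. h x \<in> {-1, 1} \<and> computes_in T ch (load_point d x s) (h x)) \<and>
          measure D {x \<in> space D. h x \<noteq> f x} \<le> \<epsilon>)"

text \<open>
  Quantification over all reachable configurations covers every way, adaptive or not, of
  giving valid responses. As all runs have length at most \<open>T\<close>, every run ends in a
  configuration without successor; such a configuration must be a regular halt, so that no
  inadmissible query is ever asked.
\<close>

definition learns ::
  "sq_algorithm \<Rightarrow> ((nat \<Rightarrow> real) \<Rightarrow> real) set \<Rightarrow> nat \<Rightarrow> real \<Rightarrow> (nat \<Rightarrow> real) measure \<Rightarrow>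
   real \<Rightarrow> real \<Rightarrow> real \<Rightarrow> bool" where
  "learns A C d \<epsilon> D T \<tau>0min \<tau>min \<longleftrightarrow>
     (\<forall>f \<in> C. \<forall>n c s.
        (step (response d D f T \<tau>0min \<tau>min) ^^ n) (main_prog A, init_state d \<epsilon>) (c, s) \<longrightarrow>
          real n \<le> T \<and>
          ((\<nexists>k. step (response d D f T \<tau>0min \<tau>min) (c, s) k) \<longrightarrow>
             c = Skip \<and> good_output d \<epsilon> D f T (hyp_prog A) s))"

end

theory Submission
  imports Defs
begin

text \<open>
  The learner keeps an iterate \<open>w\<close> and a bound \<open>\<delta>\<close> for the sine of its angle to the target \<open>v\<close>. It asks
  for the correlations of the label with the coordinates, filtered by the band
  \<open>|\<langle>w,x\<rangle>| \<le> \<beta>\<delta>\<close>. In the band the label is essentially the sign of \<open>\<langle>u,x\<rangle>\<close>, where \<open>u\<close> is the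
  component of \<open>v\<close> orthogonal to \<open>w\<close>, so these correlations have an inner product of order \<open>|u|\<close> with
  \<open>u\<close>, and a gradient step shrinks \<open>\<delta>\<close> by a factor \<open>1 - 1/poly(d)\<close>. Starting from \<open>w = 0\<close>, where the
  band is the whole space, this is repeated until \<open>\<delta>\<close> is of order \<open>\<epsilon>\<close>; the bands then have mass
  \<open>\<Omega>(\<epsilon>)\<close> throughout.

  The facts about the distribution (a thin slab of width \<open>b\<close> has mass of order \<open>b\<close>, most of it
  away from the axis; a wedge of angle \<open>\<delta>\<close> has mass \<open>O(\<delta>)\<close>) are all derived from moments and from
  \<open>P(A) P(B) \<le> P(C)\<^sup>2\<close> for sets with \<open>(A + B)/2 \<subseteq> C\<close>, the midpoint case of the
  Prekopa-Leindler inequality. No attempt is made to keep the numerical constants small.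
\<close>

section \<open>The Prekopa-Leindler inequality\<close>

text \<open>The machine has field operations and comparisons but no square root. Hence the iterate
  is never normalised, the filter compares squares, and the truncation radius is a multiple of
  \<open>d\<close> rather than of its root; the length of w is controlled by an invariant instead.
  The bound \<delta> is a fixed schedule, not an estimate: every round multiplies it by the same
  factor, whatever the responses were, and the analysis shows that it remains a valid bound.

  The filter tolerance forces the sharp form of the wedge estimate. Bounding a wedge by a slab plus
  an exponential tail gives only O(\<delta> log(1/\<delta>)); one would have to continue down to
  \<delta> of order \<epsilon>/log(1/\<epsilon>), and the bands would become too light. The
  logarithm disappears because, inside a thin slab, the mass far out in an orthogonal direction is
  itself proportional to the width of the slab.

  The constants descend from the lower bound 5/10^58 for the mass of a pair of opposite quadrants:
  1/10^71 is a slab width that is negligible against it, 10^30 a radius beyond which Chebyshev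
  leaves a negligible mass.\<close>

lemma emeasure_lborel_scale_shift:
  fixes K :: "real set"
  assumes "K \<in> sets borel"
  shows "2 * emeasure lborel ((\<lambda>x. x / 2 + c) ` K) = emeasure lborel K"
proof -
  have "emeasure lebesgue ((\<lambda>x. (1/2) *\<^sub>R x + c) ` K) = ennreal (\<bar>1/2\<bar> ^ DIM(real)) * emeasure lebesgue K"
    by (rule emeasure_lebesgue_affine)
  then have *: "emeasure lebesgue ((\<lambda>x. x / 2 + c) ` K) = ennreal (1/2) * emeasure lebesgue K"
    by simp
  have "(\<lambda>x. x / 2 + c) ` K = (\<lambda>y. 2 * (y - c)) -` K"
  proof -
    have "y \<in> (\<lambda>x. x / 2 + c) ` K" if "2 * (y - c) \<in> K" for y
      by (rule image_eqI[OF _ that]) (simp add: field_simps)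
    then show ?thesis by auto
  qed
  also have "\<dots> \<in> sets borel"
    using measurable_sets[of "\<lambda>y. 2 * (y - c)" borel borel K] assms by simp
  finally have m: "(\<lambda>x. x / 2 + c) ` K \<in> sets borel" .
  have "2 * emeasure lborel ((\<lambda>x. x / 2 + c) ` K) = 2 * (ennreal (1/2) * emeasure lborel K)"
    using * m assms by simp
  also have "\<dots> = ennreal (2 * (1/2)) * emeasure lborel K"
    by (subst ennreal_mult) (auto simp: mult.assoc)
  also have "\<dots> = emeasure lborel K" by simp
  finally show ?thesis .
qed

text \<open>With p = max K and q = min L, the sets (K + q)/2 and (L + p)/2 lie in \<open>C\<close>
  and meet at most in (p + q)/2, so their measures add up.\<close>

lemma midpoint_emeasure_compact:
  fixes K L C :: "real set"
  assumes "compact K" "compact L" "K \<noteq> {}" "L \<noteq> {}" and C: "C \<in> sets borel"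
    and mid: "\<And>a b. a \<in> K \<Longrightarrow> b \<in> L \<Longrightarrow> (a + b) / 2 \<in> C"
  shows "emeasure lborel K + emeasure lborel L \<le> 2 * emeasure lborel C"
proof -
  obtain p where p: "p \<in> K" "\<And>x. x \<in> K \<Longrightarrow> x \<le> p"
    using compact_attains_sup[OF assms(1,3)] by auto
  obtain q where q: "q \<in> L" "\<And>x. x \<in> L \<Longrightarrow> q \<le> x"
    using compact_attains_inf[OF assms(2,4)] by auto
  define X where "X = (\<lambda>x. x / 2 + q / 2) ` K"
  define Y where "Y = (\<lambda>x. x / 2 + p / 2) ` L"
  have cX: "compact X" unfolding X_def by (intro compact_continuous_image continuous_intros assms) auto
  have cY: "compact Y" unfolding Y_def by (intro compact_continuous_image continuous_intros assms) auto
  have XC: "X \<subseteq> C"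
    unfolding X_def using mid[OF _ q(1)] by (intro image_subsetI) (metis add_divide_distrib)
  have YC: "Y \<subseteq> C"
    unfolding Y_def using mid[OF p(1)] by (intro image_subsetI) (metis add_divide_distrib add.commute)
  have "X \<inter> Y \<subseteq> {(p + q) / 2}" using p(2) q(2)
    by (force simp: X_def Y_def field_simps)
  then have "emeasure lborel (X \<inter> Y) = 0"
    by (intro emeasure_lborel_countable countable_subset[of "X \<inter> Y" "{(p + q) / 2}"]) auto
  then have n: "X \<inter> Y \<in> null_sets lborel"
    using cX cY by (auto simp: null_sets_def borel_compact)
  have "emeasure lborel K + emeasure lborel L = 2 * (emeasure lborel X + emeasure lborel Y)"
    using emeasure_lborel_scale_shift[of K "q/2"] emeasure_lborel_scale_shift[of L "p/2"] assms(1,2)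
    by (simp add: X_def Y_def distrib_left borel_compact)
  also have "emeasure lborel X + emeasure lborel Y = emeasure lborel (X \<union> Y)"
    using cX cY n by (intro emeasure_Un'[symmetric]) (auto simp: borel_compact)
  also have "\<dots> \<le> emeasure lborel C"
    using XC YC C by (intro emeasure_mono) auto
  finally show ?thesis by (simp add: mult_left_mono)
qed

text \<open>Cutting with [-n, n] covers sets of infinite measure. A point of \<open>A\<close> is
  thrown in at the end because the compact case needs nonempty sets.\<close>

lemma exists_compact_inner:
  fixes A :: "real set"
  assumes A: "A \<in> sets borel" "A \<noteq> {}" and e: "0 < e" and t: "ennreal t < emeasure lborel A"
  shows "\<exists>K. compact K \<and> K \<noteq> {} \<and> K \<subseteq> A \<and> ennreal t \<le> emeasure lborel K + ennreal e"
proof -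
  obtain a where a: "a \<in> A" using A by auto
  define An where "An n = A \<inter> {- real n..real n}" for n :: nat
  have An: "An n \<in> sets borel" for n unfolding An_def using A by auto
  have "incseq An" unfolding An_def incseq_def by auto
  moreover have "(\<Union>n. An n) = A"
  proof -
    have "x \<in> (\<Union>n. An n)" if x: "x \<in> A" for x
    proof -
      obtain n where "\<bar>x\<bar> \<le> real n" using real_arch_simple by blast
      then have "x \<in> An n" using x by (auto simp: An_def)
      then show ?thesis by blast
    qed
    then show ?thesis by (auto simp: An_def)
  qed
  ultimately have "(\<lambda>n. emeasure lborel (An n)) \<longlonglongrightarrow> emeasure lborel A"
    using Lim_emeasure_incseq[of An lborel] An by auto
  then have "eventually (\<lambda>n. ennreal t < emeasure lborel (An n)) sequentially"
    using t by (rule order_tendstoD)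
  then obtain n where n: "ennreal t < emeasure lborel (An n)"
    unfolding eventually_sequentially by blast
  obtain T where T: "closed T" "T \<subseteq> An n" "An n - T \<in> lmeasurable" "emeasure lebesgue (An n - T) < ennreal e"
    using sets_lebesgue_inner_closed[of "An n" e] An e by auto
  define K where "K = insert a T"
  have cT: "compact T"
  proof -
    have "T = {- real n..real n} \<inter> T" using T(2) by (auto simp: An_def)
    then show ?thesis using T(1) compact_Int_closed[of "{- real n..real n}" T] by simp
  qed
  have "compact K" using cT by (simp add: K_def)
  moreover have "K \<subseteq> A" using T(2) a by (auto simp: K_def An_def)
  moreover have "ennreal t \<le> emeasure lborel K + ennreal e"
  proof -
    have "ennreal t \<le> emeasure lborel (T \<union> (An n - T))"
      using n T(2) by (simp add: Un_absorb1)
    also have "\<dots> \<le> emeasure lborel T + emeasure lborel (An n - T)"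
      using An T cT by (intro emeasure_subadditive) (auto simp: borel_compact)
    also have "emeasure lborel (An n - T) = emeasure lebesgue (An n - T)"
    proof -
      have "An n - T \<in> sets lborel" using An[of n] cT by (simp add: borel_compact sets.Diff)
      then show ?thesis by simp
    qed
    also have "emeasure lborel T + emeasure lebesgue (An n - T) \<le> emeasure lborel K + ennreal e"
      using T(4) cT by (intro add_mono emeasure_mono) (auto simp: K_def borel_compact less_imp_le)
    finally show ?thesis .
  qed
  ultimately show ?thesis unfolding K_def by blast
qed

text \<open>One-dimensional Brunn-Minkowski by compact approximation from inside. A Borel set
  \<open>C\<close> stands in for (A + B)/2, which need not be Borel.\<close>

lemma midpoint_emeasure:
  fixes A B C :: "real set"
  assumes A: "A \<in> sets borel" "A \<noteq> {}" and B: "B \<in> sets borel" "B \<noteq> {}" and C: "C \<in> sets borel"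
    and mid: "\<And>a b. a \<in> A \<Longrightarrow> b \<in> B \<Longrightarrow> (a + b) / 2 \<in> C"
  shows "emeasure lborel A + emeasure lborel B \<le> 2 * emeasure lborel C"
proof (rule ccontr)
  assume "\<not> ?thesis"
  then have less: "2 * emeasure lborel C < emeasure lborel A + emeasure lborel B" by simp
  have approx: "\<exists>K. compact K \<and> K \<noteq> {} \<and> K \<subseteq> S \<and> ennreal t - ennreal e \<le> emeasure lborel K"
    if "S \<in> sets borel" "S \<noteq> {}" "0 < e" "ennreal t \<le> emeasure lborel S" "0 \<le> t" for S :: "real set" and t e :: real
  proof (cases "t = 0")
    case True
    from that(2) obtain a where "a \<in> S" by auto
    then show ?thesis using True by (intro exI[of _ "{a}"]) auto
  next
    case False
    with that have "t > 0" by simp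
    then have "ennreal (t - min t e / 2) < ennreal t" using that by (subst ennreal_less_iff) auto
    with that(4) have "ennreal (t - min t e / 2) < emeasure lborel S" by (rule order_less_le_trans[rotated])
    moreover have "0 < e / 2" using that by simp
    ultimately obtain K
      where K: "compact K" "K \<noteq> {}" "K \<subseteq> S" "ennreal (t - min t e / 2) \<le> emeasure lborel K + ennreal (e/2)"
      using exists_compact_inner[OF \<open>S \<in> sets borel\<close> \<open>S \<noteq> {}\<close>] by blast
    have "ennreal t - ennreal e = ennreal (t - e)" using that by (simp add: ennreal_minus)
    also have "\<dots> \<le> emeasure lborel K"
    proof (cases "emeasure lborel K")
      case (real r)
      then have "ennreal (t - min t e / 2) \<le> ennreal (r + e/2)" using K(4) that by simp
      then have "t - min t e / 2 \<le> r + e/2" using real \<open>0 < e\<close> by (subst (asm) ennreal_le_iff) auto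
      then have "t - e \<le> r" by (auto simp: min_def split: if_splits)
      then show ?thesis using real by (simp add: ennreal_leI)
    qed simp
    finally show ?thesis using K by auto
  qed
  obtain c where c: "0 \<le> c" "emeasure lborel C = ennreal c"
    using less by (cases "emeasure lborel C") (auto simp: ennreal_mult_top)
  \<comment> \<open>Finite lower bounds \<open>s\<close>, \<open>t\<close> that exceed 2c by more
    than 2e; when one of the measures is infinite, 2c + 3 serves for it.\<close>
  have "\<exists>s t e. 0 \<le> s \<and> 0 \<le> t \<and> 0 < e \<and> ennreal s \<le> emeasure lborel A \<and> ennreal t \<le> emeasure lborel B \<and>
    2 * c < s + t - 2 * e"
  proof (cases "emeasure lborel A")
    case (real a)
    show ?thesis
    proof (cases "emeasure lborel B")
      case (real b)
      have "ennreal (2 * c) < ennreal (a + b)"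
        using less c real \<open>emeasure lborel A = ennreal a\<close> \<open>0 \<le> a\<close> by (simp add: ennreal_mult)
      then have l: "2 * c < a + b" using c by (subst (asm) ennreal_less_iff) auto
      show ?thesis using real \<open>emeasure lborel A = ennreal a\<close> \<open>0 \<le> a\<close> l
        by (intro exI[of _ a] exI[of _ b] exI[of _ "(a + b - 2 * c) / 4"]) (auto simp: field_simps)
    next
      case top
      show ?thesis using c top by (intro exI[of _ 0] exI[of _ "2 * c + 3"] exI[of _ 1]) auto
    qed
  next
    case top
    show ?thesis using c top by (intro exI[of _ "2 * c + 3"] exI[of _ 0] exI[of _ 1]) auto
  qed
  then obtain s t e where ste: "0 \<le> s" "0 \<le> t" "0 < e" "ennreal s \<le> emeasure lborel A"
    "ennreal t \<le> emeasure lborel B" "2 * c < s + t - 2 * e" by blast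
  obtain K where K: "compact K" "K \<noteq> {}" "K \<subseteq> A" "ennreal s - ennreal e \<le> emeasure lborel K"
    using approx[OF A ste(3,4,1)] by blast
  obtain L where L: "compact L" "L \<noteq> {}" "L \<subseteq> B" "ennreal t - ennreal e \<le> emeasure lborel L"
    using approx[OF B ste(3,5,2)] by blast
  have "emeasure lborel K + emeasure lborel L \<le> 2 * emeasure lborel C"
    using K L mid by (intro midpoint_emeasure_compact C) auto
  also have "\<dots> = ennreal (2 * c)" using c by (simp add: ennreal_mult)
  finally have KL: "emeasure lborel K + emeasure lborel L \<le> ennreal (2 * c)" .
  have "ennreal (s - e) + ennreal (t - e) \<le> ennreal (2 * c)"
    using K(4) L(4) ste by (intro order.trans[OF add_mono KL]) (auto simp: ennreal_minus)
  moreover have "ennreal (s - e + (t - e)) \<le> ennreal (s - e) + ennreal (t - e)"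
  proof -
    have "ennreal (s - e + (t - e)) \<le> ennreal (max 0 (s - e) + max 0 (t - e))"
      by (intro ennreal_leI add_mono) auto
    also have "\<dots> = ennreal (s - e) + ennreal (t - e)"
    proof -
      have "ennreal (max 0 x) = ennreal x" for x by (cases "0 \<le> x") (auto simp: max_def ennreal_neg)
      then show ?thesis by (subst ennreal_plus) auto
    qed
    finally show ?thesis .
  qed
  ultimately have "ennreal (s - e + (t - e)) \<le> ennreal (2 * c)" by order
  then show False using c ste by (subst (asm) ennreal_le_iff) auto
qed

section \<open>From sets to functions: the inequality on the line, then on products\<close>

lemma nn_integral_layer_cake:
  fixes f :: "real \<Rightarrow> ennreal"
  assumes [measurable]: "f \<in> borel_measurable borel" and le: "\<And>x. f x \<le> 1"
  shows "(\<integral>\<^sup>+x. f x \<partial>lborel) = (\<integral>\<^sup>+t. emeasure lborel {x. ennreal t < f x} * indicator {0..<1} t \<partial>lborel)"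
proof -
  have "(\<integral>\<^sup>+x. f x \<partial>lborel) = (\<integral>\<^sup>+x. (\<integral>\<^sup>+t. indicator {x. ennreal t < f x} x * indicator {0..<1} t \<partial>lborel) \<partial>lborel)"
  proof (intro nn_integral_cong)
    fix x :: real
    have "f x \<noteq> top" using le[of x] by (auto simp: top_unique)
    then obtain r where r: "f x = ennreal r" "0 \<le> r" by (cases "f x") auto
    then have "r \<le> 1" using le[of x] by (simp add: ennreal_le_1)
    have "(\<integral>\<^sup>+t. indicator {x. ennreal t < f x} x * indicator {0..<1} t \<partial>lborel) =
      (\<integral>\<^sup>+t. indicator {0..<r} t \<partial>lborel)"
      using r \<open>r \<le> 1\<close> by (intro nn_integral_cong) (auto simp: indicator_def ennreal_less_iff)
    also have "\<dots> = f x" using r by simp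
    finally show "f x = (\<integral>\<^sup>+t. indicator {x. ennreal t < f x} x * indicator {0..<1} t \<partial>lborel)" ..
  qed
  also have "\<dots> = (\<integral>\<^sup>+t. (\<integral>\<^sup>+x. indicator {x. ennreal t < f x} x * indicator {0..<1} t \<partial>lborel) \<partial>lborel)"
  proof (rule lborel_pair.Fubini'[symmetric])
    have "{z \<in> space (lborel \<Otimes>\<^sub>M lborel). ennreal (snd z) < f (fst z)} \<in> sets (lborel \<Otimes>\<^sub>M lborel)"
      by measurable
    then have [measurable]: "{z. ennreal (snd z) < f (fst z)} \<in> sets (lborel \<Otimes>\<^sub>M lborel)"
      by (simp add: space_pair_measure)
    have "(\<lambda>z. indicator {z. ennreal (snd z) < f (fst z)} z * (indicator {0..<1} (snd z) :: ennreal)) \<in> borel_measurable (lborel \<Otimes>\<^sub>M lborel)"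
      by measurable
    then show "(\<lambda>(x, t). indicator {x. ennreal t < f x} x * (indicator {0..<1} t :: ennreal)) \<in> borel_measurable (lborel \<Otimes>\<^sub>M lborel)"
      by (simp add: indicator_def case_prod_beta)
  qed
  also have "\<dots> = (\<integral>\<^sup>+t. emeasure lborel {x. ennreal t < f x} * indicator {0..<1} t \<partial>lborel)"
    by (intro nn_integral_cong) (simp add: nn_integral_multc)
  finally show ?thesis .
qed

text \<open>As both suprema are 1, the level sets of \<open>f\<close> and \<open>g\<close> are
  nonempty for the same t < 1, so Brunn-Minkowski applies level by level. This bounds the sum of the
  integrals, which is stronger than the product form.\<close>

lemma prekopa_leindler_normalized:
  fixes f g h :: "real \<Rightarrow> ennreal"
  assumes [measurable]: "f \<in> borel_measurable borel" "g \<in> borel_measurable borel" "h \<in> borel_measurable borel"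
    and f: "(SUP x. f x) = 1" and g: "(SUP x. g x) = 1"
    and mid: "\<And>x y. f x * g y \<le> (h ((x + y) / 2))\<^sup>2"
  shows "(\<integral>\<^sup>+x. f x \<partial>lborel) + (\<integral>\<^sup>+x. g x \<partial>lborel) \<le> 2 * (\<integral>\<^sup>+x. h x \<partial>lborel)"
proof -
  \<comment> \<open>Only the levels t < 1 matter, and the layer-cake formula is stated for functions
    bounded by 1.\<close>
  define k where "k x = min (h x) 1" for x
  have [measurable]: "k \<in> borel_measurable borel" unfolding k_def by measurable
  have f1: "f x \<le> 1" for x using f by (metis SUP_upper UNIV_I)
  have g1: "g x \<le> 1" for x using g by (metis SUP_upper UNIV_I)
  have k1: "k x \<le> 1" for x by (simp add: k_def)
  have level: "emeasure lborel {x. ennreal t < f x} + emeasure lborel {x. ennreal t < g x}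
      \<le> 2 * emeasure lborel {x. ennreal t < k x}" if t: "0 \<le> t" "t < 1" for t
  proof (rule midpoint_emeasure)
    have "ennreal t < 1" using t by simp
    then show "{x. ennreal t < f x} \<noteq> {}" "{x. ennreal t < g x} \<noteq> {}"
      using f g less_SUP_iff[of "ennreal t" f UNIV] less_SUP_iff[of "ennreal t" g UNIV] by auto
    fix x y assume "x \<in> {x. ennreal t < f x}" "y \<in> {x. ennreal t < g x}"
    then have xy: "ennreal t < f x" "ennreal t < g y" by auto
    show "(x + y) / 2 \<in> {x. ennreal t < k x}"
    proof (rule ccontr)
      assume "(x + y) / 2 \<notin> {x. ennreal t < k x}"
      then have "h ((x + y) / 2) \<le> ennreal t" using t by (auto simp: k_def min_def split: if_splits)
      then have "f x * g y \<le> (ennreal t)\<^sup>2" using mid[of x y] by (meson order_trans power_mono zero_le)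
      moreover obtain a where a: "f x = ennreal a" "0 \<le> a" using f1[of x] by (cases "f x") (auto simp: top_unique)
      moreover obtain b where b: "g y = ennreal b" "0 \<le> b" using g1[of y] by (cases "g y") (auto simp: top_unique)
      ultimately have "ennreal (a * b) \<le> ennreal (t\<^sup>2)"
        using t by (simp add: ennreal_mult ennreal_power)
      then have "a * b \<le> t\<^sup>2" by (subst (asm) ennreal_le_iff) auto
      moreover have "t < a" "t < b" using xy a b t by (auto simp: ennreal_less_iff)
      ultimately show False using t mult_strict_mono[of t a t b] by (auto simp: power2_eq_square)
    qed
  qed measurable
  have "(\<integral>\<^sup>+x. f x \<partial>lborel) + (\<integral>\<^sup>+x. g x \<partial>lborel) =
     (\<integral>\<^sup>+t. (emeasure lborel {x. ennreal t < f x} + emeasure lborel {x. ennreal t < g x}) * indicator {0..<1} t \<partial>lborel)"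
    using f1 g1 by (simp add: nn_integral_layer_cake distrib_right nn_integral_add)
  also have "\<dots> \<le> (\<integral>\<^sup>+t. 2 * (emeasure lborel {x. ennreal t < k x} * indicator {0..<1} t) \<partial>lborel)"
    using level by (intro nn_integral_mono) (auto simp: indicator_def)
  also have "\<dots> = 2 * (\<integral>\<^sup>+x. k x \<partial>lborel)"
    using k1 by (simp add: nn_integral_layer_cake nn_integral_cmult)
  also have "\<dots> \<le> 2 * (\<integral>\<^sup>+x. h x \<partial>lborel)"
    by (intro mult_left_mono nn_integral_mono) (auto simp: k_def)
  finally show ?thesis .
qed

text \<open>Scale both suprema to 1 and \<open>h\<close> by 1/sqrt(ab); AM-GM turns the resulting
  bound on the sum into one on the product.\<close>

lemma prekopa_leindler_bounded:
  fixes f g h :: "real \<Rightarrow> ennreal"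
  assumes [measurable]: "f \<in> borel_measurable borel" "g \<in> borel_measurable borel" "h \<in> borel_measurable borel"
    and f: "\<And>x. f x \<le> ennreal A" and g: "\<And>x. g x \<le> ennreal B"
    and mid: "\<And>x y. f x * g y \<le> (h ((x + y) / 2))\<^sup>2"
  shows "(\<integral>\<^sup>+x. f x \<partial>lborel) * (\<integral>\<^sup>+x. g x \<partial>lborel) \<le> (\<integral>\<^sup>+x. h x \<partial>lborel)\<^sup>2"
proof -
  have "(SUP x. f x) \<le> ennreal A" "(SUP x. g x) \<le> ennreal B" using f g by (auto intro: SUP_least)
  then obtain a b where a: "(SUP x. f x) = ennreal a" "0 \<le> a" and b: "(SUP x. g x) = ennreal b" "0 \<le> b"
    by (cases "SUP x. f x"; cases "SUP x. g x") (auto simp: top_unique)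
  have fa: "f x \<le> ennreal a" for x using a by (metis SUP_upper UNIV_I)
  have gb: "g x \<le> ennreal b" for x using b by (metis SUP_upper UNIV_I)
  show ?thesis
  proof (cases "a = 0 \<or> b = 0")
    case True
    then have "(\<forall>x. f x = 0) \<or> (\<forall>x. g x = 0)" using fa gb by auto
    then show ?thesis by auto
  next
    case False
    with a b have ab: "0 < a" "0 < b" by auto
    let ?F = "\<integral>\<^sup>+x. f x \<partial>lborel" and ?G = "\<integral>\<^sup>+x. g x \<partial>lborel" and ?H = "\<integral>\<^sup>+x. h x \<partial>lborel"
    have sq: "(ennreal (1 / sqrt (a * b)))\<^sup>2 = ennreal (1 / a) * ennreal (1 / b)"
      using ab by (simp add: ennreal_power power_divide flip: ennreal_mult)
    have "(\<integral>\<^sup>+x. ennreal (1/a) * f x \<partial>lborel) + (\<integral>\<^sup>+x. ennreal (1/b) * g x \<partial>lborel)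
       \<le> 2 * (\<integral>\<^sup>+x. ennreal (1 / sqrt (a * b)) * h x \<partial>lborel)"
    proof (rule prekopa_leindler_normalized)
      have "(SUP x. ennreal (1/a) * f x) = ennreal (1/a) * ennreal a"
        using a by (simp add: SUP_mult_left_ennreal[symmetric])
      then show "(SUP x. ennreal (1/a) * f x) = 1" using ab by (simp flip: ennreal_mult)
      have "(SUP x. ennreal (1/b) * g x) = ennreal (1/b) * ennreal b"
        using b by (simp add: SUP_mult_left_ennreal[symmetric])
      then show "(SUP x. ennreal (1/b) * g x) = 1" using ab by (simp flip: ennreal_mult)
      fix x y
      have "ennreal (1/a) * f x * (ennreal (1/b) * g y) = ennreal (1/a) * ennreal (1/b) * (f x * g y)"
        by (simp only: mult_ac)
      also have "\<dots> \<le> (ennreal (1 / sqrt (a * b)))\<^sup>2 * (h ((x + y) / 2))\<^sup>2"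
        unfolding sq by (intro mult_left_mono mid) auto
      finally show "ennreal (1/a) * f x * (ennreal (1/b) * g y) \<le> (ennreal (1 / sqrt (a * b)) * h ((x + y) / 2))\<^sup>2"
        by (simp add: power_mult_distrib)
    qed measurable
    then have le: "ennreal (1/a) * ?F + ennreal (1/b) * ?G \<le> 2 * (ennreal (1 / sqrt (a * b)) * ?H)"
      by (simp add: nn_integral_cmult)
    show ?thesis
    proof (cases ?H)
      case (real H)
      then have "2 * (ennreal (1 / sqrt (a * b)) * ?H) < top" by (simp add: ennreal_mult_less_top)
      with le have "ennreal (1/a) * ?F + ennreal (1/b) * ?G < top" by order
      then have "?F \<noteq> top" "?G \<noteq> top" using ab by (auto simp: ennreal_mult_top)
      then obtain F G where F: "?F = ennreal F" "0 \<le> F" and G: "?G = ennreal G" "0 \<le> G"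
        by (cases ?F; cases ?G) auto
      have "ennreal (F / a + G / b) \<le> ennreal (2 * H / sqrt (a * b))"
        using le F G real ab by (simp flip: ennreal_mult ennreal_plus ennreal_numeral)
      then have le': "F / a + G / b \<le> 2 * H / sqrt (a * b)"
        using real ab by (subst (asm) ennreal_le_iff) auto
      have "4 * (F / a * (G / b)) \<le> (F / a + G / b)\<^sup>2"
        using sum_squares_bound[of "F/a" "G/b"] by (simp add: power2_sum)
      also have "\<dots> \<le> (2 * H / sqrt (a * b))\<^sup>2" using le' F G ab by (intro power_mono) auto
      also have "\<dots> = 4 * (H\<^sup>2 / (a * b))" using ab by (simp add: power_divide power_mult_distrib)
      finally have "F * G \<le> H\<^sup>2" using ab by (simp add: field_simps)
      then show ?thesis using F G real by (simp add: ennreal_power ennreal_leI flip: ennreal_mult)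
    qed (simp add: power2_eq_square)
  qed
qed

lemma prekopa_leindler_line:
  fixes f g h :: "real \<Rightarrow> ennreal"
  assumes [measurable]: "f \<in> borel_measurable borel" "g \<in> borel_measurable borel" "h \<in> borel_measurable borel"
    and mid: "\<And>x y. f x * g y \<le> (h ((x + y) / 2))\<^sup>2"
  shows "(\<integral>\<^sup>+x. f x \<partial>lborel) * (\<integral>\<^sup>+x. g x \<partial>lborel) \<le> (\<integral>\<^sup>+x. h x \<partial>lborel)\<^sup>2"
proof -
  have cut: "(\<integral>\<^sup>+x. u x \<partial>lborel) = (SUP n. \<integral>\<^sup>+x. min (u x) (ennreal (real n)) \<partial>lborel)"
    if [measurable]: "u \<in> borel_measurable borel" for u :: "real \<Rightarrow> ennreal"
  proof -
    have "(SUP n. min (u x) (ennreal (real n))) = u x" for x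
    proof -
      have "(SUP n. min (u x) (of_nat n)) = min (u x) (SUP n. of_nat n)"
        by (simp add: inf_min[symmetric] inf_SUP)
      also have "(SUP n. of_nat n :: ennreal) = top" by (rule ennreal_SUP_of_nat_eq_top)
      finally show ?thesis unfolding ennreal_of_nat_eq_real_of_nat by simp
    qed
    then have "(\<integral>\<^sup>+x. u x \<partial>lborel) = (\<integral>\<^sup>+x. (SUP n. min (u x) (ennreal (real n))) \<partial>lborel)" by simp
    also have "\<dots> = (SUP n. \<integral>\<^sup>+x. min (u x) (ennreal (real n)) \<partial>lborel)"
      by (intro nn_integral_monotone_convergence_SUP) (auto simp: incseq_def le_fun_def intro!: min.mono ennreal_leI min.coboundedI2)
    finally show ?thesis .
  qed
  have "(\<integral>\<^sup>+x. min (f x) (ennreal (real m)) \<partial>lborel) * (\<integral>\<^sup>+x. min (g x) (ennreal (real n)) \<partial>lborel)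
      \<le> (\<integral>\<^sup>+x. h x \<partial>lborel)\<^sup>2" for m n :: nat
    by (rule prekopa_leindler_bounded[where A="real m" and B="real n"])
       (auto intro!: order.trans[OF mult_mono mid])
  then show ?thesis
    unfolding cut[OF assms(1)] cut[OF assms(2)] SUP_mult_left_ennreal SUP_mult_right_ennreal
    by (intro SUP_least)
qed

text \<open>Induction on the index set: after integrating over the inserted coordinate, the three
  functions of the remaining ones satisfy the hypothesis again, by the inequality on the
  line.\<close>

theorem prekopa_leindler:
  fixes f g h :: "('i \<Rightarrow> real) \<Rightarrow> ennreal"
  assumes "finite I"
    and "f \<in> borel_measurable (PiM I (\<lambda>_. lborel))" "g \<in> borel_measurable (PiM I (\<lambda>_. lborel))"
      "h \<in> borel_measurable (PiM I (\<lambda>_. lborel))"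
    and "\<And>x y. x \<in> I \<rightarrow>\<^sub>E UNIV \<Longrightarrow> y \<in> I \<rightarrow>\<^sub>E UNIV \<Longrightarrow>
       f x * g y \<le> (h (restrict (\<lambda>i. (x i + y i) / 2) I))\<^sup>2"
  shows "(\<integral>\<^sup>+x. f x \<partial>PiM I (\<lambda>_. lborel)) * (\<integral>\<^sup>+x. g x \<partial>PiM I (\<lambda>_. lborel)) \<le>
    (\<integral>\<^sup>+x. h x \<partial>PiM I (\<lambda>_. lborel))\<^sup>2"
  using assms
proof (induction I arbitrary: f g h rule: finite_induct)
  case empty
  have "(\<integral>\<^sup>+x. u x \<partial>PiM {} (\<lambda>_. lborel)) = u (\<lambda>_. undefined)" for u :: "('i \<Rightarrow> real) \<Rightarrow> ennreal"
    using product_sigma_finite.nn_integral_empty[of "\<lambda>_::'i. lborel :: real measure" u]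
    by (simp add: product_sigma_finite_def sigma_finite_lborel)
  then show ?case using empty(4)[of "\<lambda>_. undefined" "\<lambda>_. undefined"] by (simp add: restrict_def)
next
  case (insert i I)
  interpret P: product_sigma_finite "\<lambda>_::'i. lborel :: real measure" by standard
  note [measurable] = insert.prems(1-3)
  have ins: "integral\<^sup>N (PiM (insert i I) (\<lambda>_. lborel)) u =
     (\<integral>\<^sup>+x. (\<integral>\<^sup>+t. u (x(i := t)) \<partial>lborel) \<partial>PiM I (\<lambda>_. lborel))"
    if "u \<in> borel_measurable (PiM (insert i I) (\<lambda>_. lborel))" for u :: "('i \<Rightarrow> real) \<Rightarrow> ennreal"
    using P.product_nn_integral_insert[OF insert.hyps that] .
  have meas: "(\<lambda>x. \<integral>\<^sup>+t. u (x(i := t)) \<partial>lborel) \<in> borel_measurable (PiM I (\<lambda>_. lborel))"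
    if [measurable]: "u \<in> borel_measurable (PiM (insert i I) (\<lambda>_. lborel))" for u :: "('i \<Rightarrow> real) \<Rightarrow> ennreal"
    by measurable
  have slice: "(\<lambda>t. u (x(i := t))) \<in> borel_measurable borel"
    if [measurable]: "u \<in> borel_measurable (PiM (insert i I) (\<lambda>_. lborel))" and x: "x \<in> I \<rightarrow>\<^sub>E UNIV"
    for u :: "('i \<Rightarrow> real) \<Rightarrow> ennreal" and x
  proof -
    have "(\<lambda>t. x(i := t)) \<in> measurable lborel (PiM (insert i I) (\<lambda>_. lborel))"
      using x by (intro measurable_fun_upd[where J=I]) (auto simp: space_PiM)
    from measurable_compose[OF this that(1)] show ?thesis by simp
  qed
  show ?case
    unfolding ins[OF insert.prems(1)] ins[OF insert.prems(2)] ins[OF insert.prems(3)]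
  proof (rule insert.IH[OF meas meas meas])
    fix x y :: "'i \<Rightarrow> real" assume xy: "x \<in> I \<rightarrow>\<^sub>E UNIV" "y \<in> I \<rightarrow>\<^sub>E UNIV"
    let ?z = "restrict (\<lambda>i. (x i + y i) / 2) I"
    have z: "?z \<in> I \<rightarrow>\<^sub>E UNIV" by auto
    show "(\<integral>\<^sup>+t. f (x(i := t)) \<partial>lborel) * (\<integral>\<^sup>+t. g (y(i := t)) \<partial>lborel) \<le> (\<integral>\<^sup>+t. h (?z(i := t)) \<partial>lborel)\<^sup>2"
    proof (rule prekopa_leindler_line)
      fix s t
      have xs: "x(i := s) \<in> insert i I \<rightarrow>\<^sub>E UNIV" and yt: "y(i := t) \<in> insert i I \<rightarrow>\<^sub>E UNIV"
        using xy by (auto simp: PiE_def extensional_def)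
      have eq: "restrict (\<lambda>j. ((x(i := s)) j + (y(i := t)) j) / 2) (insert i I) = ?z(i := (s + t) / 2)"
        using insert.hyps by (auto simp: restrict_def)
      show "f (x(i := s)) * g (y(i := t)) \<le> (h (?z(i := (s + t) / 2)))\<^sup>2"
        using insert.prems(4)[OF xs yt] unfolding eq .
    qed (intro slice xy z insert.prems)+
  qed (intro insert.prems)+
qed

lemma log_concave_measure_midpoint:
  assumes D: "log_concave d D"
    and [measurable]: "A \<in> sets D" "B \<in> sets D" "C \<in> sets D"
    and mid: "\<And>x y. x \<in> A \<Longrightarrow> y \<in> B \<Longrightarrow> restrict (\<lambda>i. (x i + y i) / 2) {..<d} \<in> C"
  shows "measure D A * measure D B \<le> (measure D C)\<^sup>2"
proof -
  from D interpret prob_space D by (simp add: log_concave_def)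
  from D obtain f where f[measurable]: "f \<in> borel_measurable (lebesgue_R d)" and lc: "log_concave_fun d f"
    and Deq: "D = density (lebesgue_R d) (\<lambda>x. ennreal (f x))"
    by (auto simp: log_concave_def)
  have sD: "sets D = sets (lebesgue_R d)" unfolding Deq by simp
  have em: "emeasure D S = (\<integral>\<^sup>+x. ennreal (f x) * indicator S x \<partial>lebesgue_R d)" if "S \<in> sets D" for S
    unfolding Deq using that sD by (subst emeasure_density) auto
  have [measurable]: "A \<in> sets (lebesgue_R d)" "B \<in> sets (lebesgue_R d)" "C \<in> sets (lebesgue_R d)"
    using assms(2-4) sD by auto
  have "emeasure D A * emeasure D B \<le> (emeasure D C)\<^sup>2"
    unfolding em[OF assms(2)] em[OF assms(3)] em[OF assms(4)]
  proof (rule prekopa_leindler)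
    fix x y :: "nat \<Rightarrow> real" assume xy: "x \<in> {..<d} \<rightarrow>\<^sub>E UNIV" "y \<in> {..<d} \<rightarrow>\<^sub>E UNIV"
    let ?z = "restrict (\<lambda>i. (x i + y i) / 2) {..<d}"
    have nn: "0 \<le> f x" "0 \<le> f y" "0 \<le> f ?z" using lc xy by (auto simp: log_concave_fun_def)
    have zeq: "restrict (\<lambda>i. (1 - 1/2) * x i + 1/2 * y i) {..<d} = ?z"
      by (auto simp: restrict_def add_divide_distrib)
    have "f x * f y \<le> (f ?z)\<^sup>2"
    proof (cases "0 < f x \<and> 0 < f y")
      case True
      then have "0 < f ?z \<and> (1 - 1/2) * ln (f x) + 1/2 * ln (f y) \<le> ln (f ?z)"
        using lc xy unfolding log_concave_fun_def Let_def
        by (elim conjE) (drule bspec[of _ _ x], assumption, drule bspec[of _ _ y], assumption,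
          drule bspec[of _ _ "1/2"], simp, simp only: zeq simp_thms)
      then have "ln (f x) + ln (f y) \<le> 2 * ln (f ?z)" "0 < f ?z" by auto
      then have "ln (f x * f y) \<le> ln ((f ?z)\<^sup>2)" using True by (simp add: ln_mult ln_realpow)
      then show ?thesis using True \<open>0 < f ?z\<close> by (subst (asm) ln_le_cancel_iff) auto
    next
      case False
      then have "f x = 0 \<or> f y = 0" using nn by linarith
      then show ?thesis by auto
    qed
    then have "ennreal (f x) * ennreal (f y) \<le> (ennreal (f ?z))\<^sup>2"
      using nn(1,2) by (simp add: ennreal_power ennreal_leI nn(3) flip: ennreal_mult)
    then show "ennreal (f x) * indicator A x * (ennreal (f y) * indicator B y) \<le> (ennreal (f ?z) * indicator C ?z)\<^sup>2"
      using mid[of x y] by (auto simp: indicator_def)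
  qed auto
  then show ?thesis
    by (simp add: emeasure_eq_measure ennreal_power flip: ennreal_mult)
qed

section \<open>Log-concave interval masses\<close>

text \<open>An abstraction of the mass of [p, q) under a log-concave measure on the line. Arguing
  with windows of small length instead of a density means that densities of marginals never have to
  be constructed.\<close>

locale log_concave_mass =
  fixes m :: "real \<Rightarrow> real \<Rightarrow> real"
  assumes nonneg: "0 \<le> m p q"
    and add: "p \<le> q \<Longrightarrow> q \<le> r \<Longrightarrow> m p q + m q r = m p r"
    and mid: "m p q * m p' q' \<le> (m ((p + p') / 2) ((q + q') / 2))\<^sup>2"
begin

lemma mono: "p' \<le> p \<Longrightarrow> p \<le> q \<Longrightarrow> q \<le> q' \<Longrightarrow> m p q \<le> m p' q'"
  using add[of p' p q] add[of p' q q'] nonneg[of p' p] nonneg[of q q'] by simp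

lemma sum_steps:
  assumes "0 \<le> h"
  shows "(\<Sum>j<n. m (p + real j * h) (p + real (Suc j) * h)) = m p (p + real n * h)"
proof (induction n)
  case 0
  show ?case using add[of p p p] by simp
next
  case (Suc n)
  then show ?case using assms add[of p "p + real n * h" "p + real (Suc n) * h"]
    by (simp add: algebra_simps)
qed

lemma pigeonhole:
  assumes "0 \<le> h" "0 < n" "c \<le> m p (p + real n * h)"
  shows "\<exists>j<n. c / real n \<le> m (p + real j * h) (p + real (Suc j) * h)"
proof (rule ccontr)
  assume "\<not> ?thesis"
  then have "(\<Sum>j<n. m (p + real j * h) (p + real (Suc j) * h)) < (\<Sum>j<n. c / real n)"
    using assms by (intro sum_strict_mono) (auto simp: not_le)
  then show False using assms unfolding sum_steps[OF assms(1)] by simp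
qed

lemma packing:
  assumes "0 \<le> h" "\<And>j. j < n \<Longrightarrow> \<kappa> \<le> m (p + real j * h) (p + real (Suc j) * h)"
  shows "real n * \<kappa> \<le> m p (p + real n * h)"
proof -
  have "(\<Sum>j<n. \<kappa>) \<le> (\<Sum>j<n. m (p + real j * h) (p + real (Suc j) * h))"
    using assms(2) by (intro sum_mono) auto
  then show ?thesis unfolding sum_steps[OF assms(1)] by simp
qed

text \<open>If two windows of length h have mass \<kappa>, so has the one midway between them.
  Halving until the ends are h apart traps \<open>t\<close>; since only dyadic positions are
  reached, the conclusion is about a window of length 3h.\<close>

lemma quasi_concave_bisection:
  assumes "0 < h" "0 \<le> \<kappa>"
  shows "\<lbrakk>\<kappa> \<le> m t1 (t1 + h); \<kappa> \<le> m t2 (t2 + h); t1 \<le> t; t \<le> t2; t2 - t1 \<le> 2 ^ N * h\<rbrakk>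
    \<Longrightarrow> \<kappa> \<le> m (t - h) (t + 2 * h)"
proof (induction N arbitrary: t1 t2)
  case 0
  then have "m t1 (t1 + h) \<le> m (t - h) (t + 2 * h)" using assms by (intro mono) auto
  with 0 show ?case by simp
next
  case (Suc N)
  define s where "s = (t1 + t2) / 2"
  have "\<kappa> * \<kappa> \<le> m t1 (t1 + h) * m t2 (t2 + h)" using Suc.prems assms by (intro mult_mono) auto
  also have "\<dots> \<le> (m ((t1 + t2) / 2) ((t1 + h + (t2 + h)) / 2))\<^sup>2" by (rule mid)
  also have "(t1 + h + (t2 + h)) / 2 = s + h" by (simp add: s_def field_simps)
  finally have "\<kappa>\<^sup>2 \<le> (m s (s + h))\<^sup>2" by (simp add: s_def power2_eq_square)
  then have s: "\<kappa> \<le> m s (s + h)" using nonneg by (rule power2_le_imp_le)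
  show ?case
  proof (cases "t \<le> s")
    case True
    then show ?thesis using Suc.prems s by (intro Suc.IH[of t1 s]) (auto simp: s_def field_simps)
  next
    case False
    then show ?thesis using Suc.prems s by (intro Suc.IH[of s t2]) (auto simp: s_def field_simps)
  qed
qed

lemma quasi_concave:
  assumes "0 < h" "\<kappa> \<le> m t1 (t1 + h)" "\<kappa> \<le> m t2 (t2 + h)" "t1 \<le> t" "t \<le> t2"
  shows "\<kappa> \<le> m (t - h) (t + 2 * h)"
proof (cases "0 \<le> \<kappa>")
  case True
  obtain N where "(t2 - t1) / h < 2 ^ N" using real_arch_pow[of 2] by auto
  then have "t2 - t1 \<le> 2 ^ N * h" using assms by (simp add: field_simps)
  with assms True show ?thesis by (intro quasi_concave_bisection)
next
  case False
  then show ?thesis using nonneg[of "t - h" "t + 2 * h"] by linarith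
qed

text \<open>The factor 2 pays for rounding L/h up to an integer; the window found may therefore
  protrude beyond r + L.\<close>

lemma pigeonhole_interval:
  assumes "0 < h" "h \<le> L" "p \<le> m r (r + L)" "0 \<le> p"
  shows "\<exists>t\<ge>r. t < r + L \<and> p * h / (2 * L) \<le> m t (t + h)"
proof -
  define n where "n = nat \<lceil>L / h\<rceil>"
  have Lh: "1 \<le> L / h" using assms by simp
  have n: "L / h \<le> real n" "real n < L / h + 1" using Lh by (auto simp: n_def) linarith
  have n2: "real n \<le> 2 * L / h" "0 < n" using n Lh by (auto intro: gr0I)
  have "p \<le> m r (r + real n * h)"
    using assms n by (intro order.trans[OF assms(3)] mono) (auto simp: field_simps)
  then obtain j where j: "j < n" "p / real n \<le> m (r + real j * h) (r + real (Suc j) * h)"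
    using pigeonhole[of h n p r] assms n2 by auto
  have "p * h / (2 * L) \<le> p / real n"
  proof -
    have "p * (real n * h) \<le> p * (2 * L)" using n2 assms by (intro mult_left_mono) (auto simp: field_simps)
    then show ?thesis using n2 assms by (simp add: field_simps)
  qed
  also have "\<dots> \<le> m (r + real j * h) (r + real j * h + h)" using j by (simp add: algebra_simps)
  finally have "p * h / (2 * L) \<le> m (r + real j * h) (r + real j * h + h)" .
  moreover have "real j * h < L"
  proof -
    have "real j + 1 \<le> real n" using j by auto
    then have "real j < L / h" using n by linarith
    then show ?thesis using assms by (simp add: field_simps)
  qed
  ultimately show ?thesis using assms by (intro exI[of _ "r + real j * h"]) auto
qed

text \<open>Each outer interval contains a window of at least half its average mass, and
  quasi-concavity passes that bound to everything in between. Windows of length h/3 make up for the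
  widening by 3.\<close>

lemma lower_between:
  assumes "0 < r" "r < K" "0 \<le> p" "p \<le> m r K" "p \<le> m (- K) (- r)"
    and "- r \<le> t" "t + h \<le> r" "0 < h" "h \<le> K - r"
  shows "p * h / (6 * K) \<le> m t (t + h)"
proof -
  define k where "k = h / 3"
  have k: "0 < k" "k \<le> K - r" using assms by (auto simp: k_def)
  obtain t2 where t2: "r \<le> t2" "p * k / (2 * (K - r)) \<le> m t2 (t2 + k)"
    using pigeonhole_interval[of k "K - r" p r] assms k by auto
  obtain t1 where t1: "t1 < - r" "p * k / (2 * (K - r)) \<le> m t1 (t1 + k)"
    using pigeonhole_interval[of k "K - r" p "-K"] assms k by auto
  have "p * k / (2 * (K - r)) \<le> m (t + k - k) (t + k + 2 * k)"
    using t1 t2 assms k by (intro quasi_concave[of k _ t1 t2]) (auto simp: k_def)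
  moreover have "p * k / (2 * K) \<le> p * k / (2 * (K - r))"
    using assms k by (intro divide_left_mono) auto
  ultimately show ?thesis by (simp add: k_def add.commute)
qed

text \<open>A window that is too heavy at \<open>t0\<close>, averaged with a window of ordinary mass
  at \<open>t1\<close> beyond 1/2, makes the midpoint window heavy as well. By quasi-concavity
  everything from \<open>t0\<close> to the midpoint is then heavy, and the total exceeds 1.\<close>

lemma upper_bound:
  assumes le1: "\<And>p q. m p q \<le> 1" and p: "0 < p" "p \<le> m (1/2) K" and K: "1 \<le> K"
    and h: "0 < h" "h \<le> 1/48" and t0: "\<bar>t0\<bar> \<le> 1/4"
  shows "m t0 (t0 + h) \<le> 4608 * K / p * h"
proof (rule ccontr)
  assume "\<not> ?thesis"
  then have big: "4608 * K / p * h < m t0 (t0 + h)" by simp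
  \<comment> \<open>The constant 4608 is 2 * 48^2: multiplied by p h/(2K), the assumed excess gives
    exactly \<kappa>^2.\<close>
  define \<kappa> where "\<kappa> = 48 * h"
  have pos: "0 < 4608 * K / p * h" using p K h by simp
  obtain t1 where t1: "1/2 \<le> t1" "p * h / (2 * K) \<le> m t1 (t1 + h)"
  proof -
    have "p \<le> m (1/2) (1/2 + K)" using p K by (intro order.trans[OF p(2)] mono) auto
    then show ?thesis using pigeonhole_interval[of h K p "1/2"] p K h that by auto
  qed
  define s where "s = (t0 + t1) / 2"
  have "\<kappa> * \<kappa> = (4608 * K / p * h) * (p * h / (2 * K))" using p K by (simp add: \<kappa>_def field_simps)
  also have "\<dots> < m t0 (t0 + h) * m t1 (t1 + h)"
    using big pos t1 p K h by (intro mult_less_le_imp_less) auto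
  also have "\<dots> \<le> (m ((t0 + t1) / 2) ((t0 + h + (t1 + h)) / 2))\<^sup>2" by (rule mid)
  also have "(t0 + h + (t1 + h)) / 2 = s + h" by (simp add: s_def field_simps)
  finally have "\<kappa>\<^sup>2 < (m s (s + h))\<^sup>2" by (simp add: s_def power2_eq_square)
  then have ms: "\<kappa> < m s (s + h)" using nonneg by (rule power2_less_imp_less)
  define \<kappa>' where "\<kappa>' = min (m s (s + h)) (m t0 (t0 + h))"
  have \<kappa>': "\<kappa> < \<kappa>'"
  proof -
    have "p \<le> 1" using p le1[of "1/2" K] by simp
    have "48 * p \<le> 4608 * K" using \<open>p \<le> 1\<close> K by linarith
    then have "\<kappa> \<le> 4608 * K / p * h" using p h by (simp add: \<kappa>_def field_simps)
    then show ?thesis using ms big by (auto simp: \<kappa>'_def)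
  qed
  \<comment> \<open>The distance from \<open>t0\<close> to \<open>s\<close> is at least 1/8, so
    windows of length 3h can start at about 1/(24h) places; at least 1/(48h) of them, each heavier
    than 48h, already exceed total mass 1.\<close>
  define n where "n = nat \<lfloor>1 / (24 * h)\<rfloor>"
  have ge2: "2 \<le> 1 / (24 * h)" using h by (simp add: field_simps)
  have n: "real n \<le> 1 / (24 * h)" "1 / (24 * h) - 1 < real n" using ge2 unfolding n_def by linarith+
  then have n': "1 / (48 * h) \<le> real n" using ge2 by (simp add: field_simps)
  have "real n * \<kappa>' \<le> m (t0 - h) (t0 - h + real n * (3 * h))"
  proof (rule packing)
    fix j assume "j < n"
    then have "real j \<le> real n" by simp
    then have "real j * (24 * h) \<le> real n * (24 * h)" using h by (intro mult_right_mono) auto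
    also have "\<dots> \<le> 1" using n(1) h by (simp add: field_simps)
    finally have "real j * (24 * h) \<le> 1" .
    then have "real j * (3 * h) \<le> s - t0" using t1 t0 by (auto simp: s_def field_simps)
    then have "\<kappa>' \<le> m (t0 + real j * (3 * h) - h) (t0 + real j * (3 * h) + 2 * h)"
      using h by (intro quasi_concave[of h _ t0 s]) (auto simp: \<kappa>'_def)
    then show "\<kappa>' \<le> m (t0 - h + real j * (3 * h)) (t0 - h + real (Suc j) * (3 * h))"
      by (simp add: algebra_simps)
  qed (use h in auto)
  also have "\<dots> \<le> 1" by (rule le1)
  finally have "real n * \<kappa>' \<le> 1" .
  moreover have "1 < real n * \<kappa>'"
  proof -
    have "1 = 1 / (48 * h) * \<kappa>" using h by (simp add: \<kappa>_def)
    also have "\<dots> < 1 / (48 * h) * \<kappa>'" using h \<kappa>' by (intro mult_strict_left_mono) auto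
    also have "\<dots> \<le> real n * \<kappa>'" using n' \<kappa>' h by (intro mult_right_mono) (auto simp: \<kappa>_def)
    finally show ?thesis .
  qed
  ultimately show False by simp
qed

end

section \<open>Marginals of isotropic log-concave distributions\<close>

definition dot :: "nat \<Rightarrow> (nat \<Rightarrow> real) \<Rightarrow> (nat \<Rightarrow> real) \<Rightarrow> real" where
  "dot d v x = (\<Sum>i<d. v i * x i)"

definition seg_midpoint :: "nat \<Rightarrow> (nat \<Rightarrow> real) \<Rightarrow> (nat \<Rightarrow> real) \<Rightarrow> nat \<Rightarrow> real" where
  "seg_midpoint d x y = restrict (\<lambda>i. (x i + y i) / 2) {..<d}"

definition midpoint_closed :: "nat \<Rightarrow> (nat \<Rightarrow> real) set \<Rightarrow> bool" where
  "midpoint_closed d S \<longleftrightarrow> (\<forall>x\<in>S. \<forall>y\<in>S. seg_midpoint d x y \<in> S)"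

lemma dot_commute: "dot d v x = dot d x v"
  by (simp add: dot_def mult.commute)

lemma dot_midpoint: "dot d w (seg_midpoint d x y) = (dot d w x + dot d w y) / 2"
  by (simp add: dot_def seg_midpoint_def sum.distrib[symmetric] sum_divide_distrib distrib_left add_divide_distrib)

lemma dot_uminus_left: "dot d (\<lambda>i. - v i) x = - dot d v x"
  by (simp add: dot_def sum_negf)

lemma midpoint_closed_Int:
  "midpoint_closed d S \<Longrightarrow> midpoint_closed d T \<Longrightarrow> midpoint_closed d (S \<inter> T)"
  by (auto simp: midpoint_closed_def)

lemma midpoint_closed_space: "midpoint_closed d ({..<d} \<rightarrow>\<^sub>E UNIV)"
  by (auto simp: midpoint_closed_def seg_midpoint_def)

text \<open>Mean zero makes the expectation of the positive part half that of |z|, hence at least q.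
  On {z > 0} AM-GM gives z <= l z^2/2 + 1/(2l), and l = q/V lets the quadratic term use up only half
  of q.\<close>

lemma (in prob_space) prob_positive_ge:
  assumes [measurable]: "integrable M z" "integrable M (\<lambda>x. (z x)\<^sup>2)"
    and mean: "expectation z = 0" and q: "0 < q" "2 * q \<le> expectation (\<lambda>x. \<bar>z x\<bar>)"
    and V: "0 < V" "expectation (\<lambda>x. (z x)\<^sup>2) \<le> V"
  shows "q\<^sup>2 / V \<le> prob {x \<in> space M. 0 < z x}"
proof -
  define l where "l = q / V"
  have l: "0 < l" using q V by (simp add: l_def)
  have [measurable]: "z \<in> borel_measurable M" using assms(1) by simp
  let ?P = "{x \<in> space M. 0 < z x}"
  have pt: "(\<bar>z x\<bar> + z x) / 2 \<le> l * (z x)\<^sup>2 / 2 + indicator ?P x / (2 * l)" if "x \<in> space M" for x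
  proof (cases "0 < z x")
    case True
    have "0 \<le> (l * z x - 1)\<^sup>2" by simp
    then have "2 * l * z x \<le> l\<^sup>2 * (z x)\<^sup>2 + 1" by (simp add: power2_eq_square algebra_simps)
    then have "z x \<le> (l\<^sup>2 * (z x)\<^sup>2 + 1) / (2 * l)" using l by (simp add: field_simps)
    also have "\<dots> = l * (z x)\<^sup>2 / 2 + 1 / (2 * l)" using l by (simp add: field_simps power2_eq_square)
    finally show ?thesis using True that by simp
  next
    case False
    then show ?thesis using l that by simp
  qed
  have ind: "integrable M (\<lambda>x. indicator ?P x / (2 * l))"
    by (intro integrable_divide_zero integrable_real_indicator) (auto simp: less_top[symmetric])
  have "q \<le> expectation (\<lambda>x. (\<bar>z x\<bar> + z x) / 2)"
    using assms by simp
  also have "\<dots> \<le> expectation (\<lambda>x. l * (z x)\<^sup>2 / 2 + indicator ?P x / (2 * l))"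
    using assms(1,2) pt ind by (intro integral_mono) auto
  also have "\<dots> = l * expectation (\<lambda>x. (z x)\<^sup>2) / 2 + prob ?P / (2 * l)"
    using assms(1,2) by (subst Bochner_Integration.integral_add[OF _ ind]) auto
  also have "\<dots> \<le> q / 2 + prob ?P / (2 * l)"
  proof -
    have "l * expectation (\<lambda>x. (z x)\<^sup>2) \<le> l * V" using V l by (intro mult_left_mono) auto
    then show ?thesis using V by (simp add: l_def)
  qed
  finally have "q * l \<le> prob ?P" using l by (simp add: field_simps)
  then show ?thesis by (simp add: l_def power2_eq_square)
qed

locale isotropic_log_concave =
  fixes d :: nat and D :: "(nat \<Rightarrow> real) measure"
  assumes log_concave: "log_concave d D" and isotropic: "isotropic d D"
begin

sublocale prob_space D
  using log_concave by (simp add: log_concave_def)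

lemma sets_D: "sets D = sets (lebesgue_R d)"
  using log_concave by (auto simp: log_concave_def)

lemma space_D: "space D = {..<d} \<rightarrow>\<^sub>E UNIV"
  using sets_eq_imp_space_eq[OF sets_D] by (simp add: space_PiM)

lemma measurable_coord [measurable]: "i < d \<Longrightarrow> (\<lambda>x. x i) \<in> borel_measurable D"
  by (subst measurable_cong_sets[OF sets_D refl]) (auto intro!: measurable_component_singleton[of i "{..<d}" "\<lambda>_. lborel", simplified])

lemma measurable_dot [measurable]: "(\<lambda>x. dot d w x) \<in> borel_measurable D"
  unfolding dot_def by measurable

lemma integrable_dot: "integrable D (\<lambda>x. dot d w x)"
  using isotropic unfolding dot_def isotropic_def by (intro Bochner_Integration.integrable_sum) auto

lemma expectation_dot: "expectation (\<lambda>x. dot d w x) = 0"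
  using isotropic unfolding dot_def isotropic_def by (subst Bochner_Integration.integral_sum) auto

lemma dot_mult_dot: "dot d v x * dot d w x = (\<Sum>i<d. \<Sum>j<d. v i * w j * (x i * x j))"
  by (simp add: dot_def sum_product mult_ac)

lemma integrable_dot_mult: "integrable D (\<lambda>x. dot d v x * dot d w x)"
  using isotropic unfolding dot_mult_dot isotropic_def
  by (intro Bochner_Integration.integrable_sum) auto

lemma expectation_dot_mult: "expectation (\<lambda>x. dot d v x * dot d w x) = dot d v w"
proof -
  have "expectation (\<lambda>x. dot d v x * dot d w x) = (\<Sum>i<d. \<Sum>j<d. v i * w j * expectation (\<lambda>x. x i * x j))"
    using isotropic unfolding dot_mult_dot isotropic_def
    by (subst Bochner_Integration.integral_sum, auto)+
  also have "\<dots> = (\<Sum>i<d. \<Sum>j<d. if i = j then v i * w j else 0)"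
    using isotropic unfolding isotropic_def by (intro sum.cong refl) auto
  also have "\<dots> = dot d v w" by (simp add: dot_def sum.delta)
  finally show ?thesis .
qed

lemma expectation_dot_square: "expectation (\<lambda>x. (dot d v x)\<^sup>2) = dot d v v"
  using expectation_dot_mult[of v v] by (simp add: power2_eq_square)

lemma integrable_dot_square: "integrable D (\<lambda>x. (dot d v x)\<^sup>2)"
  using integrable_dot_mult[of v v] by (simp add: power2_eq_square)

lemma chebyshev:
  assumes "dot d w w = 1" "0 < t"
  shows "prob {x \<in> space D. t \<le> \<bar>dot d w x\<bar>} \<le> 1 / t\<^sup>2"
proof -
  have "prob {x \<in> space D. t \<le> \<bar>dot d w x - expectation (\<lambda>x. dot d w x)\<bar>} \<le> variance (\<lambda>x. dot d w x) / t\<^sup>2"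
    using assms integrable_dot_square by (intro Chebyshev_inequality) auto
  then show ?thesis using assms by (simp add: expectation_dot expectation_dot_square)
qed

lemma prob_midpoint:
  assumes "A \<in> sets D" "B \<in> sets D" "C \<in> sets D" "\<And>x y. x \<in> A \<Longrightarrow> y \<in> B \<Longrightarrow> seg_midpoint d x y \<in> C"
  shows "prob A * prob B \<le> (prob C)\<^sup>2"
  using log_concave_measure_midpoint[OF log_concave assms(1-3)] assms(4) by (simp add: seg_midpoint_def)

lemma midpoint_space: "x \<in> space D \<Longrightarrow> y \<in> space D \<Longrightarrow> seg_midpoint d x y \<in> space D"
  using midpoint_closed_space[of d] by (auto simp: midpoint_closed_def space_D)

text \<open>Half-open, so that adjacent strips add up exactly as \<open>log_concave_mass\<close>
  demands.\<close>

definition strip :: "(nat \<Rightarrow> real) \<Rightarrow> (nat \<Rightarrow> real) set \<Rightarrow> real \<Rightarrow> real \<Rightarrow> (nat \<Rightarrow> real) set" where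
  "strip w S p q = {x \<in> space D. p \<le> dot d w x \<and> dot d w x < q \<and> x \<in> S}"

lemma strip_sets [measurable]:
  assumes [measurable]: "S \<in> sets D" shows "strip w S p q \<in> sets D"
  unfolding strip_def by measurable

lemma log_concave_mass_strip:
  assumes S[measurable]: "S \<in> sets D" and mc: "midpoint_closed d S"
  shows "log_concave_mass (\<lambda>p q. prob (strip w S p q))"
proof
  fix p q r p' q' :: real
  show "0 \<le> prob (strip w S p q)" by simp
  show "prob (strip w S p q) + prob (strip w S q r) = prob (strip w S p r)" if "p \<le> q" "q \<le> r"
    using that by (subst finite_measure_Union[symmetric]) (auto simp: strip_def intro!: arg_cong[of _ _ prob])
  show "prob (strip w S p q) * prob (strip w S p' q') \<le> (prob (strip w S ((p + p') / 2) ((q + q') / 2)))\<^sup>2"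
    using mc by (intro prob_midpoint) (auto simp: strip_def dot_midpoint midpoint_space midpoint_closed_def)
qed

text \<open>Chebyshev makes the mass of \<open>{2 \<le> \<langle>w,x\<rangle>}\<close> at most a third of that of \<open>{-2 \<le> \<langle>w,x\<rangle>}\<close>;
  by log-concavity the ratio can only decrease further out.\<close>

lemma tail_decay:
  assumes w: "dot d w w = 1"
  shows "prob {x \<in> space D. 2 + 4 * real k \<le> dot d w x} \<le> (1/3) ^ k / 4"
proof -
  define F where "F j = prob {x \<in> space D. 4 * real j - 2 \<le> dot d w x}" for j
  have cheb: "prob {x \<in> space D. 2 \<le> \<bar>dot d w x\<bar>} \<le> 1/4" using chebyshev[OF w, of 2] by simp
  have F1: "F 1 \<le> 1/4"
    unfolding F_def by (rule order.trans[OF finite_measure_mono cheb]) auto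
  have F0: "3/4 \<le> F 0"
  proof -
    have "1 = prob ({x \<in> space D. 4 * real 0 - 2 \<le> dot d w x} \<union> {x \<in> space D. 2 \<le> \<bar>dot d w x\<bar>})"
      by (subst prob_space[symmetric]) (auto intro!: arg_cong[of _ _ prob])
    also have "\<dots> \<le> F 0 + prob {x \<in> space D. 2 \<le> \<bar>dot d w x\<bar>}"
      unfolding F_def by (intro measure_Un_le) auto
    finally show ?thesis using cheb by simp
  qed
  have dec: "F (Suc j) \<le> F j" for j unfolding F_def by (intro finite_measure_mono) auto
  have F_nn: "0 \<le> F j" for j by (simp add: F_def)
  have ratio: "F (Suc j) \<le> F j / 3" for j
  proof (induction j)
    case 0
    then show ?case using F0 F1 by simp
  next
    case (Suc j)
    have "F j * F (Suc (Suc j)) \<le> (F (Suc j))\<^sup>2"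
      unfolding F_def by (intro prob_midpoint) (auto simp: dot_midpoint midpoint_space)
    also have "\<dots> \<le> F (Suc j) * (F j / 3)"
      unfolding power2_eq_square using Suc F_nn by (intro mult_left_mono) auto
    finally have "F j * F (Suc (Suc j)) \<le> F j * (F (Suc j) / 3)" by (simp add: mult_ac)
    then show ?case using F_nn[of j] F_nn[of "Suc j"] dec[of j] dec[of "Suc j"]
      by (cases "F j = 0") auto
  qed
  have "F (Suc k) \<le> (1/3) ^ k / 4"
  proof (induction k)
    case (Suc k)
    then show ?case using ratio[of "Suc k"] by simp
  qed (use F1 in simp)
  then show ?thesis by (simp add: F_def algebra_simps)
qed

lemma fourth_moment_series_bound: "(6 + 4 * real k) ^ 4 \<le> 15552 * 2 ^ k"
proof -
  \<comment> \<open>The induction starts at 4, where consecutive terms first have a ratio of at most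
    (13/11)^4 < 2; the smaller cases are checked by hand.\<close>
  have *: "(6 + 4 * real (k + 4)) ^ 4 \<le> 15552 * 2 ^ (k + 4)" for k
  proof (induction k)
    case (Suc k)
    let ?y = "6 + 4 * real (k + 4)"
    have "6 + 4 * real (Suc k + 4) \<le> 13/11 * ?y" by simp
    then have "(6 + 4 * real (Suc k + 4)) ^ 4 \<le> (13/11 * ?y) ^ 4" by (intro power_mono) auto
    also have "\<dots> = (13/11) ^ 4 * ?y ^ 4" by (rule power_mult_distrib)
    also have "\<dots> \<le> 2 * ?y ^ 4" by (intro mult_right_mono) (simp_all add: power_divide)
    also have "\<dots> \<le> 2 * (15552 * 2 ^ (k + 4))" using Suc by (rule mult_left_mono) simp
    also have "\<dots> = 15552 * 2 ^ (Suc k + 4)" by (simp only: power_Suc add_Suc)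
    finally show ?case .
  qed simp
  show ?thesis
  proof (cases "4 \<le> k")
    case True
    then show ?thesis using *[of "k - 4"] by simp
  next
    case False
    then have "k = 0 \<or> k = 1 \<or> k = 2 \<or> k = 3" by auto
    then show ?thesis by auto
  qed
qed

lemma fourth_moment_nn:
  assumes w: "dot d w w = 1"
  shows "(\<integral>\<^sup>+x. ennreal ((dot d w x) ^ 4) \<partial>D) \<le> 25000"
proof -
  let ?A = "\<lambda>k::nat. {x \<in> space D. 2 + 4 * real k \<le> \<bar>dot d w x\<bar>}"
  let ?c = "\<lambda>k::nat. (6 + 4 * real k) ^ 4"
  \<comment> \<open>Shells 2 + 4k <= |<w,x>| < 6 + 4k, with 16 covering the core. The k-th tail has
    mass at most (1/3)^k/2, so the series is dominated by 7776 (2/3)^k, with sum 23328.\<close>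
  have pt: "ennreal ((dot d w x) ^ 4) \<le> 16 + (\<Sum>k. ennreal (?c k) * indicator (?A k) x)" if x: "x \<in> space D" for x
  proof (cases "\<bar>dot d w x\<bar> \<le> 2")
    case True
    then have "\<bar>dot d w x\<bar> ^ 4 \<le> 2 ^ 4" by (intro power_mono) auto
    then have "(dot d w x) ^ 4 \<le> 16" by (simp add: power_even_abs)
    then have "ennreal ((dot d w x) ^ 4) \<le> ennreal 16" by (rule ennreal_leI)
    then show ?thesis by (simp add: add_increasing2)
  next
    case False
    define k where "k = nat \<lfloor>(\<bar>dot d w x\<bar> - 2) / 4\<rfloor>"
    have k: "real k \<le> (\<bar>dot d w x\<bar> - 2) / 4" "(\<bar>dot d w x\<bar> - 2) / 4 < real k + 1"
      proof -
    have "0 \<le> (\<bar>dot d w x\<bar> - 2) / 4" using False by simp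
    then show "real k \<le> (\<bar>dot d w x\<bar> - 2) / 4" "(\<bar>dot d w x\<bar> - 2) / 4 < real k + 1"
      unfolding k_def by linarith+
  qed
    have "\<bar>dot d w x\<bar> ^ 4 \<le> (6 + 4 * real k) ^ 4" using k by (intro power_mono) auto
    then have "ennreal ((dot d w x) ^ 4) \<le> ennreal (?c k) * indicator (?A k) x"
      using k x by (simp add: power_even_abs ennreal_leI)
    also have "\<dots> = (\<Sum>j\<in>{k}. ennreal (?c j) * indicator (?A j) x)" by (subst sum.insert) simp_all
    also have "\<dots> \<le> (\<Sum>j. ennreal (?c j) * indicator (?A j) x)" by (intro sum_le_suminf) auto
    finally show ?thesis by (simp add: add_increasing)
  qed
  have PA: "prob (?A k) \<le> (1/3) ^ k / 2" for k
  proof -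
    have w': "dot d (\<lambda>i. - w i) (\<lambda>i. - w i) = 1" using w by (simp add: dot_def)
    have "prob (?A k) \<le> prob ({x \<in> space D. 2 + 4 * real k \<le> dot d w x} \<union> {x \<in> space D. 2 + 4 * real k \<le> dot d (\<lambda>i. - w i) x})"
      by (intro finite_measure_mono) (auto simp: dot_uminus_left)
    also have "\<dots> \<le> prob {x \<in> space D. 2 + 4 * real k \<le> dot d w x} + prob {x \<in> space D. 2 + 4 * real k \<le> dot d (\<lambda>i. - w i) x}"
      by (intro measure_Un_le) auto
    also have "\<dots> \<le> (1/3) ^ k / 2" using tail_decay[OF w, of k] tail_decay[OF w', of k] by simp
    finally show ?thesis .
  qed
  have "(\<integral>\<^sup>+x. ennreal ((dot d w x) ^ 4) \<partial>D) \<le> (\<integral>\<^sup>+x. 16 + (\<Sum>k. ennreal (?c k) * indicator (?A k) x) \<partial>D)"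
    using pt by (rule nn_integral_mono)
  also have "\<dots> = 16 + (\<Sum>k. ennreal (?c k) * emeasure D (?A k))"
    by (simp add: nn_integral_add nn_integral_suminf nn_integral_cmult emeasure_space_1)
  also have "\<dots> \<le> 16 + (\<Sum>k. ennreal (7776 * (2/3) ^ k))"
  proof (intro add_mono order.refl suminf_le)
    fix k
    have "?c k * prob (?A k) \<le> (15552 * 2 ^ k) * ((1/3) ^ k / 2)"
      using fourth_moment_series_bound[of k] PA[of k] by (intro mult_mono) auto
    also have "\<dots> = 7776 * (2/3) ^ k" by (simp add: power_divide)
    finally show "ennreal (?c k) * emeasure D (?A k) \<le> ennreal (7776 * (2/3) ^ k)"
      by (simp add: emeasure_eq_measure ennreal_leI flip: ennreal_mult)
  qed auto
  also have "(\<Sum>k. ennreal (7776 * (2/3) ^ k)) = ennreal (\<Sum>k. 7776 * (2/3) ^ k)"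
    by (intro suminf_ennreal2 summable_mult summable_geometric) auto
  also have "(\<Sum>k. 7776 * (2/3) ^ k) = (23328 :: real)"
    by (subst suminf_mult) (auto simp: suminf_geometric)
  finally show ?thesis by (rule order.trans) simp
qed

lemma integrable_fourth:
  assumes w: "dot d w w = 1"
  shows "integrable D (\<lambda>x. (dot d w x) ^ 4)"
  using order.strict_trans1[OF fourth_moment_nn[OF w], of top]
  by (intro integrableI_nonneg) auto

lemma fourth_moment:
  assumes w: "dot d w w = 1"
  shows "expectation (\<lambda>x. (dot d w x) ^ 4) \<le> 25000"
proof -
  have "ennreal (expectation (\<lambda>x. (dot d w x) ^ 4)) \<le> ennreal 25000"
    using fourth_moment_nn[OF w] nn_integral_eq_integral[OF integrable_fourth[OF w]] by simp
  then show ?thesis by (subst (asm) ennreal_le_iff) auto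
qed

text \<open>A second moment of 1 cannot come from |<w,x>| <= 1/2 alone, nor from rare huge values.
  The weights in the pointwise bound are such that the fourth moment contributes at most 1/4, which
  leaves 1/2 for the event.\<close>

lemma away_from_zero:
  assumes w: "dot d w w = 1"
  shows "1 / 50000 \<le> prob {x \<in> space D. 1/2 < \<bar>dot d w x\<bar>}"
proof -
  let ?P = "{x \<in> space D. 1/2 < \<bar>dot d w x\<bar>}"
  have pt: "(dot d w x)\<^sup>2 \<le> 1/4 + (dot d w x) ^ 4 / 100000 + 25000 * indicator ?P x" if "x \<in> space D" for x
  proof (cases "1/2 < \<bar>dot d w x\<bar>")
    case True
    define y where "y = (dot d w x)\<^sup>2"
    have "0 \<le> (y / 50000 - 1)\<^sup>2" by simp
    then have "y \<le> y\<^sup>2 / 100000 + 25000" by (simp add: power2_eq_square field_simps)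
    then show ?thesis using True that by (simp add: y_def)
  next
    case False
    then have "\<bar>dot d w x\<bar>\<^sup>2 \<le> (1/2)\<^sup>2" by (intro power_mono) auto
    then have "(dot d w x)\<^sup>2 \<le> 1/4" by (simp add: power_divide)
    moreover have "0 \<le> (dot d w x) ^ 4 / 100000" by simp
    ultimately have "(dot d w x)\<^sup>2 \<le> 1/4 + (dot d w x) ^ 4 / 100000" by linarith
    then show ?thesis using False by simp
  qed
  have ind: "integrable D (\<lambda>x. 25000 * indicator ?P x :: real)"
    by (intro integrable_mult_right integrable_real_indicator) (auto simp: less_top[symmetric])
  have "1 = expectation (\<lambda>x. (dot d w x)\<^sup>2)" using w by (simp add: expectation_dot_square)
  also have "\<dots> \<le> expectation (\<lambda>x. 1/4 + (dot d w x) ^ 4 / 100000 + 25000 * indicator ?P x)"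
    using integrable_dot_square integrable_fourth[OF w] pt
    by (intro integral_mono Bochner_Integration.integrable_add[OF _ ind]) auto
  also have "\<dots> = 1/4 + expectation (\<lambda>x. (dot d w x) ^ 4) / 100000 + 25000 * prob ?P"
    using integrable_fourth[OF w] by (subst Bochner_Integration.integral_add[OF _ ind]) (auto simp: prob_space)
  finally show ?thesis using fourth_moment[OF w] by simp
qed

text \<open>Mass away from 0 prevents concentration at 0: by \<open>away_from_zero\<close> and
  Chebyshev one of the two sides has mass at least 5/10^6 in [1/2, 400), and
  \<open>upper_bound\<close> applies to that side.\<close>

lemma slab_le:
  assumes w: "dot d w w = 1" and b: "0 < b"
  shows "prob {x \<in> space D. \<bar>dot d w x\<bar> \<le> b} \<le> 2 * 10 ^ 12 * b"
proof (cases "b \<le> 1/144")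
  case False
  have "prob {x \<in> space D. \<bar>dot d w x\<bar> \<le> b} \<le> 1" by simp
  also have "\<dots> \<le> 2 * 10 ^ 12 * b" using False by simp
  finally show ?thesis .
next
  case b2: True
  have main: "prob {x \<in> space D. \<bar>dot d v x\<bar> \<le> b} \<le> 2 * 10 ^ 12 * b"
    if v: "5 / 10 ^ 6 \<le> prob (strip v (space D) (1/2) 400)" for v
  proof -
    interpret log_concave_mass "\<lambda>p q. prob (strip v (space D) p q)"
      using midpoint_space by (intro log_concave_mass_strip) (auto simp: midpoint_closed_def)
    \<comment> \<open>The half-open window [-b, 2b) contains the closed slab; its length 3b is the
      reason for the threshold 1/144.\<close>
    have "prob {x \<in> space D. \<bar>dot d v x\<bar> \<le> b} \<le> prob (strip v (space D) (- b) (- b + 3 * b))"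
      using b by (intro finite_measure_mono) (auto simp: strip_def)
    also have "\<dots> \<le> 4608 * 400 / (5 / 10 ^ 6) * (3 * b)"
      using b b2 v by (intro upper_bound) auto
    also have "\<dots> \<le> 2 * 10 ^ 12 * b" using b by simp
    finally show ?thesis .
  qed
  let ?n = "\<lambda>i. - w i"
  have "1 / 50000 \<le> prob {x \<in> space D. 1/2 < \<bar>dot d w x\<bar>}" by (rule away_from_zero[OF w])
  also have "\<dots> \<le> prob ((strip w (space D) (1/2) 400 \<union> strip ?n (space D) (1/2) 400) \<union> {x \<in> space D. 400 \<le> \<bar>dot d w x\<bar>})"
    by (intro finite_measure_mono) (auto simp: strip_def dot_uminus_left)
  also have "\<dots> \<le> prob (strip w (space D) (1/2) 400 \<union> strip ?n (space D) (1/2) 400) + prob {x \<in> space D. 400 \<le> \<bar>dot d w x\<bar>}"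
    by (intro measure_Un_le) auto
  also have "\<dots> \<le> prob (strip w (space D) (1/2) 400) + prob (strip ?n (space D) (1/2) 400) + 1 / 400\<^sup>2"
    by (intro add_mono measure_Un_le chebyshev w) auto
  finally have "5 / 10 ^ 6 \<le> prob (strip w (space D) (1/2) 400) \<or> 5 / 10 ^ 6 \<le> prob (strip ?n (space D) (1/2) 400)"
    by simp linarith
  then show ?thesis using main[of w] main[of ?n] by (auto simp: dot_uminus_left)
qed

end

lemma midpoint_closed_space_slab: "midpoint_closed d {x \<in> {..<d} \<rightarrow>\<^sub>E UNIV. p \<le> dot d w x \<and> dot d w x \<le> q}"
  using midpoint_closed_space[of d] by (auto simp: midpoint_closed_def dot_midpoint)

context isotropic_log_concave
begin

text \<open>The argument yields 25/10^12. The constant is weakened to that of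
  \<open>prob_dot_product_positive\<close>, so that half-planes and pairs of quadrants can be
  treated alike.\<close>

lemma prob_dot_positive:
  assumes w: "dot d w w = 1"
  shows "5 / 10 ^ 58 \<le> prob {x \<in> space D. 0 < dot d w x}"
proof -
  let ?P = "{x \<in> space D. 1/2 < \<bar>dot d w x\<bar>}"
  have "(1/2) * prob ?P = expectation (\<lambda>x. (1/2) * indicator ?P x)" by simp
  also have "\<dots> \<le> expectation (\<lambda>x. \<bar>dot d w x\<bar>)"
    using integrable_dot by (intro integral_mono integrable_mult_right integrable_real_indicator)
      (auto simp: less_top[symmetric] indicator_def)
  finally have "2 * (5 / 10 ^ 6) \<le> expectation (\<lambda>x. \<bar>dot d w x\<bar>)" using away_from_zero[OF w] by simp
  then have "(5 / 10 ^ 6)\<^sup>2 / 1 \<le> prob {x \<in> space D. 0 < dot d w x}"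
    using w by (intro prob_positive_ge) (auto simp: integrable_dot integrable_dot_square expectation_dot expectation_dot_square)
  then show ?thesis by (simp add: power2_eq_square)
qed

text \<open>Orthogonality gives the product mean zero, so \<open>prob_positive_ge\<close> applies.
  The two slabs of half-width \<open>r\<close> have mass at most 1/4 each, hence the product exceeds
  r^2 in absolute value with probability at least 1/2; its second moment is bounded by fourth
  moments.\<close>

lemma prob_dot_product_positive:
  assumes w: "dot d w w = 1" and e: "dot d e e = 1" and we: "dot d w e = 0"
  shows "5 / 10 ^ 58 \<le> prob {x \<in> space D. 0 < dot d w x * dot d e x}"
proof -
  define r :: real where "r = 1 / (8 * 10 ^ 12)"
  let ?P = "{x \<in> space D. r < \<bar>dot d w x\<bar> \<and> r < \<bar>dot d e x\<bar>}"
  let ?z = "\<lambda>x. dot d w x * dot d e x"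
  have "1 = prob (?P \<union> ({x \<in> space D. \<bar>dot d w x\<bar> \<le> r} \<union> {x \<in> space D. \<bar>dot d e x\<bar> \<le> r}))"
    by (subst prob_space[symmetric]) (auto intro!: arg_cong[of _ _ prob])
  also have "\<dots> \<le> prob ?P + (prob {x \<in> space D. \<bar>dot d w x\<bar> \<le> r} + prob {x \<in> space D. \<bar>dot d e x\<bar> \<le> r})"
    by (intro order.trans[OF measure_Un_le] add_mono order.refl measure_Un_le) auto
  also have "\<dots> \<le> prob ?P + (2 * 10 ^ 12 * r + 2 * 10 ^ 12 * r)"
    by (intro add_mono order.refl slab_le w e) (auto simp: r_def)
  finally have P: "1/2 \<le> prob ?P" by (simp add: r_def)
  have "r\<^sup>2 * prob ?P = expectation (\<lambda>x. r\<^sup>2 * indicator ?P x)" by simp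
  also have "\<dots> \<le> expectation (\<lambda>x. \<bar>?z x\<bar>)"
  proof (rule integral_mono)
    show "integrable D (\<lambda>x. r\<^sup>2 * indicator ?P x)"
      by (intro integrable_mult_right integrable_real_indicator) (auto simp: less_top[symmetric])
    show "integrable D (\<lambda>x. \<bar>?z x\<bar>)" using integrable_dot_mult by (rule integrable_abs)
    fix x
    have "r * r \<le> \<bar>dot d w x\<bar> * \<bar>dot d e x\<bar>" if "x \<in> ?P"
      using that by (intro mult_mono) (auto simp: r_def)
    then show "r\<^sup>2 * indicator ?P x \<le> \<bar>?z x\<bar>" by (auto simp: indicator_def power2_eq_square abs_mult)
  qed
  finally have E: "2 * (r\<^sup>2 / 4) \<le> expectation (\<lambda>x. \<bar>?z x\<bar>)"
    using mult_left_mono[OF P, of "r\<^sup>2"] by simp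
  have pt: "(?z x)\<^sup>2 \<le> (dot d w x) ^ 4 / 2 + (dot d e x) ^ 4 / 2" for x
    using sum_squares_bound[of "(dot d w x)\<^sup>2" "(dot d e x)\<^sup>2"] by (simp add: power_mult_distrib)
  have i4: "integrable D (\<lambda>x. (dot d w x) ^ 4 / 2 + (dot d e x) ^ 4 / 2)"
    using integrable_fourth[OF w] integrable_fourth[OF e] by simp
  have iz: "integrable D (\<lambda>x. (?z x)\<^sup>2)"
    by (rule Bochner_Integration.integrable_bound[OF i4])
      (auto intro!: AE_I2 order.trans[OF pt])
  have "expectation (\<lambda>x. (?z x)\<^sup>2) \<le> expectation (\<lambda>x. (dot d w x) ^ 4 / 2 + (dot d e x) ^ 4 / 2)"
    using iz i4 pt by (intro integral_mono) auto
  also have "\<dots> \<le> 25000"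
    using fourth_moment[OF w] fourth_moment[OF e] integrable_fourth[OF w] integrable_fourth[OF e] by simp
  finally have V: "expectation (\<lambda>x. (?z x)\<^sup>2) \<le> 25000" .
  have "(r\<^sup>2 / 4)\<^sup>2 / 25000 \<le> prob {x \<in> space D. 0 < ?z x}"
    using E V iz we by (intro prob_positive_ge) (auto simp: integrable_dot_mult expectation_dot_mult r_def)
  moreover have "5 / 10 ^ 58 \<le> (r\<^sup>2 / 4)\<^sup>2 / 25000" by (simp add: r_def power2_eq_square)
  ultimately show ?thesis by linarith
qed

text \<open>From the mass 5/10^58 of either side, the slab of half-width 1/10^71 and the tail beyond
  10^30 remove at most 1/10^58. What is left on both sides feeds
  \<open>lower_between\<close>.\<close>

lemma slab_ge:
  assumes w: "dot d w w = 1" and t: "- 1 / 10 ^ 71 \<le> t" "t + h \<le> 1 / 10 ^ 71" "0 < h"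
  shows "h / 10 ^ 89 \<le> prob (strip w (space D) t (t + h))"
proof -
  interpret log_concave_mass "\<lambda>p q. prob (strip w (space D) p q)"
    using midpoint_space by (intro log_concave_mass_strip) (auto simp: midpoint_closed_def)
  let ?n = "\<lambda>i. - w i"
  have n: "dot d ?n ?n = 1" using w by (simp add: dot_def)
  let ?B = "{x \<in> space D. \<bar>dot d w x\<bar> \<le> 1 / 10 ^ 71} \<union> {x \<in> space D. 10 ^ 30 \<le> \<bar>dot d w x\<bar>}"
  have "prob ?B \<le> 2 * 10 ^ 12 * (1 / 10 ^ 71) + 1 / (10 ^ 30)\<^sup>2"
    by (intro order.trans[OF measure_Un_le] add_mono slab_le chebyshev w) auto
  then have B: "prob ?B \<le> 1 / 10 ^ 58" by simp
  have "prob {x \<in> space D. 0 < dot d w x} \<le> prob (strip w (space D) (1 / 10 ^ 71) (10 ^ 30)) + prob ?B"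
    by (intro order.trans[OF finite_measure_mono measure_Un_le]) (auto simp: strip_def)
  moreover have "prob {x \<in> space D. 0 < dot d ?n x} \<le> prob (strip w (space D) (- (10 ^ 30)) (- (1 / 10 ^ 71))) + prob ?B"
    by (intro order.trans[OF finite_measure_mono measure_Un_le]) (auto simp: strip_def dot_uminus_left)
  ultimately have "1 / 10 ^ 58 \<le> prob (strip w (space D) (1 / 10 ^ 71) (10 ^ 30))"
    "1 / 10 ^ 58 \<le> prob (strip w (space D) (- (10 ^ 30)) (- (1 / 10 ^ 71)))"
    using prob_dot_positive[OF w] prob_dot_positive[OF n] B by simp_all
  then have "1 / 10 ^ 58 * h / (6 * 10 ^ 30) \<le> prob (strip w (space D) t (t + h))"
    using t by (intro lower_between[of "1 / 10 ^ 71"]) auto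
  moreover have "h / 10 ^ 89 \<le> 1 / 10 ^ 58 * h / (6 * 10 ^ 30)" using t by simp
  ultimately show ?thesis by linarith
qed

text \<open>The four quadrants of the \<open>(w, e)\<close>-plane, cut down to \<open>S\<close>: as \<open>\<langle>w,x\<rangle>\<close> and \<open>\<langle>w,x\<rangle>\<langle>e,x\<rangle>\<close> have
  mean zero, the two quadrants above the \<open>w\<close>-axis or the two below it both carry mass, and then
  log-concavity in the direction \<open>w\<close> supplies mass in every thin strip between them.\<close>

lemma slab_off_axis_ge:
  assumes w: "dot d w w = 1" and e: "dot d e e = 1" and we: "dot d w e = 0"
    and S[measurable]: "S \<in> sets D" and mc: "midpoint_closed d S" and PS: "prob (space D - S) \<le> 1 / 10 ^ 58"
    and t: "- 1 / 10 ^ 71 \<le> t" "t + h \<le> 1 / 10 ^ 71" "0 < h"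
  shows "h / 10 ^ 89 \<le> prob (strip w {x \<in> S. 1 / 10 ^ 71 \<le> \<bar>dot d e x\<bar> \<and> \<bar>dot d e x\<bar> \<le> 10 ^ 30} t (t + h))"
proof -
  define r :: real where "r = 1 / 10 ^ 71"
  define K :: real where "K = 10 ^ 30"
  have r0: "0 < r" by (simp add: r_def)
  \<comment> \<open>The set r <= |<e,x>| <= K is not midpoint-closed, so it is treated as its two
    convex halves, for e and for -e.\<close>
  define U where "U v = S \<inter> {x \<in> {..<d} \<rightarrow>\<^sub>E UNIV. r \<le> dot d v x \<and> dot d v x \<le> K}" for v
  have U_sets[measurable]: "U v \<in> sets D" for v
    unfolding U_def space_D[symmetric] by measurable
  have U_mc: "midpoint_closed d (U v)" for v
    unfolding U_def by (intro midpoint_closed_Int mc midpoint_closed_space_slab)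
  let ?nw = "\<lambda>i. - w i" and ?ne = "\<lambda>i. - e i"
  have nw: "dot d ?nw ?nw = 1" and nwe: "dot d ?nw e = 0"
    using w we by (auto simp: dot_def sum_negf)
  define Q1 where "Q1 = prob (strip w (U e) r K)"
  define Q2 where "Q2 = prob (strip w (U e) (- K) (- r))"
  define Q3 where "Q3 = prob (strip w (U ?ne) (- K) (- r))"
  define Q4 where "Q4 = prob (strip w (U ?ne) r K)"
  define B where "B = (space D - S) \<union> (({x \<in> space D. \<bar>dot d w x\<bar> \<le> r} \<union> {x \<in> space D. K \<le> \<bar>dot d w x\<bar>})
      \<union> ({x \<in> space D. \<bar>dot d e x\<bar> \<le> r} \<union> {x \<in> space D. K \<le> \<bar>dot d e x\<bar>}))"
  have B_sets[measurable]: "B \<in> sets D" unfolding B_def by measurable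
  have "prob B \<le> 1 / 10 ^ 58 + ((2 * 10 ^ 12 * r + 1 / K\<^sup>2) + (2 * 10 ^ 12 * r + 1 / K\<^sup>2))"
    unfolding B_def
    by (rule order.trans[OF measure_Un_le], measurable, rule add_mono[OF PS],
        rule order.trans[OF measure_Un_le], measurable, intro add_mono;
        rule order.trans[OF measure_Un_le], measurable, intro add_mono slab_le chebyshev w e)
      (auto simp: r_def K_def)
  then have B: "prob B \<le> 15 / 10 ^ 59" by (simp add: r_def K_def)
  have cover: "prob A \<le> prob A1 + prob A2 + prob B"
    if "A \<subseteq> A1 \<union> A2 \<union> B" "A1 \<in> sets D" "A2 \<in> sets D" for A A1 A2
  proof -
    have "prob A \<le> prob (A1 \<union> A2 \<union> B)" using that by (intro finite_measure_mono) auto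
    also have "\<dots> \<le> prob (A1 \<union> A2) + prob B" using that by (intro measure_Un_le) auto
    also have "\<dots> \<le> prob A1 + prob A2 + prob B" using that by (intro add_right_mono measure_Un_le) auto
    finally show ?thesis .
  qed
  have out: "x \<in> S" "r < \<bar>dot d w x\<bar>" "\<bar>dot d w x\<bar> < K" "r < \<bar>dot d e x\<bar>" "\<bar>dot d e x\<bar> < K"
    if "x \<in> space D" "x \<notin> B" for x
    using that by (auto simp: B_def)
  have ne0: "dot d e x < 0 \<or> 0 < dot d e x" "dot d w x < 0 \<or> 0 < dot d w x" if "x \<in> space D" "x \<notin> B" for x
    using out(2,4)[OF that] by (auto simp: r_def)
  have q1: "x \<in> strip w (U e) r K" if "x \<in> space D" "x \<notin> B" "0 < dot d w x" "0 < dot d e x" for x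
    using that out[OF that(1,2)] by (auto simp: strip_def U_def space_D)
  have q2: "x \<in> strip w (U e) (- K) (- r)" if "x \<in> space D" "x \<notin> B" "dot d w x < 0" "0 < dot d e x" for x
    using that out[OF that(1,2)] by (auto simp: strip_def U_def space_D)
  have q3: "x \<in> strip w (U ?ne) (- K) (- r)" if "x \<in> space D" "x \<notin> B" "dot d w x < 0" "dot d e x < 0" for x
    using that out[OF that(1,2)] by (auto simp: strip_def U_def space_D dot_uminus_left)
  have q4: "x \<in> strip w (U ?ne) r K" if "x \<in> space D" "x \<notin> B" "0 < dot d w x" "dot d e x < 0" for x
    using that out[OF that(1,2)] by (auto simp: strip_def U_def space_D dot_uminus_left)
  have "prob {x \<in> space D. 0 < dot d w x} \<le> Q1 + Q4 + prob B"
    unfolding Q1_def Q4_def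
  proof (rule cover[OF subsetI], goal_cases)
    case (1 x)
    then show ?case using q1[of x] q4[of x] ne0[of x] by (cases "x \<in> B") auto
  qed (intro strip_sets U_sets)+
  then have Q14: "35 / 10 ^ 59 \<le> Q1 + Q4" using prob_dot_positive[OF w] B by simp
  have "prob {x \<in> space D. 0 < dot d ?nw x} \<le> Q2 + Q3 + prob B"
    unfolding Q2_def Q3_def dot_uminus_left neg_0_less_iff_less
  proof (rule cover[OF subsetI], goal_cases)
    case (1 x)
    then show ?case using q2[of x] q3[of x] ne0[of x] by (cases "x \<in> B") auto
  qed (intro strip_sets U_sets)+
  then have Q23: "35 / 10 ^ 59 \<le> Q2 + Q3" using prob_dot_positive[OF nw] B by simp
  have "prob {x \<in> space D. 0 < dot d w x * dot d e x} \<le> Q1 + Q3 + prob B"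
    unfolding Q1_def Q3_def zero_less_mult_iff
  proof (rule cover[OF subsetI], goal_cases)
    case (1 x)
    then show ?case using q1[of x] q3[of x] ne0[of x] by (cases "x \<in> B") auto
  qed (intro strip_sets U_sets)+
  then have Q13: "35 / 10 ^ 59 \<le> Q1 + Q3" using prob_dot_product_positive[OF w e we] B by simp
  have "prob {x \<in> space D. 0 < dot d ?nw x * dot d e x} \<le> Q2 + Q4 + prob B"
    unfolding Q2_def Q4_def dot_uminus_left zero_less_mult_iff neg_0_less_iff_less neg_less_0_iff_less
  proof (rule cover[OF subsetI], goal_cases)
    case (1 x)
    then show ?case using q2[of x] q4[of x] ne0[of x] by (cases "x \<in> B") auto
  qed (intro strip_sets U_sets)+
  then have Q24: "35 / 10 ^ 59 \<le> Q2 + Q4" using prob_dot_product_positive[OF nw e nwe] B by simp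
  have main: "h / 10 ^ 89 \<le> prob (strip w (U v) t (t + h))"
    if "1 / 10 ^ 58 \<le> prob (strip w (U v) r K)" "1 / 10 ^ 58 \<le> prob (strip w (U v) (- K) (- r))" for v
  proof -
    interpret log_concave_mass "\<lambda>p q. prob (strip w (U v) p q)"
      by (intro log_concave_mass_strip U_mc U_sets)
    have "1 / 10 ^ 58 * h / (6 * K) \<le> prob (strip w (U v) t (t + h))"
      using t that by (intro lower_between[of r]) (auto simp: r_def K_def)
    moreover have "h / 10 ^ 89 \<le> 1 / 10 ^ 58 * h / (6 * K)" using t by (simp add: K_def)
    ultimately show ?thesis by linarith
  qed
  have either: "h / 10 ^ 89 \<le> prob (strip w (U e) t (t + h)) \<or> h / 10 ^ 89 \<le> prob (strip w (U ?ne) t (t + h))"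
  \<comment> \<open>Moments bound Q1+Q4, Q2+Q3, Q1+Q3 and Q2+Q4 from below, but never a pair on one
    side of the axis. If Q1 or Q2 is small, though, the two sums containing it force both Q3 and Q4
    to be large.\<close>
  proof (cases "1 / 10 ^ 58 \<le> Q1 \<and> 1 / 10 ^ 58 \<le> Q2")
    case True
    then show ?thesis using main[of e] by (simp add: Q1_def Q2_def)
  next
    case False
    then have "1 / 10 ^ 58 \<le> Q3 \<and> 1 / 10 ^ 58 \<le> Q4" using Q14 Q23 Q13 Q24 by auto
    then show ?thesis using main[of ?ne] by (simp add: Q3_def Q4_def)
  qed
  have sub: "prob (strip w (U v) t (t + h)) \<le> prob (strip w {x \<in> S. r \<le> \<bar>dot d e x\<bar> \<and> \<bar>dot d e x\<bar> \<le> K} t (t + h))"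
    if "v = e \<or> v = ?ne" for v
  proof (rule finite_measure_mono)
    have "{x \<in> S. r \<le> \<bar>dot d e x\<bar> \<and> \<bar>dot d e x\<bar> \<le> K} = S \<inter> {x \<in> space D. r \<le> \<bar>dot d e x\<bar> \<and> \<bar>dot d e x\<bar> \<le> K}"
      using sets.sets_into_space[OF S] by auto
    also have "\<dots> \<in> sets D" by measurable
    finally show "strip w {x \<in> S. r \<le> \<bar>dot d e x\<bar> \<and> \<bar>dot d e x\<bar> \<le> K} t (t + h) \<in> sets D"
      by (rule strip_sets)
    show "strip w (U v) t (t + h) \<subseteq> strip w {x \<in> S. r \<le> \<bar>dot d e x\<bar> \<and> \<bar>dot d e x\<bar> \<le> K} t (t + h)"
    proof
      fix x assume x: "x \<in> strip w (U v) t (t + h)"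
      have "\<bar>dot d e x\<bar> = \<bar>dot d v x\<bar>" using that by (elim disjE) (simp_all add: dot_uminus_left)
      moreover have "r \<le> dot d v x" "dot d v x \<le> K" using x by (simp_all add: strip_def U_def)
      ultimately have "r \<le> \<bar>dot d e x\<bar>" "\<bar>dot d e x\<bar> \<le> K" using r0 by linarith+
      then show "x \<in> strip w {x \<in> S. r \<le> \<bar>dot d e x\<bar> \<and> \<bar>dot d e x\<bar> \<le> K} t (t + h)"
        using x by (simp add: strip_def U_def)
    qed
  qed
  have "h / 10 ^ 89 \<le> prob (strip w {x \<in> S. r \<le> \<bar>dot d e x\<bar> \<and> \<bar>dot d e x\<bar> \<le> K} t (t + h))"
    using either sub[OF disjI1[OF refl]] sub[OF disjI2[OF refl]] by linarith
  then show ?thesis unfolding r_def K_def .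
qed

end

section \<open>The mass of a wedge\<close>

lemma dot_add_left: "dot d (\<lambda>i. v i + w i) x = dot d v x + dot d w x"
  by (simp add: dot_def distrib_right sum.distrib)

lemma dot_diff_left: "dot d (\<lambda>i. v i - w i) x = dot d v x - dot d w x"
  by (simp add: dot_def left_diff_distrib sum_subtractf)

lemma dot_scale_left: "dot d (\<lambda>i. c * v i) x = c * dot d v x"
  by (simp add: dot_def sum_distrib_left mult.assoc)

lemma dot_add_right: "dot d x (\<lambda>i. v i + w i) = dot d x v + dot d x w"
  by (simp add: dot_def distrib_left sum.distrib)

lemma dot_diff_right: "dot d x (\<lambda>i. v i - w i) = dot d x v - dot d x w"
  by (simp add: dot_def right_diff_distrib sum_subtractf)

lemma dot_scale_right: "dot d x (\<lambda>i. c * v i) = c * dot d x v"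
  by (simp add: dot_def sum_distrib_left mult_ac)

lemmas dot_linear = dot_add_left dot_diff_left dot_scale_left dot_add_right dot_diff_right dot_scale_right

lemma dot_self_nonneg: "0 \<le> dot d v v"
  by (simp add: dot_def sum_nonneg)

lemma dot_self_zero: "dot d v v = 0 \<Longrightarrow> dot d v x = 0"
proof -
  assume "dot d v v = 0"
  then have "\<forall>i<d. v i * v i = 0" unfolding dot_def by (subst (asm) sum_nonneg_eq_0_iff) auto
  then show ?thesis by (simp add: dot_def)
qed

context isotropic_log_concave
begin

text \<open>If \<open>\<langle>e,x\<rangle>\<close> were large with substantial probability inside the slab, then averaging those
  points with the points of the strips around \<open>t\<close>, for all small \<open>t\<close>, would produce too much mass at
  \<open>\<langle>e,x\<rangle> \<ge> k/4\<close>.\<close>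

lemma far_strip_le:
  assumes w: "dot d w w = 1" and e: "dot d e e = 1" and we: "dot d w e = 0"
    and \<beta>: "0 < \<beta>" "\<beta> \<le> 1 / (4 * 10 ^ 71)" and k: "2 * 10 ^ 30 \<le> k"
  shows "prob (strip w {x \<in> space D. k \<le> dot d e x} (- \<beta>) \<beta>) \<le> 10 ^ 175 * \<beta> / k\<^sup>2"
proof -
  define r :: real where "r = 1 / 10 ^ 71"
  define P where "P = prob (strip w {x \<in> space D. k \<le> dot d e x} (- \<beta>) \<beta>)"
  define \<kappa> where "\<kappa> = sqrt (P * (2 * \<beta> / 10 ^ 89))"
  define T where "T = {x \<in> space D. k / 4 \<le> dot d e x}"
  have T[measurable]: "T \<in> sets D" unfolding T_def by measurable
  have r: "0 < r" "\<beta> \<le> r / 4" using \<beta> by (auto simp: r_def)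
  have k0: "0 < k" using k by simp
  interpret log_concave_mass "\<lambda>p q. prob (strip w T p q)"
    using midpoint_space by (intro log_concave_mass_strip T) (auto simp: midpoint_closed_def T_def dot_midpoint)
  have M: "\<kappa> \<le> prob (strip w T (t / 2 - \<beta>) (t / 2 + \<beta>))" if t: "- r \<le> t - \<beta>" "t + \<beta> \<le> r" for t
  proof -
    let ?A = "strip w {x \<in> space D. k \<le> dot d e x} (- \<beta>) \<beta>"
    let ?B = "strip w {x \<in> space D. 1 / 10 ^ 71 \<le> \<bar>dot d e x\<bar> \<and> \<bar>dot d e x\<bar> \<le> 10 ^ 30} (t - \<beta>) (t - \<beta> + 2 * \<beta>)"
    have "2 * \<beta> / 10 ^ 89 \<le> prob ?B"
      using t \<beta> midpoint_space by (intro slab_off_axis_ge w e we) (auto simp: r_def midpoint_closed_def)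
    then have "P * (2 * \<beta> / 10 ^ 89) \<le> prob ?A * prob ?B"
      unfolding P_def by (intro mult_left_mono) auto
    also have "\<dots> \<le> (prob (strip w T (t / 2 - \<beta>) (t / 2 + \<beta>)))\<^sup>2"
    proof (rule prob_midpoint)
      fix x y assume x: "x \<in> ?A" and y: "y \<in> ?B"
      have "k \<le> dot d e x" "- (10 ^ 30) \<le> dot d e y" using x y by (auto simp: strip_def abs_le_iff)
      \<comment> \<open>The average is at least (k - 10^30)/2, which is at least k/4 since k >= 2 *
        10^30.\<close>
      then have "k / 4 \<le> dot d e (seg_midpoint d x y)" using k by (simp add: dot_midpoint)
      then show "seg_midpoint d x y \<in> strip w T (t / 2 - \<beta>) (t / 2 + \<beta>)"
        using x y by (auto simp: strip_def T_def dot_midpoint midpoint_space)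
    qed measurable
    finally show ?thesis unfolding \<kappa>_def by (intro real_le_lsqrt) auto
  qed
  define n where "n = nat \<lfloor>r / (4 * \<beta>)\<rfloor>"
  have ge1: "1 \<le> r / (4 * \<beta>)" using r \<beta> by (simp add: field_simps)
  then have n: "real n \<le> r / (4 * \<beta>)" "r / (4 * \<beta>) - 1 < real n" "0 < real n" unfolding n_def by linarith+
  have "1 \<le> real n" using n(3) by simp
  then have n2: "r / (8 * \<beta>) \<le> real n" using n(2) by (simp add: field_simps)
  have n3: "real n * (4 * \<beta>) \<le> r" using n(1) \<beta> by (simp add: field_simps)
  have \<kappa>0: "0 \<le> \<kappa>" using \<beta> by (simp add: \<kappa>_def P_def)
  have "real n * \<kappa> \<le> prob (strip w T 0 (0 + real n * (2 * \<beta>)))"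
  proof (rule packing)
    fix j assume "j < n"
    then have "real j + 1 \<le> real n" by simp
    then have "(real j + 1) * (4 * \<beta>) \<le> real n * (4 * \<beta>)" using \<beta> by (intro mult_right_mono) auto
    then have "(real j + 1) * (4 * \<beta>) \<le> r" using n3 by linarith
    then have le: "4 * (real j * \<beta>) + 4 * \<beta> \<le> r" by (simp add: algebra_simps)
    \<comment> \<open>For t = 2\<beta>(2j + 1) the averaged windows around t/2 are the consecutive
      intervals [2\<beta>j, 2\<beta>(j + 1)), hence disjoint.\<close>
    have eq: "2 * \<beta> * (2 * real j + 1) / 2 - \<beta> = 0 + real j * (2 * \<beta>)"
      "2 * \<beta> * (2 * real j + 1) / 2 + \<beta> = 0 + real (Suc j) * (2 * \<beta>)"
      by (simp_all add: field_simps)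
    have pos: "0 \<le> real j * \<beta>" using \<beta> by simp
    have "2 * \<beta> * (2 * real j + 1) = 4 * (real j * \<beta>) + 2 * \<beta>" by (simp add: algebra_simps)
    then have "- r \<le> 2 * \<beta> * (2 * real j + 1) - \<beta>" "2 * \<beta> * (2 * real j + 1) + \<beta> \<le> r"
      using r \<beta>(1) le pos by linarith+
    from M[OF this] show "\<kappa> \<le> prob (strip w T (0 + real j * (2 * \<beta>)) (0 + real (Suc j) * (2 * \<beta>)))"
      unfolding eq .
  qed (use \<beta> in auto)
  also have "\<dots> \<le> prob {x \<in> space D. k / 4 \<le> \<bar>dot d e x\<bar>}"
    by (intro finite_measure_mono) (auto simp: strip_def T_def)
  also have "\<dots> \<le> 1 / (k / 4)\<^sup>2" using k0 by (intro chebyshev e) auto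
  finally have "real n * \<kappa> \<le> 16 / k\<^sup>2" by (simp add: power_divide)
  then have "r / (8 * \<beta>) * \<kappa> \<le> 16 / k\<^sup>2" using mult_right_mono[OF n2 \<kappa>0] by linarith
  then have "\<kappa> \<le> 128 * \<beta> / (r * k\<^sup>2)" using r \<beta> k0 by (simp add: field_simps)
  then have "\<kappa>\<^sup>2 \<le> (128 * \<beta> / (r * k\<^sup>2))\<^sup>2" using \<kappa>0 by (rule power_mono)
  then have "P * (2 * \<beta> / 10 ^ 89) \<le> (128 * \<beta> / (r * k\<^sup>2))\<^sup>2"
    using \<beta> by (simp add: \<kappa>_def P_def)
  then have "P * 2 * r\<^sup>2 * k ^ 4 \<le> 10 ^ 89 * 16384 * \<beta>"
    using \<beta> r k0 by (simp add: power_divide power_mult_distrib field_simps power2_eq_square power4_eq_xxxx)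
  then have "P * k ^ 4 \<le> 8192 * 10 ^ 231 * \<beta>" by (simp add: r_def power_divide)
  \<comment> \<open>The argument gives decay of order k^-4. Decay k^-2 is enough for summing over
    shells, so two of the powers are spent on the numerical constant.\<close>
  moreover have "P * (4 * 10 ^ 60) * k\<^sup>2 \<le> P * k ^ 4"
  proof -
    have "(2 * 10 ^ 30)\<^sup>2 \<le> k\<^sup>2" using k by (intro power_mono) auto
    then have "P * k\<^sup>2 * (4 * 10 ^ 60) \<le> P * k\<^sup>2 * k\<^sup>2" by (intro mult_left_mono) (auto simp: P_def)
    then show ?thesis by (simp add: power2_eq_square power4_eq_xxxx mult_ac)
  qed
  ultimately have "P * k\<^sup>2 \<le> 10 ^ 175 * \<beta>" using \<beta> by simp
  then show ?thesis using k0 by (simp add: P_def field_simps)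
qed

lemma far_slab_le:
  assumes w: "dot d w w = 1" and e: "dot d e e = 1" and we: "dot d w e = 0"
    and \<beta>: "0 < \<beta>" "\<beta> \<le> 1 / (8 * 10 ^ 71)" and k: "2 * 10 ^ 30 \<le> k"
  shows "prob {x \<in> space D. \<bar>dot d w x\<bar> \<le> \<beta> \<and> k \<le> \<bar>dot d e x\<bar>} \<le> 4 * 10 ^ 175 * \<beta> / k\<^sup>2"
proof -
  let ?n = "\<lambda>i. - e i"
  have n: "dot d ?n ?n = 1" "dot d w ?n = 0" using e we by (auto simp: dot_def sum_negf)
  have "prob {x \<in> space D. \<bar>dot d w x\<bar> \<le> \<beta> \<and> k \<le> \<bar>dot d e x\<bar>} \<le>
      prob (strip w {x \<in> space D. k \<le> dot d e x} (- (2 * \<beta>)) (2 * \<beta>) \<union> strip w {x \<in> space D. k \<le> dot d ?n x} (- (2 * \<beta>)) (2 * \<beta>))"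
    using \<beta> by (intro finite_measure_mono) (auto simp: strip_def dot_uminus_left)
  also have "\<dots> \<le> 10 ^ 175 * (2 * \<beta>) / k\<^sup>2 + 10 ^ 175 * (2 * \<beta>) / k\<^sup>2"
    using \<beta> by (intro order.trans[OF measure_Un_le] add_mono far_strip_le w e we n k) auto
  finally show ?thesis by simp
qed

text \<open>Dyadic shells: for k <= |<e,x>| < 2k the wedge lies in the slab of half-width
  2k\<delta>, where \<open>far_slab_le\<close> gives mass of order \<delta>/k. These sum
  geometrically, and the innermost part is a single slab. The last hypothesis keeps the slabs thin
  enough for \<open>far_slab_le\<close>.\<close>

lemma wedge_bounded_le:
  assumes w: "dot d w w = 1" and e: "dot d e e = 1" and we: "dot d w e = 0" and \<delta>: "0 < \<delta>"
    and "\<delta> * (2 * 10 ^ 30) * 2 ^ J \<le> 1 / (8 * 10 ^ 71)"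
  shows "prob {x \<in> space D. \<bar>dot d w x\<bar> \<le> \<delta> * \<bar>dot d e x\<bar> \<and> \<bar>dot d e x\<bar> < 2 * 10 ^ 30 * 2 ^ J} \<le>
     (4 * 10 ^ 42 + 8 * 10 ^ 145 * (1 - (1/2) ^ J)) * \<delta>"
  using assms(5)
proof (induction J)
  case 0
  have "prob {x \<in> space D. \<bar>dot d w x\<bar> \<le> \<delta> * \<bar>dot d e x\<bar> \<and> \<bar>dot d e x\<bar> < 2 * 10 ^ 30 * 2 ^ 0} \<le>
     prob {x \<in> space D. \<bar>dot d w x\<bar> \<le> \<delta> * (2 * 10 ^ 30)}"
    using \<delta> by (intro finite_measure_mono) (auto elim!: order.trans intro!: mult_left_mono)
  also have "\<dots> \<le> 2 * 10 ^ 12 * (\<delta> * (2 * 10 ^ 30))" using \<delta> by (intro slab_le w) auto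
  finally show ?case by simp
next
  case (Suc J)
  define k :: real where "k = 2 * 10 ^ 30 * 2 ^ J"
  have k: "2 * 10 ^ 30 \<le> k" by (simp add: k_def)
  have k0: "0 < k" by (simp add: k_def)
  have d2: "\<delta> * (2 * k) \<le> 1 / (8 * 10 ^ 71)" using Suc.prems by (simp add: k_def mult_ac)
  have IH: "prob {x \<in> space D. \<bar>dot d w x\<bar> \<le> \<delta> * \<bar>dot d e x\<bar> \<and> \<bar>dot d e x\<bar> < k} \<le>
     (4 * 10 ^ 42 + 8 * 10 ^ 145 * (1 - (1/2) ^ J)) * \<delta>"
    unfolding k_def
  proof (rule Suc.IH)
    have "\<delta> * (2 * 10 ^ 30) * 2 ^ J \<le> \<delta> * (2 * 10 ^ 30) * 2 ^ Suc J" using \<delta> by simp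
    then show "\<delta> * (2 * 10 ^ 30) * 2 ^ J \<le> 1 / (8 * 10 ^ 71)" using Suc.prems by linarith
  qed
  have m1: "{x \<in> space D. \<bar>dot d w x\<bar> \<le> \<delta> * \<bar>dot d e x\<bar> \<and> \<bar>dot d e x\<bar> < k} \<in> sets D"
    by (intro sets.sets_Collect_conj) measurable
  have m2: "{x \<in> space D. \<bar>dot d w x\<bar> \<le> \<delta> * (2 * k) \<and> k \<le> \<bar>dot d e x\<bar>} \<in> sets D"
    by measurable
  have "prob {x \<in> space D. \<bar>dot d w x\<bar> \<le> \<delta> * \<bar>dot d e x\<bar> \<and> \<bar>dot d e x\<bar> < 2 * k} \<le>
    prob ({x \<in> space D. \<bar>dot d w x\<bar> \<le> \<delta> * \<bar>dot d e x\<bar> \<and> \<bar>dot d e x\<bar> < k} \<union>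
      {x \<in> space D. \<bar>dot d w x\<bar> \<le> \<delta> * (2 * k) \<and> k \<le> \<bar>dot d e x\<bar>})"
    using \<delta> by (intro finite_measure_mono sets.Un m1 m2) (auto elim!: order.trans intro!: mult_left_mono)
  also have "\<dots> \<le> (4 * 10 ^ 42 + 8 * 10 ^ 145 * (1 - (1/2) ^ J)) * \<delta> + 4 * 10 ^ 175 * (\<delta> * (2 * k)) / k\<^sup>2"
    using \<delta> k0 by (intro order.trans[OF measure_Un_le] add_mono IH far_slab_le w e we d2 k m1 m2) auto
  also have "4 * 10 ^ 175 * (\<delta> * (2 * k)) / k\<^sup>2 = 8 * 10 ^ 175 * \<delta> / k" using k0 by (simp add: power2_eq_square)
  also have "\<dots> = 4 * 10 ^ 145 * (1/2) ^ J * \<delta>" by (simp add: k_def power_divide)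
  also have "(4 * 10 ^ 42 + 8 * 10 ^ 145 * (1 - (1/2) ^ J)) * \<delta> + 4 * 10 ^ 145 * (1/2) ^ J * \<delta>
     = (4 * 10 ^ 42 + 8 * 10 ^ 145 * (1 - (1/2) ^ Suc J)) * \<delta>"
    by (simp add: algebra_simps)
  finally show ?case by (simp add: k_def mult_ac)
qed

text \<open>The shells are used up to the last J for which their slabs are thin enough. Then k is of
  order 1/\<delta>, and Chebyshev bounds the rest by a multiple of \<delta>^2.\<close>

lemma wedge_le:
  assumes w: "dot d w w = 1" and e: "dot d e e = 1" and we: "dot d w e = 0" and \<delta>: "0 < \<delta>"
  shows "prob {x \<in> space D. \<bar>dot d w x\<bar> \<le> \<delta> * \<bar>dot d e x\<bar>} \<le> 10 ^ 147 * \<delta>"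
proof (cases "\<delta> * (2 * 10 ^ 30) \<le> 1 / (8 * 10 ^ 71)")
  case False
  then have "1 \<le> 10 ^ 147 * \<delta>" by simp
  then show ?thesis using prob_le_1 order.trans by blast
next
  case True
  let ?s = "1 / (8 * 10 ^ 71) :: real"
  let ?b = "\<lambda>n. \<delta> * (2 * 10 ^ 30) * 2 ^ n"
  obtain N where "?s / (\<delta> * (2 * 10 ^ 30)) < 2 ^ N" using real_arch_pow[of 2] by auto
  then have "?s < ?b N" using \<delta> by (simp add: field_simps)
  then have "\<exists>n. ?s < ?b n" by blast
  then obtain n where n: "?s < ?b n" "\<And>m. m < n \<Longrightarrow> ?b m \<le> ?s"
    using exists_least_iff[of "\<lambda>n. ?s < ?b n"] by (auto simp: not_less)
  have "n \<noteq> 0" using n(1) True by (intro notI) simp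
  then obtain J where J: "n = Suc J" by (cases n) auto
  define k :: real where "k = 2 * 10 ^ 30 * 2 ^ J"
  have bJ: "?b J \<le> ?s" using n(2) J by blast
  have k0: "0 < k" by (simp add: k_def)
  have ks: "?s < 2 * (\<delta> * k)" using n(1) by (simp add: J k_def mult_ac)
  have m1: "{x \<in> space D. \<bar>dot d w x\<bar> \<le> \<delta> * \<bar>dot d e x\<bar> \<and> \<bar>dot d e x\<bar> < k} \<in> sets D"
    by (intro sets.sets_Collect_conj) measurable
  have m2: "{x \<in> space D. k \<le> \<bar>dot d e x\<bar>} \<in> sets D" by measurable
  have "prob {x \<in> space D. \<bar>dot d w x\<bar> \<le> \<delta> * \<bar>dot d e x\<bar>} \<le>
    prob ({x \<in> space D. \<bar>dot d w x\<bar> \<le> \<delta> * \<bar>dot d e x\<bar> \<and> \<bar>dot d e x\<bar> < k} \<union> {x \<in> space D. k \<le> \<bar>dot d e x\<bar>})"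
    by (intro finite_measure_mono sets.Un m1 m2) auto
  also have "\<dots> \<le> (4 * 10 ^ 42 + 8 * 10 ^ 145 * (1 - (1/2) ^ J)) * \<delta> + 1 / k\<^sup>2"
    unfolding k_def
    by (intro order.trans[OF measure_Un_le] add_mono wedge_bounded_le[OF w e we \<delta> bJ] chebyshev e m1[unfolded k_def] m2[unfolded k_def]) auto
  also have "(4 * 10 ^ 42 + 8 * 10 ^ 145 * (1 - (1/2) ^ J)) * \<delta> \<le> (4 * 10 ^ 42 + 8 * 10 ^ 145) * \<delta>"
    using \<delta> by (intro mult_right_mono) auto
  also have "1 / k\<^sup>2 \<le> 10 ^ 146 * \<delta>"
  proof -
    have "?s\<^sup>2 \<le> (2 * (\<delta> * k))\<^sup>2" using ks by (intro power_mono) auto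
    also have "\<dots> = 4 * \<delta> * \<delta> * k\<^sup>2" by (simp add: power2_eq_square)
    also have "\<dots> \<le> 4 * \<delta> * 1 * k\<^sup>2" using True \<delta> by (intro mult_right_mono mult_left_mono) auto
    finally have "1 \<le> 10 ^ 146 * \<delta> * k\<^sup>2" by (simp add: power2_eq_square)
    then show ?thesis using k0 by (simp add: field_simps)
  qed
  finally show ?thesis using \<delta> by simp
qed

end

section \<open>Correlations in a band\<close>

text \<open>Written with squares to match what a program without absolute values can test.\<close>

definition band_filter :: "nat \<Rightarrow> (nat \<Rightarrow> real) \<Rightarrow> real \<Rightarrow> (nat \<Rightarrow> real) \<Rightarrow> real" where
  "band_filter d w b x = (if (dot d w x)\<^sup>2 \<le> b\<^sup>2 then 1 else 0)"

text \<open>Cutting off at a ball and dividing by its radius keeps the values in [-1, 1]. One ball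
  for all coordinates, rather than a cut per coordinate, lets the answers combine into inner
  products with arbitrary vectors, and the ball is midpoint-closed.\<close>

definition coord_query :: "nat \<Rightarrow> real \<Rightarrow> nat \<Rightarrow> (nat \<Rightarrow> real) \<Rightarrow> real \<Rightarrow> real" where
  "coord_query d R i x l = (if dot d x x \<le> R\<^sup>2 then l * x i / R else 0)"

lemma halfspace_dot: "halfspace d v x = (if 0 \<le> dot d v x then 1 else - 1)"
  by (simp add: halfspace_def dot_def)

lemma dot_unit: "i < d \<Longrightarrow> dot d (\<lambda>j. if j = i then 1 else 0) x = x i"
  unfolding dot_def by (simp add: if_distrib[of "\<lambda>c. c * _"] cong: if_cong)

lemma dot_cauchy_schwarz: "(dot d v x)\<^sup>2 \<le> dot d v v * dot d x x"
  using Cauchy_Schwarz_ineq_sum[of v x "{..<d}"] by (simp add: dot_def power2_eq_square)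

lemma orthogonal_decomposition:
  assumes W: "0 < dot d w w" and v: "dot d v v = 1" and \<alpha>: "\<alpha> = dot d v w / dot d w w"
  shows "dot d w (\<lambda>i. v i - \<alpha> * w i) = 0"
    and "dot d (\<lambda>i. v i - \<alpha> * w i) (\<lambda>i. v i - \<alpha> * w i) = 1 - (dot d v w)\<^sup>2 / dot d w w"
    and "dot d v x = \<alpha> * dot d w x + dot d (\<lambda>i. v i - \<alpha> * w i) x"
proof -
  have m: "dot d v w = \<alpha> * dot d w w" using W by (simp add: \<alpha>)
  show "dot d w (\<lambda>i. v i - \<alpha> * w i) = 0" by (simp add: dot_linear dot_commute[of d w v] m)
  have "(dot d v w)\<^sup>2 / dot d w w = \<alpha> * dot d v w" using W by (simp add: \<alpha> power2_eq_square)
  then show "dot d (\<lambda>i. v i - \<alpha> * w i) (\<lambda>i. v i - \<alpha> * w i) = 1 - (dot d v w)\<^sup>2 / dot d w w"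
    by (simp add: dot_linear dot_commute[of d w v] m v)
  show "dot d v x = \<alpha> * dot d w x + dot d (\<lambda>i. v i - \<alpha> * w i) x" by (simp add: dot_linear)
qed

lemma coord_le_norm: "i < d \<Longrightarrow> (x i)\<^sup>2 \<le> dot d x x"
  unfolding dot_def power2_eq_square by (rule member_le_sum) auto

lemma coord_query_bounded:
  assumes "i < d" "0 < R" "\<bar>l\<bar> \<le> 1"
  shows "\<bar>coord_query d R i x l\<bar> \<le> 1"
proof (cases "dot d x x \<le> R\<^sup>2")
  case True
  then have "(x i)\<^sup>2 \<le> R\<^sup>2" using coord_le_norm[OF assms(1), of x] by linarith
  then have "\<bar>x i\<bar> \<le> R" using assms by (intro abs_le_square_iff[THEN iffD2, of "x i" R, simplified abs_of_pos[OF assms(2)]])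
  then have "\<bar>l\<bar> * \<bar>x i\<bar> \<le> 1 * R" using assms by (intro mult_mono) auto
  then show ?thesis using True assms by (simp add: coord_query_def abs_mult)
qed (simp add: coord_query_def)

context isotropic_log_concave
begin

lemma measurable_norm [measurable]: "(\<lambda>x. dot d x x) \<in> borel_measurable D"
  unfolding dot_def by measurable

lemma measurable_halfspace [measurable]: "halfspace d v \<in> borel_measurable D"
  unfolding halfspace_dot[abs_def] by measurable

lemma measurable_band_filter [measurable]: "band_filter d w b \<in> borel_measurable D"
  unfolding band_filter_def[abs_def] by measurable

lemma measurable_coord_query: "i < d \<Longrightarrow> (\<lambda>x. coord_query d R i x l) \<in> borel_measurable D"
  unfolding coord_query_def[abs_def] by measurable

text \<open>Where the halfspaces disagree, the part of <v,x> along w is outweighed by <u,x> with |u|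
  <= \<delta>. For \<delta> <= 1/2 this places x in a wedge of slope 2\<delta>.\<close>

theorem halfspace_error_le:
  assumes v: "dot d v v = 1" and vw: "0 < dot d v w" and \<delta>: "0 \<le> \<delta>"
    and angle: "(1 - \<delta>\<^sup>2) * dot d w w \<le> (dot d v w)\<^sup>2"
  shows "prob {x \<in> space D. halfspace d w x \<noteq> halfspace d v x} \<le> 2 * 10 ^ 147 * \<delta>"
proof -
  define W where "W = dot d w w"
  define \<alpha> where "\<alpha> = dot d v w / dot d w w"
  define u where "u = (\<lambda>i. v i - \<alpha> * w i)"
  have W: "0 < W"
    using dot_self_nonneg[of d w] dot_self_zero[of d w v] vw by (auto simp: W_def less_le dot_commute)
  note dec = orthogonal_decomposition[OF W[unfolded W_def] v \<alpha>_def, folded u_def]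
  have \<alpha>: "0 < \<alpha>" using W vw by (simp add: \<alpha>_def W_def)
  have "1 - \<delta>\<^sup>2 \<le> (dot d v w)\<^sup>2 / dot d w w" using angle W by (simp add: W_def pos_le_divide_eq)
  then have uu: "dot d u u \<le> \<delta>\<^sup>2" using dec(2) by simp
  show ?thesis
  proof (cases "dot d u u = 0")
    case True
    then have "dot d v x = \<alpha> * dot d w x" for x using dec(3)[of x] dot_self_zero by simp
    then have empty: "{x \<in> space D. halfspace d w x \<noteq> halfspace d v x} = {}"
      using \<alpha> by (auto simp: halfspace_dot zero_le_mult_iff)
    show ?thesis unfolding empty using \<delta> by simp
  next
    case False
    then have u0: "0 < dot d u u" using dot_self_nonneg[of d u] by simp
    define N where "N = sqrt (dot d u u)"
    have N: "0 < N" "N\<^sup>2 = dot d u u" "N \<le> \<delta>" using u0 uu \<delta> by (auto simp: N_def intro: real_le_lsqrt)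
    then have \<delta>0: "0 < \<delta>" by linarith
    define e where "e = (\<lambda>i. 1 / N * u i)"
    define wn where "wn = (\<lambda>i. 1 / sqrt W * w i)"
    have e1: "dot d e e = 1" unfolding e_def dot_scale_left dot_scale_right using N u0 by (simp add: power2_eq_square field_simps)
    have w1: "dot d wn wn = 1" unfolding wn_def dot_scale_left dot_scale_right W_def[symmetric] using W by simp
    have we: "dot d wn e = 0" unfolding e_def wn_def dot_scale_left dot_scale_right using dec(1) by simp
    show ?thesis
    proof (cases "\<delta> \<le> 1/2")
      case False
      then have "1 \<le> 2 * 10 ^ 147 * \<delta>" by simp
      then show ?thesis using prob_le_1 order.trans by blast
    next
      case True
      \<comment> \<open>This product is the cosine of the angle between v and w.\<close>
      have c: "1/2 \<le> \<alpha> * sqrt W"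
      proof (rule power2_le_imp_le)
        have "(1/2 :: real)\<^sup>2 \<le> 1 - (1/2)\<^sup>2" by (simp add: power2_eq_square)
        also have "\<dots> \<le> 1 - \<delta>\<^sup>2" using True \<delta> by (intro diff_left_mono power_mono) auto
        also have "\<dots> \<le> (dot d v w)\<^sup>2 / W" using angle W by (simp add: W_def field_simps)
        also have "\<dots> = (\<alpha> * sqrt W)\<^sup>2"
        proof -
          have "(\<alpha> * sqrt W)\<^sup>2 = \<alpha>\<^sup>2 * W" using W by (simp add: power_mult_distrib)
          then show ?thesis using W by (simp add: \<alpha>_def W_def[symmetric] power_divide power2_eq_square)
        qed
        finally show "(1/2)\<^sup>2 \<le> (\<alpha> * sqrt W)\<^sup>2" .
      qed (use \<alpha> W in auto)
      have "prob {x \<in> space D. halfspace d w x \<noteq> halfspace d v x} \<le>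
        prob {x \<in> space D. \<bar>dot d wn x\<bar> \<le> (2 * \<delta>) * \<bar>dot d e x\<bar>}"
      proof (rule finite_measure_mono)
        have "{x \<in> space D. \<bar>dot d wn x\<bar> - (2 * \<delta>) * \<bar>dot d e x\<bar> \<le> 0} \<in> sets D" by measurable
        then show "{x \<in> space D. \<bar>dot d wn x\<bar> \<le> (2 * \<delta>) * \<bar>dot d e x\<bar>} \<in> sets D" by simp
        show "{x \<in> space D. halfspace d w x \<noteq> halfspace d v x} \<subseteq> {x \<in> space D. \<bar>dot d wn x\<bar> \<le> (2 * \<delta>) * \<bar>dot d e x\<bar>}"
        proof safe
          fix x assume ne: "halfspace d w x \<noteq> halfspace d v x"
          define a where "a = \<alpha> * dot d w x"
          have "dot d v x = a + dot d u x" using dec(3)[of x] by (simp add: a_def)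
          moreover have "0 \<le> a \<longleftrightarrow> 0 \<le> dot d w x" using \<alpha> by (simp add: a_def zero_le_mult_iff)
          ultimately have "\<bar>a\<bar> \<le> \<bar>dot d u x\<bar>" using ne by (auto simp: halfspace_dot split: if_splits)
          also have "dot d u x = N * dot d e x" unfolding e_def dot_scale_left using N by simp
          also have "\<bar>N * dot d e x\<bar> \<le> \<delta> * \<bar>dot d e x\<bar>" using N by (simp add: abs_mult mult_right_mono)
          finally have 1: "\<bar>a\<bar> \<le> \<delta> * \<bar>dot d e x\<bar>" .
          have "a = \<alpha> * sqrt W * dot d wn x" unfolding a_def wn_def dot_scale_left using W by simp
          then have "\<bar>a\<bar> = \<alpha> * sqrt W * \<bar>dot d wn x\<bar>" using \<alpha> W by (simp add: abs_mult)
          then have "1/2 * \<bar>dot d wn x\<bar> \<le> \<bar>a\<bar>" using c by (simp only:) (rule mult_right_mono, auto)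
          with 1 show "\<bar>dot d wn x\<bar> \<le> 2 * \<delta> * \<bar>dot d e x\<bar>" by simp
        qed
      qed
      also have "\<dots> \<le> 10 ^ 147 * (2 * \<delta>)" using \<delta>0 by (intro wedge_le w1 e1 we) auto
      finally show ?thesis by simp
    qed
  qed
qed

definition ball :: "real \<Rightarrow> (nat \<Rightarrow> real) set" where
  "ball R = {x \<in> space D. dot d x x \<le> R\<^sup>2}"

lemma ball_sets [measurable]: "ball R \<in> sets D"
  unfolding ball_def by measurable

lemma ball_midpoint_closed: "midpoint_closed d (ball R)"
proof -
  have avg: "dot d (seg_midpoint d x y) (seg_midpoint d x y) \<le> (dot d x x + dot d y y) / 2" for x y
  proof -
    have "dot d (seg_midpoint d x y) (seg_midpoint d x y) = (\<Sum>i<d. ((x i + y i) / 2) * ((x i + y i) / 2))"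
      by (simp add: dot_def seg_midpoint_def)
    also have "\<dots> \<le> (\<Sum>i<d. (x i * x i + y i * y i) / 2)"
    proof (rule sum_mono)
      fix i
      show "((x i + y i) / 2) * ((x i + y i) / 2) \<le> (x i * x i + y i * y i) / 2"
        using sum_squares_bound[of "x i" "y i"] by (simp add: field_simps power2_eq_square)
    qed
    also have "\<dots> = (dot d x x + dot d y y) / 2"
      by (simp add: dot_def sum.distrib[symmetric] sum_divide_distrib)
    finally show ?thesis .
  qed
  have "dot d (seg_midpoint d x y) (seg_midpoint d x y) \<le> R\<^sup>2" if "dot d x x \<le> R\<^sup>2" "dot d y y \<le> R\<^sup>2" for x y
    by (rule order.trans[OF avg]) (use that in simp)
  then show ?thesis
    unfolding midpoint_closed_def ball_def using midpoint_space by auto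
qed

lemma ball_complement_le:
  assumes R: "10 ^ 58 * real d \<le> R\<^sup>2" "0 < R"
  shows "prob (space D - ball R) \<le> 1 / 10 ^ 58"
proof -
  have int: "integrable D (\<lambda>x. dot d x x)"
    using isotropic unfolding dot_def isotropic_def by (intro Bochner_Integration.integrable_sum) auto
  have "R\<^sup>2 * prob (space D - ball R) = expectation (\<lambda>x. R\<^sup>2 * indicator (space D - ball R) x)" by simp
  also have "\<dots> \<le> expectation (\<lambda>x. dot d x x)"
    using int dot_self_nonneg
    by (intro integral_mono integrable_mult_right integrable_real_indicator)
      (auto simp: less_top[symmetric] indicator_def ball_def)
  also have "\<dots> = real d"
    using isotropic unfolding dot_def isotropic_def by (subst Bochner_Integration.integral_sum) auto
  also have "\<dots> \<le> R\<^sup>2 * (1 / 10 ^ 58)" using R by simp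
  finally show ?thesis using R by (subst (asm) mult_le_cancel_left_pos) auto
qed

definition band :: "(nat \<Rightarrow> real) \<Rightarrow> real \<Rightarrow> (nat \<Rightarrow> real) set" where
  "band w b = {x \<in> space D. (dot d w x)\<^sup>2 \<le> b\<^sup>2}"

lemma band_sets [measurable]: "band w b \<in> sets D"
  unfolding band_def by measurable

lemma integral_band_filter: "(\<integral>x. band_filter d w b x \<partial>D) = prob (band w b)"
proof -
  have "(\<integral>x. band_filter d w b x \<partial>D) = (\<integral>x. indicator (band w b) x \<partial>D)"
    by (intro Bochner_Integration.integral_cong) (auto simp: band_filter_def band_def)
  then show ?thesis by simp
qed

definition gradient :: "(nat \<Rightarrow> real) \<Rightarrow> (nat \<Rightarrow> real) \<Rightarrow> real \<Rightarrow> real \<Rightarrow> nat \<Rightarrow> real" where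
  "gradient v w b R i = (\<integral>x. coord_query d R i x (halfspace d v x) \<partial>filtered D (band_filter d w b))"

text \<open>The integrand whose expectation, divided by R times the mass of the band, is the inner
  product of \<open>u\<close> with the gradient.\<close>

definition signal :: "(nat \<Rightarrow> real) \<Rightarrow> (nat \<Rightarrow> real) \<Rightarrow> real \<Rightarrow> real \<Rightarrow> (nat \<Rightarrow> real) \<Rightarrow> (nat \<Rightarrow> real) \<Rightarrow> real" where
  "signal v w b R u x = indicator (band w b \<inter> ball R) x * (halfspace d v x * dot d u x)"

lemma integrable_signal: "integrable D (signal v w b R u)"
proof (rule Bochner_Integration.integrable_bound[OF integrable_dot[of u]])
  show "signal v w b R u \<in> borel_measurable D"
    unfolding signal_def[abs_def] by measurable
qed (auto simp: signal_def indicator_def halfspace_dot abs_mult)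

lemma dot_gradient:
  assumes p: "0 < prob (band w b)" and R: "0 < R"
  shows "dot d u (gradient v w b R) = expectation (signal v w b R u) / (R * prob (band w b))"
proof -
  let ?p = "prob (band w b)"
  have grad: "gradient v w b R i = expectation (signal v w b R (\<lambda>j. if j = i then 1 else 0)) / (R * ?p)" if i: "i < d" for i
  proof -
    have m: "(\<lambda>x. coord_query d R i x (halfspace d v x)) \<in> borel_measurable D"
      using i unfolding coord_query_def[abs_def] by measurable
    have "gradient v w b R i = (\<integral>x. (band_filter d w b x / ?p) *\<^sub>R coord_query d R i x (halfspace d v x) \<partial>D)"
      unfolding gradient_def filtered_def integral_band_filter using m p
      by (intro integral_density) (auto simp: band_filter_def)
    also have "\<dots> = (\<integral>x. signal v w b R (\<lambda>j. if j = i then 1 else 0) x / (R * ?p) \<partial>D)"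
      by (intro Bochner_Integration.integral_cong refl)
        (auto simp: signal_def dot_unit[OF i] band_filter_def band_def ball_def coord_query_def)
    also have "\<dots> = expectation (signal v w b R (\<lambda>j. if j = i then 1 else 0)) / (R * ?p)" by simp
    finally show ?thesis .
  qed
  have "dot d u (gradient v w b R) = (\<Sum>i<d. u i * expectation (signal v w b R (\<lambda>j. if j = i then 1 else 0))) / (R * ?p)"
    by (simp add: dot_def grad sum_divide_distrib)
  also have "(\<Sum>i<d. u i * expectation (signal v w b R (\<lambda>j. if j = i then 1 else 0))) =
     expectation (\<lambda>x. \<Sum>i<d. u i * signal v w b R (\<lambda>j. if j = i then 1 else 0) x)"
    using integrable_signal by (subst Bochner_Integration.integral_sum) auto
  also have "\<dots> = expectation (signal v w b R u)"
  proof (intro Bochner_Integration.integral_cong refl)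
    fix x
    have "(\<Sum>i<d. u i * dot d (\<lambda>j. if j = i then 1 else 0) x) = dot d u x"
      by (simp add: dot_def[of d u] dot_unit)
    moreover have "(\<Sum>i<d. u i * signal v w b R (\<lambda>j. if j = i then 1 else 0) x) =
       indicator (band w b \<inter> ball R) x * halfspace d v x * (\<Sum>i<d. u i * dot d (\<lambda>j. if j = i then 1 else 0) x)"
      unfolding signal_def sum_distrib_left by (intro sum.cong refl) (simp add: mult_ac)
    ultimately show "(\<Sum>i<d. u i * signal v w b R (\<lambda>j. if j = i then 1 else 0) x) = signal v w b R u x"
      by (simp add: signal_def)
  qed
  finally show ?thesis .
qed

lemma gradient_target_nonneg:
  assumes "0 < prob (band w b)" "0 < R"
  shows "0 \<le> dot d v (gradient v w b R)"
proof -
  have "0 \<le> expectation (signal v w b R v)"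
    by (intro Bochner_Integration.integral_nonneg) (auto simp: signal_def halfspace_dot indicator_def)
  then show ?thesis using assms by (simp add: dot_gradient)
qed

lemma expectation_signal_le:
  assumes "\<And>x. x \<in> band w b \<Longrightarrow> x \<in> ball R \<Longrightarrow> \<bar>dot d u x\<bar> \<le> C" and "0 \<le> C"
  shows "expectation (signal v w b R u) \<le> C * prob (band w b)"
proof -
  have "expectation (signal v w b R u) \<le> expectation (\<lambda>x. C * indicator (band w b) x)"
  proof (intro integral_mono integrable_signal integrable_mult_right integrable_real_indicator)
    fix x
    have "halfspace d v x * dot d u x \<le> \<bar>dot d u x\<bar>" using abs_ge_self[of "dot d u x"] abs_ge_minus_self[of "dot d u x"] by (simp add: halfspace_dot)
    then show "signal v w b R u x \<le> C * indicator (band w b) x"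
      using assms(1)[of x] assms(2) by (auto simp: signal_def indicator_def)
  qed (auto simp: less_top[symmetric])
  then show ?thesis by simp
qed

text \<open>Testing the gradient G against itself: by Cauchy-Schwarz in the ball, |G|^2 is at most
  |G|.\<close>

lemma gradient_norm_le:
  assumes p: "0 < prob (band w b)" and R: "0 < R"
  shows "dot d (gradient v w b R) (gradient v w b R) \<le> 1"
proof -
  define G where "G = gradient v w b R"
  define N where "N = sqrt (dot d G G)"
  have N: "0 \<le> N" "N\<^sup>2 = dot d G G" using dot_self_nonneg[of d G] by (auto simp: N_def)
  have "expectation (signal v w b R G) \<le> (N * R) * prob (band w b)"
  proof (rule expectation_signal_le)
    fix x assume "x \<in> ball R"
    then have "(dot d G x)\<^sup>2 \<le> dot d G G * R\<^sup>2"
      by (intro order.trans[OF dot_cauchy_schwarz] mult_left_mono dot_self_nonneg) (auto simp: ball_def)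
    then have "(dot d G x)\<^sup>2 \<le> (N * R)\<^sup>2" using N by (simp add: power_mult_distrib)
    then show "\<bar>dot d G x\<bar> \<le> N * R" using N R abs_le_square_iff[of "dot d G x" "N * R"] by simp
  qed (use N R in auto)
  then have "dot d G G \<le> N"
    unfolding dot_gradient[OF p R, of G v, folded G_def] using p R by (simp add: field_simps)
  then have "N * N \<le> 1 * N" using N by (simp add: power2_eq_square)
  then have "N \<le> 1" using N by (cases "N = 0") auto
  then have "N\<^sup>2 \<le> 1\<^sup>2" using N by (intro power_mono) auto
  then show ?thesis using N by (simp add: G_def)
qed

lemma gradient_band_le:
  assumes p: "0 < prob (band w b)" and R: "0 < R" and b: "0 \<le> b"
  shows "dot d w (gradient v w b R) \<le> b / R"
proof -
  have "expectation (signal v w b R w) \<le> b * prob (band w b)"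
    using b by (intro expectation_signal_le) (auto simp: band_def abs_le_square_iff[of _ b, simplified abs_of_nonneg[OF b]])
  then show ?thesis unfolding dot_gradient[OF p R] using p R by (simp add: field_simps)
qed

lemma band_scaled:
  assumes W: "0 < dot d w w" and b: "0 \<le> b"
  shows "band w b = {x \<in> space D. \<bar>dot d (\<lambda>i. 1 / sqrt (dot d w w) * w i) x\<bar> \<le> b / sqrt (dot d w w)}"
proof -
  have "(dot d w x)\<^sup>2 \<le> b\<^sup>2 \<longleftrightarrow> \<bar>dot d w x\<bar> \<le> b" for x using abs_le_square_iff[of "dot d w x" b] b by simp
  then show ?thesis using W unfolding dot_scale_left
    by (simp add: band_def abs_mult divide_le_cancel)
qed

lemma unit_scaled: "0 < dot d w w \<Longrightarrow> dot d (\<lambda>i. 1 / sqrt (dot d w w) * w i) (\<lambda>i. 1 / sqrt (dot d w w) * w i) = 1"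
  unfolding dot_scale_left dot_scale_right by simp

lemma band_prob_ge:
  assumes W: "0 < dot d w w" and b: "0 < b" "b / sqrt (dot d w w) \<le> 1 / 10 ^ 71"
  shows "2 * (b / sqrt (dot d w w)) / 10 ^ 89 \<le> prob (band w b)"
proof -
  let ?b = "b / sqrt (dot d w w)" and ?w = "\<lambda>i. 1 / sqrt (dot d w w) * w i"
  have "0 < ?b" using W b by simp
  then have "2 * ?b / 10 ^ 89 \<le> prob (strip ?w (space D) (- ?b) (- ?b + 2 * ?b))"
    using b by (intro slab_ge unit_scaled W) auto
  also have "\<dots> \<le> prob (band w b)"
    unfolding band_scaled[OF W less_imp_le[OF b(1)]] by (intro finite_measure_mono) (auto simp: strip_def)
  finally show ?thesis .
qed

text \<open>The label is the sign of \<open>\<alpha>\<langle>w,x\<rangle> + \<langle>u,x\<rangle>\<close>, and in a band that is thin compared with \<open>u\<close> the first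
  summand is negligible: the correlation of the label with \<open>\<langle>u,x\<rangle>\<close> is of the order of \<open>|u|\<close>.\<close>

lemma gradient_progress:
  assumes W: "0 < dot d w w" and uw: "dot d w u = 0" and u: "0 < dot d u u" and \<alpha>: "0 \<le> \<alpha>"
    and v: "\<And>x. dot d v x = \<alpha> * dot d w x + dot d u x"
    and b: "0 < b" "b / sqrt (dot d w w) \<le> 1 / 10 ^ 71"
    and R: "10 ^ 58 * real d \<le> R\<^sup>2" "0 < R"
  shows "(sqrt (dot d u u) / 10 ^ 172 - 2 * \<alpha> * b) / R \<le> dot d u (gradient v w b R)"
proof -
  define N where "N = sqrt (dot d u u)"
  have N: "0 < N" "N\<^sup>2 = dot d u u" using u by (auto simp: N_def)
  define c where "c = b / sqrt (dot d w w)"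
  have c: "0 < c" "c \<le> 1 / 10 ^ 71" using W b by (auto simp: c_def)
  define e where "e = (\<lambda>i. 1 / N * u i)"
  define wn where "wn = (\<lambda>i. 1 / sqrt (dot d w w) * w i)"
  have e1: "dot d e e = 1"
    unfolding e_def dot_scale_left dot_scale_right using N u by (simp add: power2_eq_square field_simps)
  have w1: "dot d wn wn = 1" unfolding wn_def by (rule unit_scaled[OF W])
  have we: "dot d wn e = 0" unfolding e_def wn_def dot_scale_left dot_scale_right using uw by simp
  have ue: "dot d u x = N * dot d e x" for x unfolding e_def dot_scale_left using N by simp
  let ?p = "prob (band w b)"
  have "2 * c / 10 ^ 89 \<le> ?p" using band_prob_ge[OF W b] by (simp add: c_def)
  moreover have "0 < 2 * c / 10 ^ 89" using c by simp
  ultimately have p: "0 < ?p" by linarith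
  have p_le: "?p \<le> 2 * 10 ^ 12 * c"
    unfolding band_scaled[OF W less_imp_le[OF b(1)]] c_def[symmetric] wn_def[symmetric] by (rule slab_le[OF w1 c(1)])
  define Q where "Q = band w b \<inter> ball R \<inter> {x \<in> space D. 1 / 10 ^ 71 \<le> \<bar>dot d e x\<bar>}"
  have Q[measurable]: "Q \<in> sets D" unfolding Q_def by measurable
  have "2 * c / 10 ^ 89 \<le> prob (strip wn {x \<in> ball R. 1 / 10 ^ 71 \<le> \<bar>dot d e x\<bar> \<and> \<bar>dot d e x\<bar> \<le> 10 ^ 30} (- c) (- c + 2 * c))"
    using c by (intro slab_off_axis_ge w1 e1 we ball_sets ball_midpoint_closed ball_complement_le R) auto
  also have "\<dots> \<le> prob Q"
    unfolding Q_def band_scaled[OF W less_imp_le[OF b(1)]] c_def[symmetric] wn_def[symmetric]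
    by (intro finite_measure_mono) (auto simp: strip_def ball_def)
  finally have Qp: "2 * c / 10 ^ 89 \<le> prob Q" .
  have "N / 10 ^ 71 * (2 * c / 10 ^ 89) - 2 * \<alpha> * b * ?p \<le> N / 10 ^ 71 * prob Q - 2 * \<alpha> * b * ?p"
    using N Qp by (intro diff_right_mono mult_left_mono) auto
  also have "\<dots> = expectation (\<lambda>x. N / 10 ^ 71 * indicator Q x - 2 * \<alpha> * b * indicator (band w b) x)"
    by (subst Bochner_Integration.integral_diff) (auto intro!: integrable_mult_right integrable_real_indicator simp: less_top[symmetric])
  also have "\<dots> \<le> expectation (signal v w b R u)"
  proof (intro integral_mono integrable_signal Bochner_Integration.integrable_diff integrable_mult_right integrable_real_indicator)
    fix x
    define a where "a = \<alpha> * dot d w x"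
    \<comment> \<open>The label differs from the sign of <u,x> only where |<u,x>| <= |a|, and there
      the loss is at most 2|<u,x>|.\<close>
    have sgn: "\<bar>dot d u x\<bar> - 2 * \<bar>a\<bar> \<le> halfspace d v x * dot d u x"
      using v[of x] by (auto simp: halfspace_dot a_def[symmetric])
    show "N / 10 ^ 71 * indicator Q x - 2 * \<alpha> * b * indicator (band w b) x \<le> signal v w b R u x"
    proof (cases "x \<in> band w b")
      case True
      then have "\<bar>dot d w x\<bar> \<le> b" using abs_le_square_iff[of "dot d w x" b] b by (simp add: band_def)
      then have a: "2 * \<bar>a\<bar> \<le> 2 * \<alpha> * b" using \<alpha> by (simp add: a_def abs_mult mult_left_mono)
      show ?thesis
      proof (cases "x \<in> ball R")
        case inb: True
        have "N / 10 ^ 71 * indicator Q x \<le> \<bar>dot d u x\<bar>"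
          using N mult_left_mono[of "1 / 10 ^ 71" "\<bar>dot d e x\<bar>" N] by (auto simp: Q_def indicator_def ue abs_mult)
        then show ?thesis using True inb sgn a by (simp add: signal_def)
      next
        case False
        then show ?thesis using \<alpha> b by (simp add: Q_def signal_def)
      qed
    qed (simp add: Q_def signal_def)
  qed (auto simp: less_top[symmetric])
  finally have E: "N / 10 ^ 71 * (2 * c / 10 ^ 89) - 2 * \<alpha> * b * ?p \<le> expectation (signal v w b R u)" .
  \<comment> \<open>The part \<open>Q\<close> with |<e,x>| >= 1/10^71 has mass at least 2c/10^89,
    the whole band at most 2 * 10^12 c. The ratio of masses times 1/10^71 is 1/10^172.\<close>
  have "N / 10 ^ 172 * ?p \<le> N / 10 ^ 172 * (2 * 10 ^ 12 * c)" using N p_le by (intro mult_left_mono) auto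
  also have "\<dots> = N / 10 ^ 71 * (2 * c / 10 ^ 89)" by simp
  finally have "(N / 10 ^ 172 - 2 * \<alpha> * b) * ?p \<le> expectation (signal v w b R u)"
    using E by (simp add: left_diff_distrib)
  then have "(N / 10 ^ 172 - 2 * \<alpha> * b) * ?p / (R * ?p) \<le> expectation (signal v w b R u) / (R * ?p)"
    using p R by (intro divide_right_mono) auto
  then show ?thesis unfolding dot_gradient[OF p R(2)] N_def using p by simp
qed

text \<open>With the whole space as band, the correlation with v is E|<v,x>| over the ball. The norm
  bound improves on \<open>gradient_norm_le\<close> by 1/R, because isotropy gives E|<G,x>| <= |G|,
  in the form |t| <= N/2 + t^2/(2N).\<close>

lemma initial_gradient:
  assumes v: "dot d v v = 1" and R: "10 ^ 58 * real d \<le> R\<^sup>2" "0 < R"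
  shows "9 / 10 ^ 6 / R \<le> dot d v (gradient v (\<lambda>_. 0) b R)"
    and "dot d (gradient v (\<lambda>_. 0) b R) (gradient v (\<lambda>_. 0) b R) \<le> 1 / R\<^sup>2"
proof -
  have band: "band (\<lambda>_. 0) b = space D" by (simp add: band_def dot_def)
  have p: "prob (band (\<lambda>_. 0) b) = 1" by (simp add: band prob_space)
  define G where "G = gradient v (\<lambda>_. 0) b R"
  have G: "dot d u G = expectation (signal v (\<lambda>_. 0) b R u) / R" for u
    unfolding G_def by (subst dot_gradient) (use p R in auto)
  let ?P = "{x \<in> space D. 1/2 < \<bar>dot d v x\<bar>}"
  have "1 / 50000 \<le> prob ?P" by (rule away_from_zero[OF v])
  also have "\<dots> \<le> prob ((?P \<inter> ball R) \<union> (space D - ball R))" by (intro finite_measure_mono) auto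
  also have "\<dots> \<le> prob (?P \<inter> ball R) + 1 / 10 ^ 58"
    by (intro order.trans[OF measure_Un_le] add_left_mono ball_complement_le R) auto
  finally have "9 / 10 ^ 6 \<le> 1/2 * prob (?P \<inter> ball R)" by simp
  also have "\<dots> = expectation (\<lambda>x. 1/2 * indicator (?P \<inter> ball R) x)" by simp
  also have "\<dots> \<le> expectation (signal v (\<lambda>_. 0) b R v)"
    by (intro integral_mono integrable_signal integrable_mult_right integrable_real_indicator)
      (auto simp: less_top[symmetric] signal_def band halfspace_dot indicator_def)
  finally show "9 / 10 ^ 6 / R \<le> dot d v (gradient v (\<lambda>_. 0) b R)"
    using R unfolding G_def[symmetric] G by (intro divide_right_mono) auto
  define N where "N = sqrt (dot d G G)"
  have N: "0 \<le> N" "N\<^sup>2 = dot d G G" using dot_self_nonneg[of d G] by (auto simp: N_def)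
  show "dot d (gradient v (\<lambda>_. 0) b R) (gradient v (\<lambda>_. 0) b R) \<le> 1 / R\<^sup>2"
  proof (cases "N = 0")
    case True
    then show ?thesis using N R by (simp add: G_def)
  next
    case False
    with N have N0: "0 < N" by simp
    have "expectation (signal v (\<lambda>_. 0) b R G) \<le> expectation (\<lambda>x. N / 2 + (dot d G x)\<^sup>2 / (2 * N))"
    proof (intro integral_mono integrable_signal Bochner_Integration.integrable_add)
      fix x
      have "0 \<le> (N - \<bar>dot d G x\<bar>)\<^sup>2" by simp
      then have "2 * N * \<bar>dot d G x\<bar> \<le> N\<^sup>2 + (dot d G x)\<^sup>2" by (simp add: power2_diff)
      then have "\<bar>dot d G x\<bar> \<le> N / 2 + (dot d G x)\<^sup>2 / (2 * N)" using N0 by (simp add: field_simps power2_eq_square)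
      moreover have "halfspace d v x * dot d G x \<le> \<bar>dot d G x\<bar>" using abs_ge_self[of "dot d G x"] abs_ge_minus_self[of "dot d G x"] by (simp add: halfspace_dot)
      ultimately show "signal v (\<lambda>_. 0) b R G x \<le> N / 2 + (dot d G x)\<^sup>2 / (2 * N)"
        using N0 by (auto simp: signal_def indicator_def)
    qed (use integrable_dot_square in auto)
    also have "\<dots> = N / 2 + dot d G G / (2 * N)"
      using integrable_dot_square by (simp add: expectation_dot_square prob_space)
    also have "\<dots> = N" using N0 unfolding N(2)[symmetric] by (simp add: power2_eq_square)
    finally have "N\<^sup>2 \<le> N / R" unfolding N(2) G using R by (intro divide_right_mono) auto
    then have "N \<le> 1 / R" using N0 R by (simp add: power2_eq_square field_simps)
    then have "N\<^sup>2 \<le> (1 / R)\<^sup>2" using N by (intro power_mono) auto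
    then show ?thesis using N by (simp add: G_def power_divide)
  qed
qed

end

section \<open>The gradient step\<close>

lemma dot_cong: "(\<And>i. i < d \<Longrightarrow> v i = v' i) \<Longrightarrow> (\<And>i. i < d \<Longrightarrow> x i = x' i) \<Longrightarrow> dot d v x = dot d v' x'"
  unfolding dot_def by (intro sum.cong) auto

lemma dot_le_norms:
  assumes "dot d v v \<le> a\<^sup>2" "dot d x x \<le> b\<^sup>2" "0 \<le> a" "0 \<le> b"
  shows "\<bar>dot d v x\<bar> \<le> a * b"
proof -
  have "(dot d v x)\<^sup>2 \<le> a\<^sup>2 * b\<^sup>2"
    using assms by (intro order.trans[OF dot_cauchy_schwarz] mult_mono dot_self_nonneg) auto
  then have "(dot d v x)\<^sup>2 \<le> (a * b)\<^sup>2" by (simp add: power_mult_distrib)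
  then show ?thesis using abs_le_square_iff[of "dot d v x" "a * b"] assms by simp
qed

text \<open>The last condition says that the sine of the angle between v and w is at most \<delta>.
  The bounds on <v,w> and |w|^2 contain slack linear in \<delta>: as \<delta> shrinks they relax,
  and this pays for the drift of each step, so lengths stay bounded over any number of
  rounds.\<close>

definition good_iterate :: "nat \<Rightarrow> (nat \<Rightarrow> real) \<Rightarrow> (nat \<Rightarrow> real) \<Rightarrow> real \<Rightarrow> bool" where
  "good_iterate d v w \<delta> \<longleftrightarrow> 0 < \<delta> \<and> \<delta> \<le> 1 \<and> 4 / 10 ^ 6 * (1 + \<delta>) \<le> dot d v w \<and> dot d w w \<le> 9 - 4 * \<delta> \<and>
     (1 - \<delta>\<^sup>2) * dot d w w \<le> (dot d v w)\<^sup>2"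

lemma good_iterate_cong:
  assumes "\<And>i. i < d \<Longrightarrow> w i = w' i"
  shows "good_iterate d v w \<delta> \<longleftrightarrow> good_iterate d v w' \<delta>"
proof -
  have "dot d v w = dot d v w'" "dot d w w = dot d w' w'" using assms by (auto intro!: dot_cong)
  then show ?thesis by (simp add: good_iterate_def)
qed

context isotropic_log_concave
begin

lemma noise_norm:
  assumes d: "0 < d" and n: "\<And>i. i < d \<Longrightarrow> \<bar>n i\<bar> \<le> 1 / (10 ^ 215 * (real d)\<^sup>2)"
  shows "dot d n n \<le> (1 / (10 ^ 215 * real d))\<^sup>2"
proof -
  have "dot d n n \<le> (\<Sum>i<d. (1 / (10 ^ 215 * (real d)\<^sup>2))\<^sup>2)"
    unfolding dot_def power2_eq_square[symmetric]
  proof (rule sum_mono)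
    fix i assume "i \<in> {..<d}"
    then show "(n i)\<^sup>2 \<le> (1 / (10 ^ 215 * (real d)\<^sup>2))\<^sup>2"
      using n[of i] abs_le_square_iff[of "n i" "1 / (10 ^ 215 * (real d)\<^sup>2)"] by simp
  qed
  also have "\<dots> = real d * (1 / (10 ^ 215 * (real d)\<^sup>2))\<^sup>2" by simp
  also have "\<dots> \<le> real d * real d * (1 / (10 ^ 215 * (real d)\<^sup>2))\<^sup>2"
    using d by (intro mult_right_mono) auto
  also have "\<dots> = (1 / (10 ^ 215 * real d))\<^sup>2" using d by (simp add: power2_eq_square field_simps)
  finally show ?thesis .
qed

text \<open>The true half-width of the band is its parameter divided by |w|. A lower bound on |w|
  makes it thin enough for \<open>slab_ge\<close>, the upper bound |w| <= 3 keeps its mass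
  proportional to \<delta>.\<close>

lemma good_iterate_band:
  assumes v: "dot d v v = 1" and good: "good_iterate d v w \<delta>"
  shows "0 < dot d w w" "\<delta> / 10 ^ 180 / sqrt (dot d w w) \<le> 1 / 10 ^ 71"
    and "\<delta> / 10 ^ 270 \<le> prob (band w (\<delta> / 10 ^ 180))"
proof -
  note g = good[unfolded good_iterate_def]
  have m: "4 / 10 ^ 6 \<le> dot d v w"
  proof -
    have "4 / 10 ^ 6 * 1 \<le> 4 / 10 ^ 6 * (1 + \<delta>)" using g by (intro mult_left_mono) auto
    then show ?thesis using g by linarith
  qed
  have "(dot d v w)\<^sup>2 \<le> dot d w w" using dot_cauchy_schwarz[of d v w] v by simp
  then have mw: "dot d v w \<le> sqrt (dot d w w)" by (rule real_le_rsqrt)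
  then have s: "4 / 10 ^ 6 \<le> sqrt (dot d w w)" using m by linarith
  then have "0 < sqrt (dot d w w)" by (rule less_le_trans[rotated]) simp
  then show W: "0 < dot d w w" by simp
  have s0: "0 < sqrt (dot d w w)" using W by simp
  have "\<delta> / 10 ^ 180 \<le> 1 / 10 ^ 71 * (4 / 10 ^ 6)" using g by simp
  also have "\<dots> \<le> 1 / 10 ^ 71 * sqrt (dot d w w)" using s by (intro mult_left_mono) auto
  finally show b: "\<delta> / 10 ^ 180 / sqrt (dot d w w) \<le> 1 / 10 ^ 71" using s0 by (simp only: pos_divide_le_eq)
  have "sqrt (dot d w w) \<le> 3" using g by (intro real_le_lsqrt) auto
  then have "\<delta> / 10 ^ 180 / 3 \<le> \<delta> / 10 ^ 180 / sqrt (dot d w w)"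
    using g s0 by (intro divide_left_mono) auto
  then have "2 * (\<delta> / 10 ^ 180 / 3) / 10 ^ 89 \<le> 2 * (\<delta> / 10 ^ 180 / sqrt (dot d w w)) / 10 ^ 89"
    by simp
  also have "\<dots> \<le> prob (band w (\<delta> / 10 ^ 180))" using g b by (intro band_prob_ge W) auto
  finally have "2 * (\<delta> / 10 ^ 180 / 3) / 10 ^ 89 \<le> prob (band w (\<delta> / 10 ^ 180))" .
  moreover have "\<delta> / 10 ^ 270 \<le> 2 * (\<delta> / 10 ^ 180 / 3) / 10 ^ 89" using g by simp
  ultimately show "\<delta> / 10 ^ 270 \<le> prob (band w (\<delta> / 10 ^ 180))" by linarith
qed

lemma radius_ok: "0 < d \<Longrightarrow> 10 ^ 58 * real d \<le> (10 ^ 29 * real d)\<^sup>2" "0 < d \<Longrightarrow> 0 < 10 ^ 29 * real d"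
proof -
  assume d: "0 < d"
  have "real d \<le> real d * real d" using d by simp
  then have "10 ^ 58 * real d \<le> 10 ^ 58 * (real d * real d)" by (rule mult_left_mono) simp
  also have "\<dots> = (10 ^ 29 * real d)\<^sup>2" by (simp only: power_mult_distrib power_mult[symmetric] power2_eq_square[of "real d"]) simp
  finally show "10 ^ 58 * real d \<le> (10 ^ 29 * real d)\<^sup>2" .
  show "0 < 10 ^ 29 * real d" using d by simp
qed

text \<open>For \<delta> = 1 the angle condition is void. Multiplying by the radius undoes the
  scaling of the query, leaving <v,w> at least 8/10^6 and |w|^2 at most 5, as the invariant asks at
  \<delta> = 1.\<close>

lemma good_iterate_initial:
  assumes v: "dot d v v = 1" and d: "0 < d"
    and g: "\<And>i. i < d \<Longrightarrow> \<bar>g i - gradient v (\<lambda>_. 0) b (10 ^ 29 * real d) i\<bar> \<le> 1 / (10 ^ 215 * (real d)\<^sup>2)"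
  shows "good_iterate d v (\<lambda>i. 10 ^ 29 * real d * g i) 1"
proof -
  define R where "R = 10 ^ 29 * real d"
  define G where "G = gradient v (\<lambda>_. 0) b R"
  define n where "n = (\<lambda>i. g i - G i)"
  define \<xi> where "\<xi> = 1 / (10 ^ 215 * real d)"
  have R: "0 < R" using d by (simp add: R_def)
  have nn: "dot d n n \<le> \<xi>\<^sup>2" unfolding \<xi>_def by (rule noise_norm[OF d]) (use g in \<open>simp add: n_def G_def R_def\<close>)
  have geq: "g = (\<lambda>i. G i + n i)" by (simp add: n_def)
  have G1: "9 / 10 ^ 6 / R \<le> dot d v G" and G2: "dot d G G \<le> (1 / R)\<^sup>2"
    using initial_gradient[OF v radius_ok[OF d], of b] by (simp_all add: G_def R_def power_divide)
  have \<xi>: "0 < \<xi>" "R * \<xi> = 1 / 10 ^ 186" using d by (simp_all add: \<xi>_def R_def)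
  have vn: "\<bar>dot d v n\<bar> \<le> 1 * \<xi>" using v nn \<xi> by (intro dot_le_norms) auto
  have Gn: "\<bar>dot d G n\<bar> \<le> 1 / R * \<xi>" using G2 nn \<xi> R by (intro dot_le_norms) auto
  have vw: "dot d v (\<lambda>i. R * g i) = R * dot d v G + R * dot d v n"
    unfolding dot_scale_right by (simp add: geq dot_add_right distrib_left)
  have "9 / 10 ^ 6 \<le> R * dot d v G" using mult_left_mono[OF G1, of R] R by simp
  moreover have "- (1 / 10 ^ 186) \<le> R * dot d v n"
    using mult_left_mono[of "- \<xi>" "dot d v n" R] vn R \<xi>(2) by simp
  ultimately have m: "8 / 10 ^ 6 \<le> dot d v (\<lambda>i. R * g i)" unfolding vw by simp
  have "dot d (\<lambda>i. R * g i) (\<lambda>i. R * g i) = R\<^sup>2 * (dot d G G + 2 * dot d G n + dot d n n)"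
    unfolding dot_scale_left dot_scale_right
    by (simp add: geq dot_add_right dot_add_left power2_eq_square dot_commute[of d n G])
  also have "\<dots> \<le> R\<^sup>2 * ((1 / R)\<^sup>2 + 2 * (1 / R * \<xi>) + \<xi>\<^sup>2)"
    using G2 Gn nn by (intro mult_left_mono add_mono) auto
  also have "\<dots> = (1 + R * \<xi>)\<^sup>2" using R by (simp add: power2_eq_square field_simps)
  also have "\<dots> \<le> 5" unfolding \<xi>(2) by (simp add: power2_eq_square)
  finally have W: "dot d (\<lambda>i. R * g i) (\<lambda>i. R * g i) \<le> 5" .
  show ?thesis using m W unfolding good_iterate_def R_def by simp
qed

text \<open>A step along the gradient reduces |v - \<alpha>w|^2: the first-order gain
  \<alpha>\<eta><u,g> beats the quadratic term because \<eta> is small. All changes are measured in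
  multiples of one quantity, so that each clause of the invariant becomes a comparison of
  constants.\<close>

lemma good_iterate_step:
  assumes v: "dot d v v = 1" and d: "0 < d" and good: "good_iterate d v w \<delta>"
    and g: "\<And>i. i < d \<Longrightarrow> \<bar>g i - gradient v w (\<delta> / 10 ^ 180) (10 ^ 29 * real d) i\<bar> \<le> 1 / (10 ^ 215 * (real d)\<^sup>2)"
  shows "good_iterate d v (\<lambda>i. w i + \<delta> / (10 ^ 209 * real d) * g i) ((1 - 5 / (10 ^ 418 * (real d)\<^sup>2)) * \<delta>)"
proof -
  define R where "R = 10 ^ 29 * real d"
  define b where "b = \<delta> / 10 ^ 180"
  define G where "G = gradient v w b R"
  define n where "n = (\<lambda>i. g i - G i)"
  define B :: real where "B = 1 / 10 ^ 209"
  define A where "A = B * B"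
  define \<xi> where "\<xi> = 1 / (10 ^ 215 * real d)"
  define X where "X = \<delta> / real d"
  \<comment> \<open>This equals b/R, the bound on <w,G>; up to noise, the growth 2\<eta><w,G> of
    |w|^2 is then of the same order \<eta>^2 as the quadratic term.\<close>
  define \<eta> where "\<eta> = B * X"
  define W where "W = dot d w w"
  define m where "m = dot d v w"
  define \<alpha> where "\<alpha> = dot d v w / dot d w w"
  define u where "u = (\<lambda>i. v i - \<alpha> * w i)"
  define w' where "w' = (\<lambda>i. w i + \<eta> * g i)"
  define \<delta>' where "\<delta>' = \<delta> - 5 * A * (X / real d)"
  note gi = good[unfolded good_iterate_def, folded W_def m_def]
  have \<delta>: "0 < \<delta>" "\<delta> \<le> 1" using gi by auto
  have d1: "1 \<le> real d" using d by simp
  have B: "0 < B" "B \<le> 1 / 10 ^ 9" by (simp_all add: B_def)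
  have A: "0 < A" "A \<le> 1 / 1000"
  proof -
    show "0 < A" using B by (simp add: A_def)
    have "B * B \<le> (1 / 10 ^ 9) * (1 / 10 ^ 9)" using B by (intro mult_mono) auto
    then show "A \<le> 1 / 1000" by (simp add: A_def)
  qed
  have "(10::real) ^ 418 = 10 ^ 209 * 10 ^ 209" by (simp only: power_add[symmetric]) (rule arg_cong[where f = "power 10"], simp)
  then have A_eq: "A = 1 / 10 ^ 418" by (simp only: A_def B_def times_divide_times_eq mult_1)
  have "(10::real) ^ 215 = 10 ^ 6 * 10 ^ 209" by (simp only: power_add[symmetric]) (rule arg_cong[where f = "power 10"], simp)
  then have \<xi>_eq: "\<xi> = B / 10 ^ 6 / real d" by (simp only: \<xi>_def B_def divide_divide_eq_left mult_ac)
  have "(10::real) ^ 209 = 10 ^ 180 * 10 ^ 29" by (simp only: power_add[symmetric]) (rule arg_cong[where f = "power 10"], simp)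
  then have bR: "b / R = B * X" by (simp only: b_def R_def B_def X_def times_divide_times_eq divide_divide_eq_left mult_1 mult_ac)
  have R: "0 < R" using d by (simp add: R_def)
  have b: "0 < b" using \<delta> by (simp add: b_def)
  have X: "0 < X" "X \<le> \<delta>" using \<delta> d1 by (simp_all add: X_def divide_le_eq)
  have \<eta>: "0 < \<eta>" using X B by (simp add: \<eta>_def)
  have W: "0 < W" and bW: "b / sqrt (dot d w w) \<le> 1 / 10 ^ 71" and p: "0 < prob (band w b)"
    using good_iterate_band[OF v good] \<delta> by (auto simp: W_def b_def intro: less_le_trans[of 0 "\<delta> / 10 ^ 270"])
  have W9: "W \<le> 9" using gi by auto
  have m0: "4 / 10 ^ 6 * (1 + \<delta>) \<le> m" using gi by auto
  have m1: "4 / 10 ^ 6 \<le> m" using m0 \<delta> by (simp add: distrib_left)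
  have mW: "m\<^sup>2 \<le> W" using dot_cauchy_schwarz[of d v w] v by (simp add: m_def W_def)
  have \<alpha>: "0 < \<alpha>" using m1 W by (simp add: \<alpha>_def W_def[symmetric] m_def[symmetric])
  have \<alpha>_lo: "4 / 10 ^ 7 \<le> \<alpha>"
  proof -
    have "4 / 10 ^ 7 * W \<le> m" using m1 W9 W by simp
    then show ?thesis using W by (simp add: \<alpha>_def W_def[symmetric] m_def[symmetric] pos_le_divide_eq)
  qed
  \<comment> \<open>Since m^2 <= W, \<alpha> = m/W is at most 1/m.\<close>
  have \<alpha>_hi: "\<alpha> \<le> 250000"
  proof -
    have "m * (4 / 10 ^ 6) \<le> m * m" using m1 by (intro mult_left_mono) auto
    then have "m \<le> 250000 * W" using mW by (simp add: power2_eq_square)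
    then show ?thesis using W by (simp add: \<alpha>_def W_def[symmetric] m_def[symmetric] pos_divide_le_eq)
  qed
  note dec = orthogonal_decomposition[OF W[unfolded W_def] v \<alpha>_def, folded u_def]
  have uu: "dot d u u \<le> \<delta>\<^sup>2"
  proof -
    have "1 - \<delta>\<^sup>2 \<le> m\<^sup>2 / W" using gi W by (simp add: pos_le_divide_eq)
    then show ?thesis using dec(2) by (simp add: m_def W_def)
  qed
  have \<xi>: "0 < \<xi>" "\<xi> \<le> 1" using d1 by (simp_all add: \<xi>_def divide_le_eq)
  have nn: "dot d n n \<le> \<xi>\<^sup>2"
    unfolding \<xi>_def by (rule noise_norm[OF d]) (use g in \<open>simp add: n_def G_def R_def b_def\<close>)
  have geq: "g = (\<lambda>i. G i + n i)" by (simp add: n_def)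
  have G1: "dot d G G \<le> 1\<^sup>2" using gradient_norm_le[OF p R] by (simp add: G_def)
  have gg: "dot d g g \<le> 2\<^sup>2"
  proof -
    have "\<bar>dot d G n\<bar> \<le> 1 * \<xi>" using G1 nn \<xi> by (intro dot_le_norms) auto
    moreover have "\<xi>\<^sup>2 \<le> 1\<^sup>2" using \<xi> by (intro power_mono) auto
    moreover have "dot d g g = dot d G G + 2 * dot d G n + dot d n n"
      by (simp add: geq dot_add_left dot_add_right dot_commute[of d n G])
    ultimately show ?thesis using G1 nn \<xi> by simp
  qed
  have vg: "- \<xi> \<le> dot d v g"
  proof -
    have "\<bar>dot d v n\<bar> \<le> 1 * \<xi>" using v nn \<xi> by (intro dot_le_norms) auto
    moreover have "0 \<le> dot d v G" unfolding G_def by (rule gradient_target_nonneg[OF p R])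
    ultimately show ?thesis by (simp add: geq dot_add_right)
  qed
  have wg: "dot d w g \<le> b / R + 3 * \<xi>"
  proof -
    have "\<bar>dot d w n\<bar> \<le> 3 * \<xi>" using W9 nn \<xi> by (intro dot_le_norms) (auto simp: W_def)
    moreover have "dot d w G \<le> b / R" unfolding G_def using b by (intro gradient_band_le p R) auto
    ultimately show ?thesis by (simp add: geq dot_add_right)
  qed
  have Xd: "0 \<le> X / real d" using X by simp
  have XX: "X * X \<le> X / real d"
  proof -
    have "X * \<delta> / real d \<le> X * 1 / real d" using X \<delta> by (intro divide_right_mono mult_left_mono) auto
    then show ?thesis by (simp add: X_def)
  qed
  \<comment> \<open>The unit of change: \<delta> drops by 5Y, while <v,w> loses at most Y/10^6 and
    |w|^2 gains less than 7Y. The slack released in the invariant is larger, namely 20Y/10^6 and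
    20Y.\<close>
  define Y where "Y = A * (X / real d)"
  have Y: "0 \<le> Y" "A * (X * X) \<le> Y" using A Xd mult_left_mono[OF XX, of A] mult_nonneg_nonneg[of A "X / real d"] by (simp_all add: Y_def)
  have \<eta>\<xi>: "\<eta> * \<xi> = A / 10 ^ 6 * (X / real d)" by (simp add: \<eta>_def \<xi>_eq A_def)
  have \<eta>b: "\<eta> * (b / R) = A * (X * X)"
    by (simp add: \<eta>_def bR A_def)
  have \<eta>\<eta>: "\<eta>\<^sup>2 = A * (X * X)" by (simp add: \<eta>_def A_def power2_eq_square)
  have m': "4 / 10 ^ 6 * (1 + \<delta>') \<le> dot d v w'"
  proof -
    have "dot d v w' = m + \<eta> * dot d v g" unfolding w'_def dot_add_right dot_scale_right by (simp add: m_def)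
    moreover have "- (\<eta> * \<xi>) \<le> \<eta> * dot d v g" using mult_left_mono[OF vg, of \<eta>] \<eta> by simp
    moreover have "\<eta> * \<xi> = Y / 10 ^ 6" "\<delta>' = \<delta> - 5 * Y" by (simp_all add: \<eta>\<xi> Y_def \<delta>'_def)
    ultimately show ?thesis using m0 Y by (simp add: distrib_left right_diff_distrib)
  qed
  have w'w': "dot d w' w' = W + 2 * (\<eta> * dot d w g) + \<eta>\<^sup>2 * dot d g g"
    unfolding w'_def dot_add_right dot_add_left dot_scale_right dot_scale_left
    by (simp add: W_def dot_commute[of d g w] power2_eq_square)
  have W': "dot d w' w' \<le> 9 - 4 * \<delta>'"
  proof -
    have "\<eta> * dot d w g \<le> \<eta> * (b / R + 3 * \<xi>)" using wg \<eta> by (intro mult_left_mono) auto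
    also have "\<dots> = \<eta> * (b / R) + 3 * (\<eta> * \<xi>)" by (simp only: distrib_left mult.left_commute)
    also have "\<dots> \<le> Y + 3 * (Y / 10 ^ 6)"
    proof (intro add_mono mult_left_mono)
      show "\<eta> * (b / R) \<le> Y" unfolding \<eta>b by (rule Y(2))
    qed (simp_all add: \<eta>\<xi> Y_def)
    finally have 1: "\<eta> * dot d w g \<le> Y + 3 * (Y / 10 ^ 6)" .
    have "\<eta>\<^sup>2 * dot d g g \<le> \<eta>\<^sup>2 * 2\<^sup>2" using gg by (intro mult_left_mono) auto
    then have 2: "\<eta>\<^sup>2 * dot d g g \<le> 4 * Y" using Y(2) unfolding \<eta>\<eta> by simp
    have "W \<le> 9 - 4 * \<delta>" using gi by auto
    moreover have "\<delta>' = \<delta> - 5 * Y" by (simp add: Y_def \<delta>'_def)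
    ultimately show ?thesis using 1 2 Y unfolding w'w' by simp
  qed
  \<comment> \<open>The old multiplier \<alpha> is kept. For every multiplier the squared length of
    v - \<alpha>w' is at least the squared sine of the new angle, so bounding it suffices.\<close>
  define u' where "u' = (\<lambda>i. v i - \<alpha> * w' i)"
  have u'u': "dot d u' u' = dot d u u - 2 * (\<alpha> * \<eta> * dot d u g) + \<alpha>\<^sup>2 * \<eta>\<^sup>2 * dot d g g"
  proof -
    have "u' = (\<lambda>i. u i - (\<alpha> * \<eta>) * g i)" by (simp add: u'_def u_def w'_def algebra_simps fun_eq_iff)
    then show ?thesis
      by (simp only: dot_diff_left dot_diff_right dot_scale_left dot_scale_right)
        (simp add: dot_commute[of d g u] power2_eq_square algebra_simps)
  qed
  have ag: "\<alpha>\<^sup>2 * \<eta>\<^sup>2 * dot d g g \<le> \<alpha>\<^sup>2 * \<eta>\<^sup>2 * 2\<^sup>2" using gg by (intro mult_left_mono) auto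
  have key: "dot d u' u' \<le> \<delta>\<^sup>2 - 10 * A * X\<^sup>2"
  proof (cases "\<delta> / 2 \<le> sqrt (dot d u u)")
    case True
    define N where "N = sqrt (dot d u u)"
    have N: "\<delta> / 2 \<le> N" "N \<le> \<delta>" using True uu \<delta> by (auto simp: N_def intro: real_le_lsqrt)
    have u0: "0 < dot d u u"
    proof -
      have "0 < sqrt (dot d u u)" using True \<delta> by linarith
      then show ?thesis by simp
    qed
    have "\<bar>dot d u n\<bar> \<le> \<delta> * \<xi>" using uu nn \<delta> \<xi> by (intro dot_le_norms) auto
    moreover have "(N / 10 ^ 172 - 2 * \<alpha> * b) / R \<le> dot d u G"
      unfolding N_def G_def R_def
      by (rule gradient_progress[OF W[unfolded W_def] dec(1) u0 less_imp_le[OF \<alpha>] dec(3) b bW radius_ok[OF d]])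
    moreover have "((\<delta> / 2) / 10 ^ 172 - 2 * 250000 * b) / R \<le> (N / 10 ^ 172 - 2 * \<alpha> * b) / R"
      using N \<alpha>_hi b R by (intro divide_right_mono diff_mono mult_right_mono) auto
    \<comment> \<open>The band parameter \<delta>/10^180 makes the error 2\<alpha>b at most one
      hundredth of the signal, and the query tolerance puts the noise far below both.\<close>
    moreover have "((\<delta> / 2) / 10 ^ 172 - 2 * 250000 * b) / R = (10 ^ 8 / 2 - 500000) * (B * X)"
    proof -
      have "(10::real) ^ 209 = 10 ^ 8 * (10 ^ 172 * 10 ^ 29)" by (simp only: power_add[symmetric]) (rule arg_cong[where f = "power 10"], simp)
      then have "\<delta> / 10 ^ 172 / R = 10 ^ 8 * (B * X)"
        by (simp only: R_def B_def X_def times_divide_times_eq divide_divide_eq_left mult_1 mult_ac) simp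
      then have "\<delta> / 10 ^ 172 / R / 2 - 500000 * (b / R) = (10 ^ 8 / 2 - 500000) * (B * X)"
        unfolding bR by simp
      then show ?thesis by (simp add: diff_divide_distrib)
    qed
    moreover have "\<delta> * \<xi> = B * X / 10 ^ 6" by (simp add: \<xi>_eq X_def mult_ac)
    ultimately have ug: "4 * 10 ^ 7 * (B * X) \<le> dot d u g" using X B by (simp add: geq dot_add_right)
    have up: "\<alpha> * \<eta> * (4 * 10 ^ 7 * (B * X)) \<le> \<alpha> * \<eta> * dot d u g" using ug \<alpha> \<eta> by (intro mult_left_mono) auto
    have "\<alpha> * \<eta> * (4 * 10 ^ 7 * (B * X)) = 4 * 10 ^ 7 * (A * (\<alpha> * X\<^sup>2))"
      by (simp add: \<eta>_def A_def power2_eq_square)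
    with up have gain: "4 * 10 ^ 7 * (A * (\<alpha> * X\<^sup>2)) \<le> \<alpha> * \<eta> * dot d u g" by (simp only:)
    have quad: "\<alpha>\<^sup>2 * \<eta>\<^sup>2 * 2\<^sup>2 \<le> 10 ^ 6 * (A * (\<alpha> * X\<^sup>2))"
    proof -
      have "\<alpha> * (A * (\<alpha> * X\<^sup>2)) \<le> 250000 * (A * (\<alpha> * X\<^sup>2))" using \<alpha>_hi \<alpha> A by (intro mult_right_mono) auto
      then show ?thesis unfolding \<eta>\<eta> by (simp add: power2_eq_square mult_ac)
    qed
    have "A * (4 / 10 ^ 7 * X\<^sup>2) \<le> A * (\<alpha> * X\<^sup>2)"
      using \<alpha>_lo A by (intro mult_left_mono mult_right_mono) auto
    then have low: "4 / 10 ^ 7 * (A * X\<^sup>2) \<le> A * (\<alpha> * X\<^sup>2)" by simp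
    have nonneg: "0 \<le> A * X\<^sup>2" using A by simp
    have arith: "U - 2 * P + F \<le> S - 10 * Q"
      if "4 * 10 ^ 7 * Z \<le> P" "E \<le> 10 ^ 6 * Z" "4 / 10 ^ 7 * Q \<le> Z" "0 \<le> Q" "U \<le> S" "F \<le> E"
      for U P F S Q Z E :: real
      using that by simp
    have "dot d u u - 2 * (\<alpha> * \<eta> * dot d u g) + \<alpha>\<^sup>2 * \<eta>\<^sup>2 * dot d g g \<le> \<delta>\<^sup>2 - 10 * (A * X\<^sup>2)"
      by (rule arith[OF gain quad low nonneg uu ag])
    then show ?thesis unfolding u'u' by simp
  next
    case False
    then have "sqrt (dot d u u) \<le> \<delta> / 2" by simp
    then have u2: "dot d u u \<le> (\<delta> / 2)\<^sup>2" by (rule sqrt_le_D)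
    have "\<bar>dot d u g\<bar> \<le> \<delta> / 2 * 2" using u2 gg \<delta> by (intro dot_le_norms) auto
    then have "- (\<alpha> * \<eta> * dot d u g) \<le> \<alpha> * \<eta> * \<delta>"
      using mult_left_mono[of "- dot d u g" \<delta> "\<alpha> * \<eta>"] \<alpha> \<eta> by simp
    also have "\<dots> \<le> 250000 * (B * \<delta>) * \<delta>"
      using \<alpha>_hi X \<alpha> \<delta> B by (intro mult_right_mono mult_mono) (auto simp: \<eta>_def)
    also have "\<dots> \<le> 250000 * (1 / 10 ^ 9 * \<delta>) * \<delta>"
      using B \<delta> by (intro mult_right_mono mult_left_mono) auto
    also have "\<dots> = 1 / 4000 * \<delta>\<^sup>2" by (simp add: power2_eq_square)
    also have "\<dots> \<le> 1 / 100 * \<delta>\<^sup>2" by (intro mult_right_mono) auto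
    finally have 1: "- (\<alpha> * \<eta> * dot d u g) \<le> 1 / 100 * \<delta>\<^sup>2" .
    have "\<alpha> * \<eta> \<le> 250000 * (1 / 10 ^ 9 * \<delta>)"
      using \<alpha>_hi X \<alpha> \<delta> B unfolding \<eta>_def by (intro mult_mono) auto
    then have "\<alpha> * \<eta> \<le> \<delta> / 1000" using \<delta> by simp
    then have "(\<alpha> * \<eta>)\<^sup>2 \<le> (\<delta> / 1000)\<^sup>2" using \<alpha> \<eta> by (intro power_mono) auto
    then have "4 * (\<alpha>\<^sup>2 * \<eta>\<^sup>2) \<le> 4 / 1000000 * \<delta>\<^sup>2" by (simp add: power_mult_distrib power_divide)
    also have "\<dots> \<le> 1 / 100 * \<delta>\<^sup>2" by (intro mult_right_mono) auto
    finally have 2: "\<alpha>\<^sup>2 * \<eta>\<^sup>2 * 2\<^sup>2 \<le> 1 / 100 * \<delta>\<^sup>2" by (simp add: mult.commute)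
    have "X\<^sup>2 \<le> \<delta>\<^sup>2" using X by (intro power_mono) auto
    then have 3: "10 * A * X\<^sup>2 \<le> 10 * (1 / 1000) * \<delta>\<^sup>2" using A by (intro mult_mono) auto
    have u4: "dot d u u \<le> 1 / 4 * \<delta>\<^sup>2" using u2 by (simp add: power_divide)
    have arith: "U - 2 * P + F \<le> S - Q"
      if "- P \<le> 1 / 100 * S" "E \<le> 1 / 100 * S" "Q \<le> 10 * (1 / 1000) * S" "U \<le> 1 / 4 * S" "F \<le> E" "0 \<le> S"
      for U P F S Q E :: real
      using that by simp
    show ?thesis unfolding u'u' by (rule arith[OF 1 2 3 u4 ag zero_le_power2])
  qed
  \<comment> \<open>Dropping the square of the decrement leaves \<delta>^2 - 10A\<delta>X/d, and
    \<delta>/d is X.\<close>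
  have \<delta>'2: "\<delta>\<^sup>2 - 10 * A * X\<^sup>2 \<le> \<delta>'\<^sup>2"
  proof -
    have eq: "\<delta> * (X / real d) = X\<^sup>2" by (simp add: X_def power2_eq_square)
    have "\<delta>'\<^sup>2 = \<delta>\<^sup>2 - 10 * A * (\<delta> * (X / real d)) + (5 * A * (X / real d))\<^sup>2"
      unfolding \<delta>'_def power2_diff by (simp add: mult_ac)
    then show ?thesis unfolding eq by simp
  qed
  have angle: "(1 - \<delta>'\<^sup>2) * dot d w' w' \<le> (dot d v w')\<^sup>2"
  proof -
    define V where "V = dot d w' w'"
    define k where "k = dot d v w'"
    have "dot d u' u' = 1 - 2 * (\<alpha> * k) + \<alpha>\<^sup>2 * V"
      unfolding u'_def
      by (simp only: dot_diff_left dot_diff_right dot_scale_left dot_scale_right)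
        (simp add: dot_commute[of d w' v] power2_eq_square algebra_simps v V_def k_def)
    then have le: "1 - 2 * (\<alpha> * k) + \<alpha>\<^sup>2 * V \<le> \<delta>'\<^sup>2" using key \<delta>'2 by linarith
    have V: "0 \<le> V" unfolding V_def by (rule dot_self_nonneg)
    have "V * (1 - 2 * (\<alpha> * k) + \<alpha>\<^sup>2 * V) = (\<alpha> * V - k)\<^sup>2 + V - k\<^sup>2"
      by (simp add: power2_eq_square algebra_simps)
    then have "V - k\<^sup>2 \<le> V * (1 - 2 * (\<alpha> * k) + \<alpha>\<^sup>2 * V)" by simp
    also have "\<dots> \<le> V * \<delta>'\<^sup>2" using le V by (rule mult_left_mono)
    finally show ?thesis by (simp add: V_def k_def algebra_simps)
  qed
  have "0 < \<delta>'" "\<delta>' \<le> 1"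
  proof -
    have "X / real d \<le> X / 1" using X d1 by (intro divide_left_mono) auto
    then have "A * (X / real d) \<le> 1 / 1000 * \<delta>" using A X Xd by (intro mult_mono) auto
    then have Y1: "Y \<le> 1 / 1000 * \<delta>" by (simp only: Y_def)
    have \<delta>'_eq: "\<delta>' = \<delta> - 5 * Y" by (simp add: Y_def \<delta>'_def)
    show "0 < \<delta>'" unfolding \<delta>'_eq using Y1 \<delta>(1) by linarith
    show "\<delta>' \<le> 1" unfolding \<delta>'_eq using Y(1) \<delta>(2) by linarith
  qed
  then have "good_iterate d v w' \<delta>'" unfolding good_iterate_def using m' W' angle by simp
  moreover have "\<delta>' = (1 - 5 / (10 ^ 418 * (real d)\<^sup>2)) * \<delta>"
  proof -
    have "5 / (10 ^ 418 * (real d)\<^sup>2) = 5 * A / (real d)\<^sup>2"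
      by (simp only: A_eq times_divide_eq_right mult_1_right divide_divide_eq_left)
    then show ?thesis by (simp only:) (simp add: \<delta>'_def X_def left_diff_distrib power2_eq_square)
  qed
  moreover have "w' = (\<lambda>i. w i + \<delta> / (10 ^ 209 * real d) * g i)"
  proof -
    have "\<delta> / (10 ^ 209 * real d) = B * X" by (simp only: B_def X_def times_divide_times_eq mult_1)
    then show ?thesis by (simp only: w'_def \<eta>_def)
  qed
  ultimately show ?thesis by (simp only:)
qed

end

section \<open>Programs with bounded running time\<close>

text \<open>A total-correctness assertion with a step bound. Requiring a successor rules out stuck
  configurations, in particular inadmissible queries; quantifying over all successors covers every
  valid response.\<close>

primrec all_runs :: "('q \<Rightarrow> state \<Rightarrow> state \<Rightarrow> bool) \<Rightarrow> nat \<Rightarrow> 'q com \<Rightarrow> state \<Rightarrow> (state \<Rightarrow> bool) \<Rightarrow> bool" where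
  "all_runs ans 0 c s Q \<longleftrightarrow> c = Skip \<and> Q s"
| "all_runs ans (Suc N) c s Q \<longleftrightarrow> c = Skip \<and> Q s \<or>
     (\<exists>k. step ans (c, s) k) \<and> (\<forall>c' s'. step ans (c, s) (c', s') \<longrightarrow> all_runs ans N c' s' Q)"

inductive_cases step_SkipE: "step ans (Skip, s) k"
inductive_cases step_NAssignE: "step ans (NAssign v e, s) k"
inductive_cases step_RAssignE: "step ans (RAssign a e r, s) k"
inductive_cases step_SeqE: "step ans (Seq c1 c2, s) k"
inductive_cases step_IfE: "step ans (If b c1 c2, s) k"
inductive_cases step_WhileE: "step ans (While b c, s) k"
inductive_cases step_AskE: "step ans (Ask q, s) k"

lemma all_runs_sound:
  assumes "all_runs ans N c s Q" "(step ans ^^ n) (c, s) (c', s')"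
  shows "n \<le> N \<and> ((\<nexists>k. step ans (c', s') k) \<longrightarrow> c' = Skip \<and> Q s')"
  using assms
proof (induction N arbitrary: n c s)
  case 0
  show ?case
  proof (cases n)
    case 0
    then show ?thesis using \<open>all_runs ans 0 c s Q\<close> \<open>(step ans ^^ n) (c, s) (c', s')\<close> by auto
  next
    case (Suc m)
    then obtain y where "step ans (c, s) y" using 0 by (metis relpowp_Suc_E2)
    then show ?thesis using 0 by (auto elim: step_SkipE)
  qed
next
  case (Suc N)
  show ?case
  proof (cases n)
    case 0
    then show ?thesis using Suc.prems by auto
  next
    case (Suc m)
    then obtain c1 s1 where st: "step ans (c, s) (c1, s1)" "(step ans ^^ m) (c1, s1) (c', s')"
      using Suc.prems(2) by (metis relpowp_Suc_E2 surj_pair)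
    then have "all_runs ans N c1 s1 Q" using Suc.prems(1) by (auto elim: step_SkipE)
    from Suc.IH[OF this st(2)] show ?thesis using Suc by auto
  qed
qed

lemma all_runs_complete:
  assumes "all_runs ans N c s Q"
  shows "\<exists>n s'. n \<le> N \<and> (step ans ^^ n) (c, s) (Skip, s') \<and> Q s'"
  using assms
proof (induction N arbitrary: c s)
  case 0
  then show ?case by (intro exI[of _ 0]) auto
next
  case (Suc N)
  show ?case
  proof (cases "c = Skip \<and> Q s")
    case True
    then show ?thesis by (intro exI[of _ 0]) auto
  next
    case False
    then obtain c1 s1 where st: "step ans (c, s) (c1, s1)" "all_runs ans N c1 s1 Q"
      using Suc.prems by (metis all_runs.simps(2) surj_pair)
    from Suc.IH[OF st(2)] obtain n s' where n: "n \<le> N" "(step ans ^^ n) (c1, s1) (Skip, s')" "Q s'" by blast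
    have "(step ans ^^ Suc n) (c, s) (Skip, s')" using st(1) n(2) by (rule relpowp_Suc_I2)
    then show ?thesis using n by (intro exI[of _ "Suc n"]) auto
  qed
qed

lemma all_runs_mono:
  "all_runs ans N c s Q \<Longrightarrow> N \<le> M \<Longrightarrow> (\<And>s. Q s \<Longrightarrow> Q' s) \<Longrightarrow> all_runs ans M c s Q'"
proof (induction N arbitrary: M c s)
  case 0
  then show ?case by (cases M) auto
next
  case (Suc N)
  then obtain M' where M: "M = Suc M'" "N \<le> M'" by (cases M) auto
  show ?case using Suc.prems(1) Suc.IH[OF _ M(2) Suc.prems(3)] Suc.prems(3) unfolding M(1) by auto
qed

lemma all_runs_NAssign: "Q (s\<lparr>nreg := (nreg s)(v := nval e s)\<rparr>) \<Longrightarrow> all_runs ans 1 (NAssign v e) s Q"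
  by (auto elim: step_NAssignE intro: step_NAssign)

lemma all_runs_RAssign: "Q (store a (nval e s) (rval r s) s) \<Longrightarrow> all_runs ans 1 (RAssign a e r) s Q"
  by (auto elim: step_RAssignE intro: step_RAssign)

lemma all_runs_Ask:
  "(\<exists>s'. ans q s s') \<Longrightarrow> (\<And>s'. ans q s s' \<Longrightarrow> Q s') \<Longrightarrow> all_runs ans 1 (Ask q) s Q"
  by (auto elim!: step_AskE intro: step_Ask)

lemma all_runs_Seq:
  assumes "all_runs ans N c1 s (\<lambda>s'. all_runs ans M c2 s' Q)"
  shows "all_runs ans (N + M + 1) (Seq c1 c2) s Q"
  using assms
proof (induction N arbitrary: c1 s)
  case 0
  then show ?case by (auto elim!: step_SeqE step_SkipE intro: step_Seq_Skip)
next
  case (Suc N)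
  show ?case
  proof (cases "c1 = Skip")
    case True
    then have "all_runs ans M c2 s Q" using Suc.prems by (auto elim: step_SkipE)
    then have "all_runs ans (Suc N + M) c2 s Q" by (rule all_runs_mono) auto
    then show ?thesis using True by (auto elim!: step_SeqE elim: step_SkipE intro: step_Seq_Skip)
  next
    case False
    then obtain k where k: "step ans (c1, s) k" using Suc.prems by auto
    then have "\<exists>k. step ans (Seq c1 c2, s) k" by (cases k) (auto intro: step_Seq)
    moreover have "all_runs ans (N + M + 1) c' s' Q" if st: "step ans (Seq c1 c2, s) (c', s')" for c' s'
    proof -
      obtain c1' where c1': "c' = Seq c1' c2" "step ans (c1, s) (c1', s')"
        by (rule step_SeqE[OF st]) (use False in auto)
      then have "all_runs ans N c1' s' (\<lambda>s'. all_runs ans M c2 s' Q)" using Suc.prems False by auto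
      then show ?thesis unfolding c1' by (rule Suc.IH)
    qed
    ultimately show ?thesis by simp
  qed
qed

lemma all_runs_If:
  assumes "bval b s \<Longrightarrow> all_runs ans N c1 s Q" "\<not> bval b s \<Longrightarrow> all_runs ans N c2 s Q"
  shows "all_runs ans (Suc N) (If b c1 c2) s Q"
proof -
  have "\<exists>k. step ans (If b c1 c2, s) k" using step_If_True step_If_False by (cases "bval b s") blast+
  then show ?thesis using assms by (auto elim!: step_IfE)
qed

text \<open>The invariant carries the number of completed rounds. A round costs N plus 3 steps for
  unfolding, branching and sequencing; leaving the loop costs 2.\<close>

lemma all_runs_While:
  assumes body: "\<And>j s. I j s \<Longrightarrow> bval b s \<Longrightarrow> j < K \<and> all_runs ans N c s (I (Suc j))"
    and exit: "\<And>j s. I j s \<Longrightarrow> \<not> bval b s \<Longrightarrow> Q s" and init: "I 0 s"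
  shows "all_runs ans (K * (N + 3) + 2) (While b c) s Q"
proof -
  have unfold: "all_runs ans (Suc M) (While b c) s Q"
    if "all_runs ans M (If b (Seq c (While b c)) Skip) s Q" for M s
    using that by (auto elim!: step_WhileE intro: step_While)
  have "I j s \<Longrightarrow> m = K - j \<Longrightarrow> all_runs ans (m * (N + 3) + 2) (While b c) s Q" for m j s
  proof (induction m arbitrary: j s)
    case 0
    then have nb: "\<not> bval b s" using body[of j s] by auto
    then have "all_runs ans (Suc (Suc 0)) (While b c) s Q"
      using exit[OF 0(1)] by (intro unfold all_runs_If) auto
    then show ?case by (rule all_runs_mono) auto
  next
    case (Suc m)
    have "all_runs ans (Suc (Suc (N + (m * (N + 3) + 2) + 1))) (While b c) s Q"
    proof (intro unfold all_runs_If all_runs_Seq)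
      assume b: "bval b s"
      show "all_runs ans N c s (\<lambda>s'. all_runs ans (m * (N + 3) + 2) (While b c) s' Q)"
        using body[OF Suc.prems(1) b] Suc.prems(2)
        by (elim conjE all_runs_mono) (auto intro!: Suc.IH[unfolded add_2_eq_Suc'] simp del: all_runs.simps)
    next
      assume "\<not> bval b s"
      then show "all_runs ans (N + (m * (N + 3) + 2) + 1) Skip s Q"
        using exit[OF Suc.prems(1)] by simp
    qed
    then show ?case by (rule all_runs_mono) auto
  qed
  from this[OF init refl] show ?thesis by simp
qed

text \<open>The equivalence is needed because \<open>response\<close> quantifies over any filter and
  query function described by the programs; uniqueness of the value pins them down.\<close>

lemma computes_in_iff:
  assumes "all_runs (\<lambda>_ _ _. False) N c s (\<lambda>s'. rmem s' 3 0 = r)" "real N \<le> T"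
  shows "computes_in T c s r' \<longleftrightarrow> r' = r"
proof
  assume "computes_in T c s r'"
  then obtain n s' where "(step (\<lambda>_ _ _. False) ^^ n) (c, s) (Skip, s')" "rmem s' 3 0 = r'"
    by (auto simp: computes_in_def)
  then show "r' = r" using all_runs_sound[OF assms(1)] by (auto elim: step_SkipE)
next
  assume "r' = r"
  obtain n s' where "n \<le> N" "(step (\<lambda>_ _ _. False) ^^ n) (c, s) (Skip, s')" "rmem s' 3 0 = r"
    using all_runs_complete[OF assms(1)] by blast
  then show "computes_in T c s r'" unfolding computes_in_def using \<open>r' = r\<close> assms(2)
    by (intro exI[of _ n] exI[of _ s']) auto
qed

text \<open>Index register 0 holds the dimension.\<close>

definition For :: "nat \<Rightarrow> 'q com \<Rightarrow> 'q com" where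
  "For v c = Seq (NAssign v (NConst 0))
     (While (NLess (NReg v) (NReg 0)) (Seq c (NAssign v (NPlus (NReg v) (NConst 1)))))"

lemma all_runs_For:
  assumes body: "\<And>j s. j < d \<Longrightarrow> nreg s 0 = d \<Longrightarrow> nreg s v = j \<Longrightarrow> P j s \<Longrightarrow>
      all_runs ans N c s (\<lambda>s'. nreg s' 0 = d \<and> nreg s' v = j \<and> P (Suc j) (s'\<lparr>nreg := (nreg s')(v := Suc j)\<rparr>))"
    and exit: "\<And>s. nreg s 0 = d \<Longrightarrow> nreg s v = d \<Longrightarrow> P d s \<Longrightarrow> Q s"
    and init: "nreg s 0 = d" "P 0 (s\<lparr>nreg := (nreg s)(v := 0)\<rparr>)" and v: "v \<noteq> 0"
  shows "all_runs ans (d * (N + 5) + 4) (For v c) s Q"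
proof -
  define I where "I j s \<longleftrightarrow> j \<le> d \<and> nreg s 0 = d \<and> nreg s v = j \<and> P j s" for j s
  have "all_runs ans (1 + (d * ((N + 1 + 1) + 3) + 2) + 1) (For v c) s Q"
    unfolding For_def
  proof (intro all_runs_Seq all_runs_NAssign all_runs_While[where I = I])
    fix j s assume I: "I j s" and b: "bval (NLess (NReg v) (NReg 0)) s"
    then have j: "j < d" by (simp add: I_def)
    have "all_runs ans (N + 1 + 1) (Seq c (NAssign v (NPlus (NReg v) (NConst 1)))) s (I (Suc j))"
    proof (intro all_runs_Seq)
      have "all_runs ans N c s (\<lambda>s'. nreg s' 0 = d \<and> nreg s' v = j \<and> P (Suc j) (s'\<lparr>nreg := (nreg s')(v := Suc j)\<rparr>))"
        using I by (intro body j) (auto simp: I_def)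
      then show "all_runs ans N c s (\<lambda>s'. all_runs ans 1 (NAssign v (NPlus (NReg v) (NConst 1))) s' (I (Suc j)))"
      proof (rule all_runs_mono)
        fix s' assume "nreg s' 0 = d \<and> nreg s' v = j \<and> P (Suc j) (s'\<lparr>nreg := (nreg s')(v := Suc j)\<rparr>)"
        then show "all_runs ans 1 (NAssign v (NPlus (NReg v) (NConst 1))) s' (I (Suc j))"
          using j v by (intro all_runs_NAssign) (simp add: I_def)
      qed simp
    qed
    then show "j < d \<and> all_runs ans (N + 1 + 1) (Seq c (NAssign v (NPlus (NReg v) (NConst 1)))) s (I (Suc j))"
      using j by blast
  next
    fix j s assume "I j s" "\<not> bval (NLess (NReg v) (NReg 0)) s"
    then show "Q s" by (auto simp: I_def intro!: exit)
  qed (use init v in \<open>auto simp: I_def\<close>)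
  then show ?thesis by (rule all_runs_mono) auto
qed

text \<open>The loop runs over index register 2, since register 1 has to survive the computation
  inside \<open>query_prog\<close>.\<close>

definition dot_prog :: "nat \<Rightarrow> nat \<Rightarrow> 'q com" where
  "dot_prog A B = Seq (RAssign 6 (NConst 0) (RConst 0))
     (For 2 (RAssign 6 (NConst 0)
        (RPlus (RMem 6 (NConst 0)) (RTimes (RMem A (NReg 2)) (RMem B (NReg 2))))))"

lemma all_runs_dot_prog:
  assumes "A \<noteq> 6" "B \<noteq> 6" "nreg s 0 = d"
    and Q: "\<And>s'. rmem s' 6 0 = dot d (rmem s A) (rmem s B) \<Longrightarrow> (\<And>a. a \<noteq> 6 \<Longrightarrow> rmem s' a = rmem s a) \<Longrightarrow>
       (\<And>v. v \<noteq> 2 \<Longrightarrow> nreg s' v = nreg s v) \<Longrightarrow> Q s'"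
  shows "all_runs ans (d * 6 + 6) (dot_prog A B) s Q"
proof -
  have "all_runs ans (1 + (d * (1 + 5) + 4) + 1) (dot_prog A B) s Q"
    unfolding dot_prog_def
  proof (intro all_runs_Seq all_runs_RAssign
      all_runs_For[where P = "\<lambda>j s'. rmem s' 6 0 = dot j (rmem s A) (rmem s B) \<and> (\<forall>a. a \<noteq> 6 \<longrightarrow> rmem s' a = rmem s a) \<and>
       (\<forall>v. v \<noteq> 2 \<longrightarrow> nreg s' v = nreg s v)"])
  qed (use assms in \<open>auto simp: store_def dot_def\<close>)
  then show ?thesis by (rule all_runs_mono) auto
qed

section \<open>The learner\<close>

text \<open>Memory layout: array 0 holds \<open>\<epsilon>\<close> and the current angle bound \<open>\<delta>\<close>, array 4 the iterate \<open>w\<close>,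
  array 5 the estimated gradient and array 6 is scratch space; index register 1 selects the
  coordinate being queried.\<close>

definition dim_exp :: rexp where "dim_exp = ROfNat (NReg 0)"
definition radius_exp :: rexp where "radius_exp = RTimes (RConst (10 ^ 29)) dim_exp"
definition eps_exp :: rexp where "eps_exp = RMem 0 (NConst 0)"
definition angle_exp :: rexp where "angle_exp = RMem 0 (NConst 1)"
definition width_exp :: rexp where "width_exp = RDivide angle_exp (RConst (10 ^ 180))"
definition scratch_exp :: rexp where "scratch_exp = RMem 6 (NConst 0)"

definition filter_prog :: code where
  "filter_prog = Seq (dot_prog 4 1)
     (If (RLess (RTimes width_exp width_exp) (RTimes scratch_exp scratch_exp))
       (RAssign 3 (NConst 0) (RConst 0)) (RAssign 3 (NConst 0) (RConst 1)))"

definition query_prog :: code where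
  "query_prog = Seq (dot_prog 1 1)
     (If (RLess (RTimes radius_exp radius_exp) scratch_exp)
       (RAssign 3 (NConst 0) (RConst 0))
       (RAssign 3 (NConst 0) (RDivide (RTimes (RMem 2 (NConst 0)) (RMem 1 (NReg 1))) radius_exp)))"

definition halfspace_prog :: code where
  "halfspace_prog = Seq (dot_prog 4 1)
     (If (RLess scratch_exp (RConst 0))
       (RAssign 3 (NConst 0) (RConst (- 1))) (RAssign 3 (NConst 0) (RConst 1)))"

text \<open>The filter tolerance is what the band mass \<delta>/10^270 guarantees while \<delta> is
  above the stopping threshold. The query tolerance of order 1/d^2 makes the error vector of order
  at most 1/d in norm.\<close>

definition gradient_query :: query where
  "gradient_query = ActiveSQ filter_prog query_prog
     (RDivide eps_exp (RConst (10 ^ 418)))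
     (RDivide (RConst 1) (RTimes (RConst (10 ^ 215)) (RTimes dim_exp dim_exp))) 5 (NReg 1)"

definition gradient_prog :: "query com" where
  "gradient_prog = For 1 (Ask gradient_query)"

definition update_prog :: "rexp \<Rightarrow> query com" where
  "update_prog h = For 1 (RAssign 4 (NReg 1) (RPlus (RMem 4 (NReg 1)) (RTimes h (RMem 5 (NReg 1)))))"

definition step_exp :: rexp where
  "step_exp = RDivide angle_exp (RTimes (RConst (10 ^ 209)) dim_exp)"

definition shrink_exp :: rexp where
  "shrink_exp = RTimes (RMinus (RConst 1) (RDivide (RConst 5) (RTimes (RConst (10 ^ 418)) (RTimes dim_exp dim_exp)))) angle_exp"

definition round_prog :: "query com" where
  "round_prog = Seq (Seq gradient_prog (update_prog step_exp)) (RAssign 0 (NConst 1) shrink_exp)"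

text \<open>The threshold inverts the error bound 2 * 10^147 \<delta> of
  \<open>halfspace_error_le\<close>.\<close>

definition guard_exp :: bexp where
  "guard_exp = RLess (RDivide eps_exp (RConst (2 * 10 ^ 147))) angle_exp"

definition learner_prog :: "query com" where
  "learner_prog = Seq (RAssign 0 (NConst 1) (RConst 1))
     (Seq (Seq gradient_prog (update_prog radius_exp))
       (While guard_exp round_prog))"

section \<open>Correctness and running time of the programs\<close>

lemma of_rat_power_ten [simp]: "(of_rat (10 ^ n) :: real) = 10 ^ n"
  by (simp add: of_rat_power)

lemma rval_exps:
  "rval dim_exp s = real (nreg s 0)"
  "rval radius_exp s = 10 ^ 29 * real (nreg s 0)"
  "rval eps_exp s = rmem s 0 0"
  "rval angle_exp s = rmem s 0 1"
  "rval width_exp s = rmem s 0 1 / 10 ^ 180"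
  "rval scratch_exp s = rmem s 6 0"
  "rval step_exp s = rmem s 0 1 / (10 ^ 209 * real (nreg s 0))"
  by (simp_all add: dim_exp_def radius_exp_def eps_exp_def angle_exp_def width_exp_def scratch_exp_def step_exp_def
      del: power_numeral)

lemma rval_shrink_exp:
  "rval shrink_exp s = (1 - 5 / (10 ^ 418 * (real (nreg s 0))\<^sup>2)) * rmem s 0 1"
  by (simp add: shrink_exp_def rval_exps power2_eq_square del: power_numeral)

lemma dot_loaded: "dot d (\<lambda>i. if i < d then x i else 0) (\<lambda>i. if i < d then x i else 0) = dot d x x"
  "dot d w (\<lambda>i. if i < d then x i else 0) = dot d w x"
  by (auto intro!: dot_cong)

lemma computes_filter_prog:
  assumes "nreg s 0 = d" "real (6 * d + 9) \<le> T"
  shows "computes_in T filter_prog (load_point d x s) r \<longleftrightarrow> r = band_filter d (rmem s 4) (rmem s 0 1 / 10 ^ 180) x"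
proof (rule computes_in_iff)
  show "all_runs (\<lambda>_ _ _. False) (d * 6 + 6 + Suc 1 + 1) filter_prog (load_point d x s)
    (\<lambda>s'. rmem s' 3 0 = band_filter d (rmem s 4) (rmem s 0 1 / 10 ^ 180) x)"
    unfolding filter_prog_def
  proof (intro all_runs_Seq all_runs_dot_prog all_runs_If all_runs_RAssign)
  qed (use assms in \<open>auto simp: load_point_def store_def rval_exps dot_loaded band_filter_def power2_eq_square
      not_less simp del: power_numeral\<close>)
qed (use assms in simp)

lemma computes_query_prog:
  assumes "nreg s 0 = d" "nreg s 1 = i" "i < d" "real (6 * d + 9) \<le> T"
  shows "computes_in T query_prog (load_example d x l s) r \<longleftrightarrow> r = coord_query d (10 ^ 29 * real d) i x l"
proof (rule computes_in_iff)
  show "all_runs (\<lambda>_ _ _. False) (d * 6 + 6 + Suc 1 + 1) query_prog (load_example d x l s)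
    (\<lambda>s'. rmem s' 3 0 = coord_query d (10 ^ 29 * real d) i x l)"
    unfolding query_prog_def
  proof (intro all_runs_Seq all_runs_dot_prog all_runs_If all_runs_RAssign)
  qed (use assms in \<open>auto simp: load_example_def load_point_def store_def rval_exps dot_loaded coord_query_def power2_eq_square
      not_less simp del: power_numeral\<close>)
qed (use assms in simp)

lemma computes_halfspace_prog:
  assumes "nreg s 0 = d" "real (6 * d + 9) \<le> T"
  shows "computes_in T halfspace_prog (load_point d x s) r \<longleftrightarrow> r = halfspace d (rmem s 4) x"
proof (rule computes_in_iff)
  show "all_runs (\<lambda>_ _ _. False) (d * 6 + 6 + Suc 1 + 1) halfspace_prog (load_point d x s)
    (\<lambda>s'. rmem s' 3 0 = halfspace d (rmem s 4) x)"
    unfolding halfspace_prog_def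
  proof (intro all_runs_Seq all_runs_dot_prog all_runs_If all_runs_RAssign)
  qed (use assms in \<open>auto simp: load_point_def store_def rval_exps dot_loaded halfspace_dot not_less\<close>)
qed (use assms in simp)

lemma all_runs_update_prog:
  assumes h: "\<And>s'. nreg s' 0 = d \<Longrightarrow> rmem s' 0 = rmem s 0 \<Longrightarrow> rval h s' = \<eta>"
    and s: "nreg s 0 = d"
    and Q: "\<And>s'. nreg s' 0 = d \<Longrightarrow> rmem s' 0 = rmem s 0 \<Longrightarrow>
       (\<And>i. i < d \<Longrightarrow> rmem s' 4 i = rmem s 4 i + \<eta> * rmem s 5 i) \<Longrightarrow> Q s'"
  shows "all_runs ans (d * 6 + 4) (update_prog h) s Q"
proof -
  have "all_runs ans (d * (1 + 5) + 4) (update_prog h) s Q"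
    unfolding update_prog_def
  proof (rule all_runs_For[where P = "\<lambda>j s'. rmem s' 0 = rmem s 0 \<and> rmem s' 5 = rmem s 5 \<and>
      (\<forall>i. rmem s' 4 i = (if i < j then rmem s 4 i + \<eta> * rmem s 5 i else rmem s 4 i))"], goal_cases)
    case (1 j s')
    then have "rval h s' = \<eta>" using h by blast
    with 1 show ?case by (intro all_runs_RAssign) (auto simp: store_def less_Suc_eq)
  next
    case (2 s')
    then show ?case by (intro Q) auto
  qed (use s in auto)
  then show ?thesis by simp
qed

context isotropic_log_concave
begin

context
  fixes v :: "nat \<Rightarrow> real" and T \<tau>0 \<tau> \<epsilon> :: real
  assumes T: "real (6 * d + 9) \<le> T" and \<tau>0: "\<tau>0 \<le> \<epsilon> / 10 ^ 418" and \<tau>: "\<tau> \<le> 1 / (10 ^ 215 * (real d)\<^sup>2)"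
begin

text \<open>The mass hypothesis keeps the filter above its tolerance; below it every value would be
  a valid response. Both directions matter: one bounds the error of each response, the other shows
  that the query is admissible and does not get stuck.\<close>

lemma response_gradient:
  assumes s: "nreg s 0 = d" "nreg s 1 = i" "i < d" "rmem s 0 0 = \<epsilon>"
    and mass: "\<epsilon> / 10 ^ 418 \<le> prob (band (rmem s 4) (rmem s 0 1 / 10 ^ 180))"
  shows "response d D (halfspace d v) T \<tau>0 \<tau> gradient_query s s' \<longleftrightarrow>
    (\<exists>\<mu>. s' = store 5 i \<mu> s \<and>
      \<bar>\<mu> - gradient v (rmem s 4) (rmem s 0 1 / 10 ^ 180) (10 ^ 29 * real d) i\<bar> \<le> 1 / (10 ^ 215 * (real d)\<^sup>2))"
proof -
  define w where "w = rmem s 4"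
  define b where "b = rmem s 0 1 / 10 ^ 180"
  define R where "R = 10 ^ 29 * real d"
  have R: "0 < R" using s by (simp add: R_def)
  have r0: "rval (RDivide eps_exp (RConst (10 ^ 418))) s = \<epsilon> / 10 ^ 418"
    using s by (simp add: rval_exps del: power_numeral)
  have r1: "rval (RDivide (RConst 1) (RTimes (RConst (10 ^ 215)) (RTimes dim_exp dim_exp))) s = 1 / (10 ^ 215 * (real d)\<^sup>2)"
    using s by (simp add: rval_exps power2_eq_square del: power_numeral)
  have cf: "computes_in T filter_prog (load_point d x s) r \<longleftrightarrow> r = band_filter d w b x" for x r
    unfolding w_def b_def by (rule computes_filter_prog[OF s(1) T])
  have cq: "computes_in T query_prog (load_example d x l s) r \<longleftrightarrow> r = coord_query d R i x l" for x l r
    unfolding R_def by (rule computes_query_prog[OF s(1,2,3) T])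
  have hs: "halfspace d v x \<in> {-1, 1}" for x by (simp add: halfspace_dot)
  have valid: "valid_response D (halfspace d v) \<rho> \<phi> (\<epsilon> / 10 ^ 418) t \<mu> \<longleftrightarrow> \<bar>\<mu> - gradient v w b R i\<bar> \<le> t"
    if \<rho>: "is_filter D \<rho>" "\<And>x. x \<in> space D \<Longrightarrow> \<rho> x = band_filter d w b x"
      and \<phi>: "\<And>x l. x \<in> space D \<Longrightarrow> l \<in> {-1, 1} \<Longrightarrow> \<phi> x l = coord_query d R i x l" for \<rho> \<phi> t \<mu>
  proof -
    have int: "(\<integral>x. \<rho> x \<partial>D) = (\<integral>x. band_filter d w b x \<partial>D)"
      using \<rho>(2) by (intro Bochner_Integration.integral_cong) auto
    have "filtered D \<rho> = filtered D (band_filter d w b)"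
      unfolding filtered_def int using \<rho> by (intro density_cong) (auto simp: is_filter_def)
    moreover have "(\<integral>x. \<phi> x (halfspace d v x) \<partial>filtered D (band_filter d w b)) = gradient v w b R i"
      unfolding gradient_def
      by (intro Bochner_Integration.integral_cong refl) (auto simp: filtered_def intro!: \<phi> hs)
    ultimately show ?thesis using mass
      by (simp add: valid_response_def int integral_band_filter w_def b_def)
  qed
  have isf: "is_filter D (band_filter d w b)"
    by (simp add: is_filter_def) (simp add: band_filter_def)
  have isq: "is_query D (coord_query d R i)"
    unfolding is_query_def
  proof (intro ballI conjI)
    fix l :: real and x assume l: "l \<in> {-1, 1}"
    show "(\<lambda>x. coord_query d R i x l) \<in> borel_measurable D" using s by (intro measurable_coord_query)
    have "\<bar>coord_query d R i x l\<bar> \<le> 1" using l s R by (intro coord_query_bounded) auto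
    then show "coord_query d R i x l \<in> {-1..1}" by (simp add: abs_le_iff)
  qed
  show ?thesis
    unfolding w_def[symmetric] b_def[symmetric] R_def[symmetric]
  proof
    assume "response d D (halfspace d v) T \<tau>0 \<tau> gradient_query s s'"
    then show "\<exists>\<mu>. s' = store 5 i \<mu> s \<and> \<bar>\<mu> - gradient v w b R i\<bar> \<le> 1 / (10 ^ 215 * (real d)\<^sup>2)"
      unfolding gradient_query_def
    proof (cases rule: response.cases)
      case (response_ActiveSQ \<rho> \<phi> \<mu>)
      then have "\<bar>\<mu> - gradient v w b R i\<bar> \<le> 1 / (10 ^ 215 * (real d)\<^sup>2)"
        unfolding r0 r1 by (subst valid[symmetric, of \<rho> \<phi>]) (auto simp: cf cq)
      then show ?thesis using response_ActiveSQ s by auto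
    qed
  next
    assume "\<exists>\<mu>. s' = store 5 i \<mu> s \<and> \<bar>\<mu> - gradient v w b R i\<bar> \<le> 1 / (10 ^ 215 * (real d)\<^sup>2)"
    then obtain \<mu> where \<mu>: "s' = store 5 i \<mu> s" "\<bar>\<mu> - gradient v w b R i\<bar> \<le> 1 / (10 ^ 215 * (real d)\<^sup>2)" by blast
    have "response d D (halfspace d v) T \<tau>0 \<tau> gradient_query s (store 5 (nval (NReg 1) s) \<mu> s)"
      unfolding gradient_query_def
    proof (rule response_ActiveSQ[OF isf _ isq])
      show "valid_response D (halfspace d v) (band_filter d w b) (coord_query d R i)
         (rval (RDivide eps_exp (RConst (10 ^ 418))) s)
         (rval (RDivide (RConst 1) (RTimes (RConst (10 ^ 215)) (RTimes dim_exp dim_exp))) s) \<mu>"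
        unfolding r0 r1 by (subst valid[OF isf]) (use \<mu> in auto)
    qed (unfold r0 r1, (intro ballI cf[THEN iffD2] cq[THEN iffD2] refl \<tau>0 \<tau>)+)
    then show "response d D (halfspace d v) T \<tau>0 \<tau> gradient_query s s'" using s \<mu> by simp
  qed
qed

lemma all_runs_gradient_prog:
  assumes s: "nreg s 0 = d" "rmem s 0 0 = \<epsilon>"
    and mass: "\<epsilon> / 10 ^ 418 \<le> prob (band (rmem s 4) (rmem s 0 1 / 10 ^ 180))"
    and Q: "\<And>s'. nreg s' 0 = d \<Longrightarrow> rmem s' 0 = rmem s 0 \<Longrightarrow> rmem s' 4 = rmem s 4 \<Longrightarrow>
      (\<And>i. i < d \<Longrightarrow> \<bar>rmem s' 5 i - gradient v (rmem s 4) (rmem s 0 1 / 10 ^ 180) (10 ^ 29 * real d) i\<bar>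
         \<le> 1 / (10 ^ 215 * (real d)\<^sup>2)) \<Longrightarrow> Q s'"
  shows "all_runs (response d D (halfspace d v) T \<tau>0 \<tau>) (d * 6 + 4) gradient_prog s Q"
proof -
  define G where "G = gradient v (rmem s 4) (rmem s 0 1 / 10 ^ 180) (10 ^ 29 * real d)"
  define t where "t = 1 / (10 ^ 215 * (real d)\<^sup>2)"
  have t0: "0 \<le> t" unfolding t_def by (intro divide_nonneg_nonneg mult_nonneg_nonneg) auto
  have "all_runs (response d D (halfspace d v) T \<tau>0 \<tau>) (d * (1 + 5) + 4) gradient_prog s Q"
    unfolding gradient_prog_def
  proof (rule all_runs_For[where P = "\<lambda>j s'. rmem s' 0 = rmem s 0 \<and> rmem s' 4 = rmem s 4 \<and>
      (\<forall>i<j. \<bar>rmem s' 5 i - G i\<bar> \<le> t)"], goal_cases)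
    case (1 j s1)
    have s1: "rmem s1 0 = rmem s 0" "rmem s1 4 = rmem s 4" using 1(4) by auto
    have resp: "response d D (halfspace d v) T \<tau>0 \<tau> gradient_query s1 s' \<longleftrightarrow>
       (\<exists>\<mu>. s' = store 5 j \<mu> s1 \<and> \<bar>\<mu> - G j\<bar> \<le> t)" for s'
      unfolding G_def t_def
      by (rule response_gradient[OF 1(2,3,1), unfolded s1, OF s(2) mass])
    show ?case
    proof (rule all_runs_Ask)
      show "\<exists>s'. response d D (halfspace d v) T \<tau>0 \<tau> gradient_query s1 s'"
        unfolding resp by (intro exI[of _ "store 5 j (G j) s1"] exI[of _ "G j"]) (use t0 in auto)
    next
      fix s'
      assume "response d D (halfspace d v) T \<tau>0 \<tau> gradient_query s1 s'"
      then obtain \<mu> where "s' = store 5 j \<mu> s1" "\<bar>\<mu> - G j\<bar> \<le> t" unfolding resp by blast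
      then show "nreg s' 0 = d \<and> nreg s' 1 = j \<and>
         rmem (s'\<lparr>nreg := (nreg s')(1 := Suc j)\<rparr>) 0 = rmem s 0 \<and>
         rmem (s'\<lparr>nreg := (nreg s')(1 := Suc j)\<rparr>) 4 = rmem s 4 \<and>
         (\<forall>i<Suc j. \<bar>rmem (s'\<lparr>nreg := (nreg s')(1 := Suc j)\<rparr>) 5 i - G i\<bar> \<le> t)"
        using 1 by (auto simp: store_def less_Suc_eq)
    qed
  next
    case (2 s1)
    then show ?case by (intro Q) (auto simp: G_def t_def)
  qed (use s in auto)
  then show ?thesis by simp
qed

lemma all_runs_learner_prog:
  assumes v: "dot d v v = 1" and d: "0 < d" and \<epsilon>: "0 < \<epsilon>" "\<epsilon> < 1"
    and K: "\<And>j. \<epsilon> / (2 * 10 ^ 147) < (1 - 5 / (10 ^ 418 * (real d)\<^sup>2)) ^ j \<Longrightarrow> j < K"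
  shows "all_runs (response d D (halfspace d v) T \<tau>0 \<tau>) (K * (12 * d + 14) + 12 * d + 14) learner_prog (init_state d \<epsilon>)
     (\<lambda>s. nreg s 0 = d \<and> good_iterate d v (rmem s 4) (rmem s 0 1) \<and> rmem s 0 1 \<le> \<epsilon> / (2 * 10 ^ 147))"
proof -
  define q where "q = 1 - 5 / (10 ^ 418 * (real d)\<^sup>2)"
  define e where "e = \<epsilon> / (2 * 10 ^ 147)"
  define R where "R = 10 ^ 29 * real d"
  let ?ans = "response d D (halfspace d v) T \<tau>0 \<tau>"
  define I where "I j s \<longleftrightarrow> nreg s 0 = d \<and> rmem s 0 0 = \<epsilon> \<and> rmem s 0 1 = q ^ j \<and> good_iterate d v (rmem s 4) (rmem s 0 1)"
    for j and s :: state
  have loop: "all_runs ?ans (12 * d + 11) round_prog s (I (Suc j))"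
    if I: "I j s" and less: "e < rmem s 0 1" for j s
  proof -
    define \<delta> where "\<delta> = rmem s 0 1"
    define w where "w = rmem s 4"
    have sI: "nreg s 0 = d" "rmem s 0 0 = \<epsilon>" "\<delta> = q ^ j" "good_iterate d v w \<delta>" using I by (auto simp: I_def \<delta>_def w_def)
    \<comment> \<open>The loop guard gives \<delta> > \<epsilon>/(2 * 10^147); together with the
      band mass \<delta>/10^270, and 2 rounded up to 10, this is \<epsilon>/10^418.\<close>
    have mass: "\<epsilon> / 10 ^ 418 \<le> prob (band w (\<delta> / 10 ^ 180))"
    proof -
      have p: "(10::real) ^ 418 = 10 * 10 ^ 147 * 10 ^ 270"
        using power_add[of "10::real" 148 270] power_Suc[of "10::real" 147]
        by (simp only: numeral_plus_numeral add_num_simps Suc_numeral)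
      have "\<epsilon> / 10 ^ 418 = \<epsilon> / (10 * 10 ^ 147) / 10 ^ 270" by (simp only: p divide_divide_eq_left)
      also have "\<epsilon> / (10 * 10 ^ 147) \<le> e" unfolding e_def using \<epsilon> by (intro divide_left_mono mult_right_mono) auto
      also have "e \<le> \<delta>" using less by (simp add: \<delta>_def)
      finally have "\<epsilon> / 10 ^ 418 \<le> \<delta> / 10 ^ 270" by (simp add: divide_right_mono)
      then show ?thesis using good_iterate_band(3)[OF v sI(4)] by linarith
    qed
    have "all_runs ?ans ((d * 6 + 4 + (d * 6 + 4) + 1) + 1 + 1)
       round_prog s (I (Suc j))"
      unfolding round_prog_def
    proof (intro all_runs_Seq all_runs_gradient_prog[OF sI(1,2) mass[unfolded w_def \<delta>_def]])
      fix s1 :: state assume s1: "nreg s1 0 = d" "rmem s1 0 = rmem s 0" "rmem s1 4 = rmem s 4"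
        "\<And>i. i < d \<Longrightarrow> \<bar>rmem s1 5 i - gradient v (rmem s 4) (rmem s 0 1 / 10 ^ 180) (10 ^ 29 * real d) i\<bar>
         \<le> 1 / (10 ^ 215 * (real d)\<^sup>2)"
      show "all_runs ?ans (d * 6 + 4) (update_prog step_exp) s1 (\<lambda>s'. all_runs ?ans 1 (RAssign 0 (NConst 1) shrink_exp) s' (I (Suc j)))"
      proof (rule all_runs_update_prog)
        show "rval step_exp s' = \<delta> / (10 ^ 209 * real d)" if "nreg s' 0 = d" "rmem s' 0 = rmem s1 0" for s' :: state
          using that s1 by (simp only: rval_exps \<delta>_def)
        fix s2 :: state assume s2: "nreg s2 0 = d" "rmem s2 0 = rmem s1 0"
          "\<And>i. i < d \<Longrightarrow> rmem s2 4 i = rmem s1 4 i + \<delta> / (10 ^ 209 * real d) * rmem s1 5 i"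
        have "good_iterate d v (\<lambda>i. w i + \<delta> / (10 ^ 209 * real d) * rmem s1 5 i) (q * \<delta>)"
          unfolding q_def by (rule good_iterate_step[OF v d sI(4)]) (use s1(4) in \<open>simp only: w_def \<delta>_def\<close>)
        then have "good_iterate d v (rmem s2 4) (q * \<delta>)"
          by (subst good_iterate_cong[where w' = "\<lambda>i. w i + \<delta> / (10 ^ 209 * real d) * rmem s1 5 i"])
            (use s2(3) s1(3) in \<open>auto simp only: w_def\<close>)
        moreover have "rval shrink_exp s2 = q * \<delta>"
          using s2 s1 by (simp only: rval_shrink_exp q_def \<delta>_def)
        ultimately show "all_runs ?ans 1 (RAssign 0 (NConst 1) shrink_exp) s2 (I (Suc j))"
          using s2(1,2) s1(2) sI by (intro all_runs_RAssign) (simp add: I_def store_def)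
      qed (rule s1)
    qed
    then show ?thesis by (rule all_runs_mono) auto
  qed
  have "all_runs ?ans (1 + ((d * 6 + 4 + (d * 6 + 4) + 1) + (K * ((12 * d + 11) + 3) + 2) + 1) + 1) learner_prog (init_state d \<epsilon>)
     (\<lambda>s. nreg s 0 = d \<and> good_iterate d v (rmem s 4) (rmem s 0 1) \<and> rmem s 0 1 \<le> e)"
    unfolding learner_prog_def
  proof (intro all_runs_Seq all_runs_RAssign)
    let ?s = "store 0 (nval (NConst 1) (init_state d \<epsilon>)) (rval (RConst 1) (init_state d \<epsilon>)) (init_state d \<epsilon>)"
    let ?W = "While guard_exp round_prog"
    let ?Q = "\<lambda>s. nreg s 0 = d \<and> good_iterate d v (rmem s 4) (rmem s 0 1) \<and> rmem s 0 1 \<le> e"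
    have s0: "nreg ?s 0 = d" "rmem ?s 0 0 = \<epsilon>" "rmem ?s 0 1 = 1" "rmem ?s 4 = (\<lambda>_. 0)"
      by (auto simp: init_state_def store_def)
    \<comment> \<open>The initial iterate is 0, whose band is the whole space.\<close>
    have mass0: "\<epsilon> / 10 ^ 418 \<le> prob (band (rmem ?s 4) (rmem ?s 0 1 / 10 ^ 180))"
    proof -
      have "\<epsilon> / 10 ^ 418 \<le> \<epsilon> / 1" using \<epsilon> by (intro divide_left_mono) auto
      moreover have "band (\<lambda>_. 0) b = space D" for b by (simp add: band_def dot_def)
      ultimately show ?thesis using \<epsilon> unfolding s0 by (simp only: prob_space)
    qed
    show "all_runs ?ans (d * 6 + 4) gradient_prog ?s
      (\<lambda>s'. all_runs ?ans (d * 6 + 4) (update_prog radius_exp) s' (\<lambda>s'. all_runs ?ans (K * ((12 * d + 11) + 3) + 2) ?W s' ?Q))"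
    proof (rule all_runs_gradient_prog[OF s0(1,2) mass0])
      fix s1 :: state assume s1: "nreg s1 0 = d" "rmem s1 0 = rmem ?s 0" "rmem s1 4 = rmem ?s 4"
        "\<And>i. i < d \<Longrightarrow> \<bar>rmem s1 5 i - gradient v (rmem ?s 4) (rmem ?s 0 1 / 10 ^ 180) (10 ^ 29 * real d) i\<bar>
         \<le> 1 / (10 ^ 215 * (real d)\<^sup>2)"
      show "all_runs ?ans (d * 6 + 4) (update_prog radius_exp) s1 (\<lambda>s'. all_runs ?ans (K * ((12 * d + 11) + 3) + 2) ?W s' ?Q)"
      proof (rule all_runs_update_prog)
        show "rval radius_exp s' = R" if "nreg s' 0 = d" for s' :: state using that by (simp only: rval_exps R_def)
        fix s2 :: state assume s2: "nreg s2 0 = d" "rmem s2 0 = rmem s1 0"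
          "\<And>i. i < d \<Longrightarrow> rmem s2 4 i = rmem s1 4 i + R * rmem s1 5 i"
        have "good_iterate d v (\<lambda>i. R * rmem s1 5 i) 1"
          unfolding R_def by (rule good_iterate_initial[OF v d]) (use s1(4) in \<open>simp only: s0(4)\<close>)
        then have "good_iterate d v (rmem s2 4) 1"
          by (subst good_iterate_cong[where w' = "\<lambda>i. R * rmem s1 5 i"])
            (use s2(3) s1(3) s0(4) in \<open>auto simp only: add_0\<close>)
        then have I0: "I 0 s2" unfolding I_def using s2 s1 s0 by (simp only: power_0 simp_thms)
        have guard: "bval guard_exp s \<longleftrightarrow> e < rmem s 0 1"
          if "rmem s 0 0 = \<epsilon>" for s :: state
          using that by (simp add: guard_exp_def rval_exps e_def of_rat_mult)
        show "all_runs ?ans (K * ((12 * d + 11) + 3) + 2) ?W s2 ?Q"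
        proof (rule all_runs_While[where I = I, OF _ _ I0])
          fix j s assume I: "I j s" and b: "bval guard_exp s"
          then have less: "e < rmem s 0 1" using guard by (simp only: I_def)
          then have "j < K" using I K[folded q_def e_def] by (simp only: I_def)
          then show "j < K \<and> all_runs ?ans (12 * d + 11)
              round_prog s (I (Suc j))"
            using loop[OF I less] by blast
        next
          fix j s assume I: "I j s" and b: "\<not> bval guard_exp s"
          then have "rmem s 0 1 \<le> e" using guard[of s] by (auto simp only: I_def not_less)
          then show "nreg s 0 = d \<and> good_iterate d v (rmem s 4) (rmem s 0 1) \<and> rmem s 0 1 \<le> e"
            using I unfolding I_def by blast
        qed
      qed (rule s1)
    qed
  qed
  then show ?thesis unfolding e_def by (rule all_runs_mono) auto
qed

end

end

section \<open>Number of rounds, polynomial bounds and assembly\<close>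

lemma iteration_bound:
  fixes \<gamma> e :: real
  assumes \<gamma>: "0 < \<gamma>" "\<gamma> \<le> 1" and e: "0 < e" and less: "e < (1 - \<gamma>) ^ j"
  shows "j < nat \<lceil>ln (1 / e) / \<gamma>\<rceil>"
proof -
  have "(1 - \<gamma>) ^ j \<le> (exp (- \<gamma>)) ^ j"
    using \<gamma> exp_ge_add_one_self[of "- \<gamma>"] by (intro power_mono) auto
  also have "\<dots> = exp (- (\<gamma> * real j))" by (simp add: exp_of_nat_mult[symmetric] mult.commute)
  finally have "e < exp (- (\<gamma> * real j))" using less by linarith
  then have "ln e < - (\<gamma> * real j)" using e ln_less_cancel_iff[of e "exp (- (\<gamma> * real j))"] by simp
  then have "\<gamma> * real j < ln (1 / e)" using e by (simp add: ln_div)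
  then have "real j < ln (1 / e) / \<gamma>" using \<gamma> by (simp add: pos_less_divide_eq mult.commute)
  then show ?thesis by linarith
qed

lemma running_time_bound:
  fixes \<epsilon> c :: real
  assumes d: "0 < d" and \<epsilon>: "0 < \<epsilon>" "\<epsilon> < 1" and c: "1 \<le> c"
    and K: "K = nat \<lceil>ln (1 / (\<epsilon> / (2 * 10 ^ 147))) / (5 / (c * (real d)\<^sup>2))\<rceil>"
  shows "real (K * (12 * d + 14) + 12 * d + 14) \<le> 10 ^ 5 * c * (real d + ln (1 / \<epsilon>)) ^ 4"
proof -
  define S where "S = real d + ln (1 / \<epsilon>)"
  have L: "0 \<le> ln (1 / \<epsilon>)" using \<epsilon> by (simp add: ln_div)
  have d1: "1 \<le> real d" using d by simp
  have S: "1 \<le> S" "real d \<le> S" "ln (1 / \<epsilon>) \<le> S" using L d1 by (auto simp: S_def)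
  have "ln (1 / (\<epsilon> / (2 * 10 ^ 147))) = ln (1 / \<epsilon> * (2 * 10 ^ 147))" by (simp only: divide_divide_eq_right times_divide_eq_left mult_1)
  also have "\<dots> = ln (1 / \<epsilon>) + (ln 2 + real 147 * ln 10)"
  proof -
    have "ln (1 / \<epsilon> * (2 * 10 ^ 147)) = ln (1 / \<epsilon>) + ln (2 * 10 ^ 147)"
      using \<epsilon> by (intro ln_mult_pos) auto
    moreover have "ln (2 * (10::real) ^ 147) = ln 2 + ln (10 ^ 147)" by (intro ln_mult_pos) auto
    moreover have "ln ((10::real) ^ 147) = real 147 * ln 10" by (rule ln_realpow)
    ultimately show ?thesis by (simp only:)
  qed
  \<comment> \<open>With ln 2 <= 1, ln 10 <= 9 and S >= 1, the coefficient is 1 + 1 + 147 * 9 =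
    1325.\<close>
  also have "\<dots> \<le> 1325 * S" using S ln_le_minus_one[of "2::real"] ln_le_minus_one[of "10::real"] by simp
  finally have lnle: "ln (1 / (\<epsilon> / (2 * 10 ^ 147))) \<le> 1325 * S" .
  have "ln (1 / (\<epsilon> / (2 * 10 ^ 147))) / (5 / (c * (real d)\<^sup>2)) = ln (1 / (\<epsilon> / (2 * 10 ^ 147))) * (c * (real d)\<^sup>2 / 5)"
    by (simp only: divide_divide_eq_right times_divide_eq_right)
  also have "\<dots> \<le> 1325 * S * (c * S\<^sup>2 / 5)"
    using lnle S c by (intro mult_mono divide_right_mono mult_left_mono power_mono) auto
  also have "\<dots> = 265 * (c * S ^ 3)" by (simp add: power2_eq_square power3_eq_cube)
  finally have Kr: "ln (1 / (\<epsilon> / (2 * 10 ^ 147))) / (5 / (c * (real d)\<^sup>2)) \<le> 265 * (c * S ^ 3)" .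
  have cS: "1 \<le> c * S ^ 3" using mult_mono[OF c one_le_power[OF S(1), of 3]] c by simp
  have "real K \<le> 265 * (c * S ^ 3) + 1" unfolding K using Kr cS by linarith
  then have K1: "real K + 1 \<le> 267 * (c * S ^ 3)" using cS by linarith
  have "real (K * (12 * d + 14) + 12 * d + 14) = (real K + 1) * (12 * real d + 14)" by (simp add: algebra_simps)
  also have "\<dots> \<le> 267 * (c * S ^ 3) * (26 * S)" using K1 S cS by (intro mult_mono) auto
  also have "\<dots> = 6942 * (c * S ^ 4)" by (simp add: power4_eq_xxxx power3_eq_cube)
  also have "\<dots> \<le> 10 ^ 5 * (c * S ^ 4)" using S c by (intro mult_right_mono) auto
  finally show ?thesis by (simp add: S_def mult.assoc)
qed

theorem theorem3p6:
  shows "\<exists>(A :: sq_algorithm) (c1 :: real) (k1 :: nat) (c2 :: real) (k2 :: nat) (c0 :: real).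
           0 < c1 \<and> 0 < c2 \<and> 0 < c0 \<and>
           (\<forall>(d :: nat) (\<epsilon> :: real) (D :: (nat \<Rightarrow> real) measure).
              0 < \<epsilon> \<longrightarrow> \<epsilon> < 1 \<longrightarrow> log_concave d D \<longrightarrow> isotropic d D \<longrightarrow>
              learns A (halfspaces d) d \<epsilon> D
                (c1 * (real d + ln (1 / \<epsilon>)) ^ k1)
                (c0 * \<epsilon>)
                (1 / (c2 * (real d + ln (1 / \<epsilon>)) ^ k2)))"
proof -
  define c :: real where "c = 10 ^ 418"
  define A where "A = \<lparr>main_prog = learner_prog, hyp_prog = halfspace_prog\<rparr>"
  have c: "1 \<le> c" unfolding c_def by (rule one_le_power) simp
  have "learns A (halfspaces d) d \<epsilon> D (10 ^ 5 * c * (real d + ln (1 / \<epsilon>)) ^ 4) (1 / c * \<epsilon>)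
      (1 / (10 ^ 215 * (real d + ln (1 / \<epsilon>)) ^ 2))"
    if \<epsilon>: "0 < \<epsilon>" "\<epsilon> < 1" and lc: "log_concave d D" and iso: "isotropic d D" for d \<epsilon> D
    unfolding learns_def
  proof (intro ballI allI impI)
    define T where "T = 10 ^ 5 * c * (real d + ln (1 / \<epsilon>)) ^ 4"
    define \<tau> where "\<tau> = 1 / (10 ^ 215 * (real d + ln (1 / \<epsilon>)) ^ 2)"
    interpret isotropic_log_concave d D using lc iso by unfold_locales
    fix f n cm s
    assume f: "f \<in> halfspaces d"
      and run: "(step (response d D f (10 ^ 5 * c * (real d + ln (1 / \<epsilon>)) ^ 4) (1 / c * \<epsilon>)
        (1 / (10 ^ 215 * (real d + ln (1 / \<epsilon>)) ^ 2))) ^^ n) (main_prog A, init_state d \<epsilon>) (cm, s)"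
    from f obtain v where v: "f = halfspace d v" "(\<Sum>i<d. (v i)\<^sup>2) = 1" by (auto simp: halfspaces_def)
    have vv: "dot d v v = 1" using v(2) by (simp add: dot_def power2_eq_square)
    \<comment> \<open>In dimension 0 there is no unit vector, so the class of targets is
      empty.\<close>
    have d: "0 < d" using v(2) by (cases "d = 0") auto
    have d1: "1 \<le> real d" using d by simp
    have L: "0 \<le> ln (1 / \<epsilon>)" using \<epsilon> by (simp add: ln_div)
    define K where "K = nat \<lceil>ln (1 / (\<epsilon> / (2 * 10 ^ 147))) / (5 / (c * (real d)\<^sup>2))\<rceil>"
    have time: "real (K * (12 * d + 14) + 12 * d + 14) \<le> T"
      unfolding T_def by (rule running_time_bound[OF d \<epsilon> c K_def])
    have "real (6 * d + 9) \<le> real (K * (12 * d + 14) + 12 * d + 14)" by (subst of_nat_le_iff) simp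
    then have T: "real (6 * d + 9) \<le> T" using time by linarith
    have \<tau>0: "1 / c * \<epsilon> \<le> \<epsilon> / 10 ^ 418" by (simp only: c_def times_divide_eq_left mult_1 order.refl)
    have \<tau>: "\<tau> \<le> 1 / (10 ^ 215 * (real d)\<^sup>2)"
      unfolding \<tau>_def using L d1 by (intro divide_left_mono mult_left_mono power_mono mult_pos_pos) auto
    have iter: "j < K" if "\<epsilon> / (2 * 10 ^ 147) < (1 - 5 / (10 ^ 418 * (real d)\<^sup>2)) ^ j" for j
      unfolding K_def
    proof (rule iteration_bound)
      have "1 * 1 \<le> c / 5 * (real d)\<^sup>2"
      proof (rule mult_mono)
        show "1 \<le> c / 5" unfolding c_def using power_increasing[of 1 418 "10::real"] by simp
      qed (use d1 c in auto)
      then show "5 / (c * (real d)\<^sup>2) \<le> 1" using c d1 by (simp add: divide_le_eq)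
      show "0 < 5 / (c * (real d)\<^sup>2)" using c d1 by (intro divide_pos_pos mult_pos_pos) auto
      show "0 < \<epsilon> / (2 * 10 ^ 147)" using \<epsilon> by (intro divide_pos_pos) auto
      show "\<epsilon> / (2 * 10 ^ 147) < (1 - 5 / (c * (real d)\<^sup>2)) ^ j" using that by (simp only: c_def)
    qed
    note result = all_runs_sound[OF all_runs_learner_prog[OF T \<tau>0 \<tau> vv d \<epsilon> iter] run[folded T_def \<tau>_def, unfolded A_def v sq_algorithm.simps]]
    show "real n \<le> 10 ^ 5 * c * (real d + ln (1 / \<epsilon>)) ^ 4 \<and>
       ((\<nexists>k. step (response d D f (10 ^ 5 * c * (real d + ln (1 / \<epsilon>)) ^ 4) (1 / c * \<epsilon>)
          (1 / (10 ^ 215 * (real d + ln (1 / \<epsilon>)) ^ 2))) (cm, s) k) \<longrightarrow>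
         cm = Skip \<and> good_output d \<epsilon> D f (10 ^ 5 * c * (real d + ln (1 / \<epsilon>)) ^ 4) (hyp_prog A) s)"
      unfolding T_def[symmetric] \<tau>_def[symmetric]
    proof (intro conjI impI)
      have "n \<le> K * (12 * d + 14) + 12 * d + 14" using result by blast
      then have "real n \<le> real (K * (12 * d + 14) + 12 * d + 14)" by (subst of_nat_le_iff)
      then show "real n \<le> T" using time by linarith
      assume "\<nexists>k. step (response d D f T (1 / c * \<epsilon>) \<tau>) (cm, s) k"
      then have fin: "cm = Skip" "nreg s 0 = d" "good_iterate d v (rmem s 4) (rmem s 0 1)" "rmem s 0 1 \<le> \<epsilon> / (2 * 10 ^ 147)"
        using result unfolding v by blast+
      then show "cm = Skip" by blast
      have gi: "0 \<le> rmem s 0 1" "0 < dot d v (rmem s 4)"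
        "(1 - (rmem s 0 1)\<^sup>2) * dot d (rmem s 4) (rmem s 4) \<le> (dot d v (rmem s 4))\<^sup>2"
        using fin(3) unfolding good_iterate_def by (auto intro: less_le_trans[of 0 "4 / 10 ^ 6 * (1 + rmem s 0 1)"])
      have "prob {x \<in> space D. halfspace d (rmem s 4) x \<noteq> f x} \<le> 2 * 10 ^ 147 * rmem s 0 1"
        unfolding v by (rule halfspace_error_le[OF vv gi(2,1,3)])
      also have "\<dots> \<le> 2 * 10 ^ 147 * (\<epsilon> / (2 * 10 ^ 147))" by (rule mult_left_mono[OF fin(4)]) simp
      also have "\<dots> = \<epsilon>" by simp
      finally show "good_output d \<epsilon> D f T (hyp_prog A) s"
        unfolding good_output_def A_def sq_algorithm.simps
        by (intro exI[of _ "halfspace d (rmem s 4)"])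
          (auto simp: computes_halfspace_prog[OF fin(2) T] halfspace_dot)
    qed
  qed
  then have "0 < 10 ^ 5 * c \<and> (0::real) < 10 ^ 215 \<and> 0 < 1 / c \<and>
      (\<forall>d \<epsilon> D. 0 < \<epsilon> \<longrightarrow> \<epsilon> < 1 \<longrightarrow> log_concave d D \<longrightarrow> isotropic d D \<longrightarrow>
        learns A (halfspaces d) d \<epsilon> D (10 ^ 5 * c * (real d + ln (1 / \<epsilon>)) ^ 4) (1 / c * \<epsilon>)
          (1 / (10 ^ 215 * (real d + ln (1 / \<epsilon>)) ^ 2)))"
    using c by auto
  then show ?thesis by blast
qed

end
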